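(* Let $k$ be a field with $\operatorname{char}k=p>0$. Let $\Sigma$ be a rational pointed fan in $\mathbb{R}^d$ ($d\ge 1$), and $\mathcal{M}=(M_C)_{C\in\Sigma}$ a seminormal monoidal complex supported on $\Sigma$. The following statements are equivalent: (i) for each maximal cone $C\in\Sigma$, the monoid ring $k[M_C]$ is $F$-pure (equivalently, $F$-injective); (ii) for each maximal cone $C\in\Sigma$ and each face $D\subseteq C$, the prime ideal $(p)$ is not associated to the $\mathbb{Z}$-module $(\mathbb{Z}M_C\cap\mathbb{R}M_D)/\mathbb{Z}M_D$; (iii) $k[\mathcal{M}]$ is $F$-split; (iv) $k[\mathcal{M}]$ is $F$-pure.
   Context: Cones: a cone in $\mathbb{R}^d$ is a finite intersection of closed half-spaces bounded by hyperplanes through the origin. It is rational if the hyperplanes can be defined by homogeneous linear equations with integer coefficients. A face of a cone $C$ is $C$ itself or the intersection of $C$ with a supporting hyperplane through the origin. $C$ is pointed if $\{0\}$ is a face of $C$. All cones are rational and pointed. Monoids: an affine monoid is a finitely generated submonoid $M$ of some $\mathbb{Z}^d$; $\mathbb{Z}M$ is the subgroup it generates, $\mathbb{R}M$ its real linear span and $\mathbb{R}_+M$ the cone of nonnegative real combinations of its elements. $M$ is seminormal if every $x\in\mathbb{Z}M$ with $2x,3x\in M$ lies in $M$. $k[M]$ is the monoid algebra. Fans and monoidal complexes: a rational pointed fan $\Sigma$ in $\mathbb{R}^d$ is a finite nonempty set of rational pointed cones such that faces of members are members, and the intersection of two members is a common face of both. A maximal cone is one maximal with respect to inclusion in $\Sigma$.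 A monoidal complex $\mathcal{M}$ supported on $\Sigma$ is a family of affine monoids $(M_C)_{C\in\Sigma}$ with $M_C\subseteq C\cap\mathbb{Z}^d$, $\mathbb{R}_+M_C=C$, and $M_D=M_C\cap D$ whenever $D$ is a face of $C$. It is seminormal if all $M_C$ are seminormal. Put $|\mathcal{M}|=\bigcup_{C\in\Sigma}M_C$. Toric face ring: $k[\mathcal{M}]=\bigoplus_{a\in|\mathcal{M}|}k\,X^a$ as a $k$-vector space, with $X^a\cdot X^b=X^{a+b}$ if $a,b\in M_C$ for some $C\in\Sigma$, and $X^aX^b=0$ otherwise. Frobenius notions: let $R$ be $k[\mathcal{M}]$ or $k[M_C]$, with $\mathfrak{m}$ the ideal spanned by the nonconstant monomials, and let $F:R\to R$, $t\mapsto t^p$. $R$ is $F$-injective if for all $i$ the map induced by $F$ on $H^i_{\mathfrak{m}}(R)$ is injective; $F$-pure if $F(R)$ is a pure subring of $R$ (that is, $N\to N\otimes_{F(R)}R$ is injective for every $F(R)$-module $N$); $F$-split if $F(R)$ is a direct summand of $R$ as an $F(R)$-module. *)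

theory Defs
  imports
    "HOL-Analysis.Analysis"
    "HOL-Computational_Algebra.Group_Closure"
    "HOL-Algebra.Algebra"
begin

section \<open>Cones and fans\<close>

definition real_vec :: "int ^ 'd \<Rightarrow> real ^ 'd"
  where "real_vec x = (\<chi> i. real_of_int (x $ i))"

text \<open>A cone is given by a finite set of nonzero inner normals of half-spaces; it is rational
  if the normals can be chosen integral.\<close>

definition rational_cone :: "(real ^ 'd) set \<Rightarrow> bool"
  where "rational_cone C \<longleftrightarrow>
    (\<exists>H :: (int ^ 'd) set. finite H \<and> 0 \<notin> H \<and> C = {x. \<forall>a\<in>H. 0 \<le> real_vec a \<bullet> x})"

definition cone_face :: "(real ^ 'd) set \<Rightarrow> (real ^ 'd) set \<Rightarrow> bool"
  where "cone_face D C \<longleftrightarrow>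
    D = C \<or> (\<exists>a. a \<noteq> 0 \<and> (\<forall>x\<in>C. 0 \<le> a \<bullet> x) \<and> D = C \<inter> {x. a \<bullet> x = 0})"

definition pointed_cone :: "(real ^ 'd) set \<Rightarrow> bool"
  where "pointed_cone C \<longleftrightarrow> cone_face {0} C"

definition rational_pointed_fan :: "(real ^ 'd) set set \<Rightarrow> bool"
  where "rational_pointed_fan \<Sigma> \<longleftrightarrow>
    finite \<Sigma> \<and> \<Sigma> \<noteq> {} \<and>
    (\<forall>C\<in>\<Sigma>. rational_cone C \<and> pointed_cone C) \<and>
    (\<forall>C\<in>\<Sigma>. \<forall>D. cone_face D C \<longrightarrow> D \<in> \<Sigma>) \<and>
    (\<forall>C\<in>\<Sigma>. \<forall>D\<in>\<Sigma>. cone_face (C \<inter> D) C \<and> cone_face (C \<inter> D) D)"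

definition maximal_cones :: "(real ^ 'd) set set \<Rightarrow> (real ^ 'd) set set"
  where "maximal_cones \<Sigma> = {C \<in> \<Sigma>. \<not> (\<exists>D\<in>\<Sigma>. C \<subset> D)}"

section \<open>Affine monoids and monoidal complexes\<close>

definition add_submonoid :: "'a::monoid_add set \<Rightarrow> bool"
  where "add_submonoid M \<longleftrightarrow> 0 \<in> M \<and> (\<forall>x\<in>M. \<forall>y\<in>M. x + y \<in> M)"

definition affine_monoid :: "(int ^ 'd) set \<Rightarrow> bool"
  where "affine_monoid M \<longleftrightarrow> add_submonoid M \<and> (\<exists>G. finite G \<and> M = add_submonoid hull G)"

definition nonneg_span :: "(int ^ 'd) set \<Rightarrow> (real ^ 'd) set"
  where "nonneg_span M =
    {\<Sum>x\<in>F. c x *\<^sub>R real_vec x | F c. finite F \<and> F \<subseteq> M \<and> (\<forall>x\<in>F. (0::real) \<le> c x)}"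

definition seminormal :: "(int ^ 'd) set \<Rightarrow> bool"
  where "seminormal M \<longleftrightarrow> (\<forall>x\<in>group_closure M. 2 *s x \<in> M \<and> 3 *s x \<in> M \<longrightarrow> x \<in> M)"

definition monoidal_complex ::
    "(real ^ 'd) set set \<Rightarrow> ((real ^ 'd) set \<Rightarrow> (int ^ 'd) set) \<Rightarrow> bool"
  where "monoidal_complex \<Sigma> M \<longleftrightarrow>
    (\<forall>C\<in>\<Sigma>. affine_monoid (M C) \<and> real_vec ` M C \<subseteq> C \<and> nonneg_span (M C) = C) \<and>
    (\<forall>C\<in>\<Sigma>. \<forall>D. cone_face D C \<longrightarrow> M D = {x \<in> M C. real_vec x \<in> D})"

definition seminormal_complex ::
    "(real ^ 'd) set set \<Rightarrow> ((real ^ 'd) set \<Rightarrow> (int ^ 'd) set) \<Rightarrow> bool"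
  where "seminormal_complex \<Sigma> M \<longleftrightarrow> monoidal_complex \<Sigma> M \<and> (\<forall>C\<in>\<Sigma>. seminormal (M C))"

section \<open>Monoid rings and toric face rings\<close>

text \<open>The function with finite support taking the value \<open>c\<close> at \<open>a\<close> only is \<open>c X\<^sup>a\<close>; the product
  of finitely supported functions in \<open>HOL-Library.Poly_Mapping\<close> is convolution.\<close>

definition monoid_ring :: "(int ^ 'd) set \<Rightarrow> ((int ^ 'd) \<Rightarrow>\<^sub>0 'k::field) ring"
  where "monoid_ring M =
    \<lparr>carrier = {f. Poly_Mapping.keys f \<subseteq> M}, monoid.mult = (*), one = 1, ring.zero = 0, ring.add = (+)\<rparr>"

definition toric_face_ring ::
    "(real ^ 'd) set set \<Rightarrow> ((real ^ 'd) set \<Rightarrow> (int ^ 'd) set) \<Rightarrow> ((int ^ 'd) \<Rightarrow>\<^sub>0 'k::field) ring"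
  where "toric_face_ring \<Sigma> M =
    \<lparr>carrier = {f. Poly_Mapping.keys f \<subseteq> (\<Union>C\<in>\<Sigma>. M C)},
     monoid.mult = (\<lambda>f g. \<Sum>a\<in>Poly_Mapping.keys f. \<Sum>b\<in>Poly_Mapping.keys g.
       if \<exists>C\<in>\<Sigma>. a \<in> M C \<and> b \<in> M C
       then Poly_Mapping.single (a + b) (Poly_Mapping.lookup f a * Poly_Mapping.lookup g b) else 0),
     one = 1, ring.zero = 0, ring.add = (+)\<rparr>"

definition monomial_ideal :: "((int ^ 'd) \<Rightarrow>\<^sub>0 'k::field) ring \<Rightarrow> ((int ^ 'd) \<Rightarrow>\<^sub>0 'k) set"
  where "monomial_ideal R = {f \<in> carrier R. 0 \<notin> Poly_Mapping.keys f}"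

section \<open>Associated primes\<close>

definition associated_prime ::
    "('a, 'm) ring_scheme \<Rightarrow> ('a, 'b, 'n) module_scheme \<Rightarrow> 'a set \<Rightarrow> bool"
  where "associated_prime R N P \<longleftrightarrow> primeideal P R \<and>
    (\<exists>x\<in>carrier N. P = {r \<in> carrier R. r \<odot>\<^bsub>N\<^esub> x = \<zero>\<^bsub>N\<^esub>})"

definition additive_group :: "'a::ab_group_add set \<Rightarrow> 'a monoid"
  where "additive_group G = \<lparr>carrier = G, monoid.mult = (+), one = 0\<rparr>"

text \<open>An abelian group as a \<open>\<Z>\<close>-module. The multiplicative fields of a module record play no role.\<close>

definition int_module :: "('a, 'm) monoid_scheme \<Rightarrow> (int, 'a) module"
  where "int_module G =
    \<lparr>carrier = carrier G, monoid.mult = undefined, one = undefined,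
     ring.zero = \<one>\<^bsub>G\<^esub>, ring.add = (\<otimes>\<^bsub>G\<^esub>), module.smult = (\<lambda>n x. x [^]\<^bsub>G\<^esub> n)\<rparr>"

text \<open>The \<open>\<Z>\<close>-module \<open>(\<Z>M \<inter> \<real>N) / \<Z>N\<close>.\<close>

definition saturation_quotient :: "(int ^ 'd) set \<Rightarrow> (int ^ 'd) set \<Rightarrow> (int, (int ^ 'd) set) module"
  where "saturation_quotient M N =
    int_module (additive_group {x \<in> group_closure M. real_vec x \<in> span (real_vec ` N)}
      Mod group_closure N)"

section \<open>Tensor products and purity\<close>

definition tensor_relations ::
    "('a, 'm) ring_scheme \<Rightarrow> ('a, 'b, 'n) module_scheme \<Rightarrow> ('a, 'c, 'q) module_scheme
     \<Rightarrow> ('b \<times> 'c \<Rightarrow>\<^sub>0 int) set"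
  where "tensor_relations A N P =
    {frag_of (x \<oplus>\<^bsub>N\<^esub> x', y) - frag_of (x, y) - frag_of (x', y) | x x' y.
       x \<in> carrier N \<and> x' \<in> carrier N \<and> y \<in> carrier P} \<union>
    {frag_of (x, y \<oplus>\<^bsub>P\<^esub> y') - frag_of (x, y) - frag_of (x, y') | x y y'.
       x \<in> carrier N \<and> y \<in> carrier P \<and> y' \<in> carrier P} \<union>
    {frag_of (a \<odot>\<^bsub>N\<^esub> x, y) - frag_of (x, a \<odot>\<^bsub>P\<^esub> y) | a x y.
       a \<in> carrier A \<and> x \<in> carrier N \<and> y \<in> carrier P}"

text \<open>The pure tensor of \<open>x\<close> and \<open>y\<close> in \<open>N \<otimes>\<^sub>A P\<close>, the latter being the free abelian group on
  \<open>N \<times> P\<close> modulo the subgroup generated by the bilinearity relations.\<close>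

definition pure_tensor ::
    "('a, 'm) ring_scheme \<Rightarrow> ('a, 'b, 'n) module_scheme \<Rightarrow> ('a, 'c, 'q) module_scheme
     \<Rightarrow> 'b \<Rightarrow> 'c \<Rightarrow> ('b \<times> 'c \<Rightarrow>\<^sub>0 int) set"
  where "pure_tensor A N P x y =
    (let G = free_Abelian_group (carrier N \<times> carrier P)
     in generate G (tensor_relations A N P) #>\<^bsub>G\<^esub> frag_of (x, y))"

definition self_module :: "('a, 'm) ring_scheme \<Rightarrow> ('a, 'a) module"
  where "self_module R =
    \<lparr>carrier = carrier R, monoid.mult = (\<otimes>\<^bsub>R\<^esub>), one = \<one>\<^bsub>R\<^esub>, ring.zero = \<zero>\<^bsub>R\<^esub>, ring.add = (\<oplus>\<^bsub>R\<^esub>),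
     module.smult = (\<otimes>\<^bsub>R\<^esub>)\<rparr>"

text \<open>Purity of a subring \<open>A\<close> of \<open>R\<close> quantifies over all \<open>A\<close>-modules. A formula cannot quantify over
  types, so the carriers range over the type \<open>'u + (nat \<Rightarrow> 'a) set\<close> with \<open>'u\<close> a parameter. Instances
  of \<open>'u\<close> provide modules of any size. The right-hand summand contains, whatever \<open>'u\<close> is, a copy of
  every finitely generated module (as a set of cosets in some \<open>A\<^sup>n\<close>); as an element
  killed in \<open>N \<otimes> R\<close> is already killed in \<open>N' \<otimes> R\<close> for a finitely generated submodule \<open>N'\<close> of \<open>N\<close>,
  the notion does not depend on \<open>'u\<close>.\<close>

definition pure_subring :: "'u itself \<Rightarrow> 'a set \<Rightarrow> ('a, 'm) ring_scheme \<Rightarrow> bool"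
  where "pure_subring u A R \<longleftrightarrow> subring A R \<and>
    (\<forall>N :: ('a, 'u + (nat \<Rightarrow> 'a) set) module. Module.module (R\<lparr>carrier := A\<rparr>) N \<longrightarrow>
       inj_on (\<lambda>x. pure_tensor (R\<lparr>carrier := A\<rparr>) N (self_module R) x \<one>\<^bsub>R\<^esub>) (carrier N))"

definition direct_summand ::
    "('a, 'm) ring_scheme \<Rightarrow> ('a, 'b, 'n) module_scheme \<Rightarrow> 'b set \<Rightarrow> bool"
  where "direct_summand A N H \<longleftrightarrow> submodule H A N \<and>
    (\<exists>Q. submodule Q A N \<and> H \<inter> Q = {\<zero>\<^bsub>N\<^esub>} \<and> H <+>\<^bsub>N\<^esub> Q = carrier N)"

section \<open>Local cohomology\<close>

text \<open>The localization of \<open>R\<close> at the powers of \<open>f\<close>; \<open>fraction R f a m\<close> is \<open>a / f\<^sup>m\<close>.\<close>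

definition fraction_rel :: "('a, 'm) ring_scheme \<Rightarrow> 'a \<Rightarrow> (('a \<times> nat) \<times> ('a \<times> nat)) set"
  where "fraction_rel R f =
    {((a, m), (b, n)). a \<in> carrier R \<and> b \<in> carrier R \<and>
       (\<exists>l::nat. f [^]\<^bsub>R\<^esub> l \<otimes>\<^bsub>R\<^esub> (f [^]\<^bsub>R\<^esub> n \<otimes>\<^bsub>R\<^esub> a) = f [^]\<^bsub>R\<^esub> l \<otimes>\<^bsub>R\<^esub> (f [^]\<^bsub>R\<^esub> m \<otimes>\<^bsub>R\<^esub> b))}"

definition fraction :: "('a, 'm) ring_scheme \<Rightarrow> 'a \<Rightarrow> 'a \<Rightarrow> nat \<Rightarrow> ('a \<times> nat) set"
  where "fraction R f a m = fraction_rel R f `` {(a, m)}"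

definition localization :: "('a, 'm) ring_scheme \<Rightarrow> 'a \<Rightarrow> ('a \<times> nat) set ring"
  where "localization R f =
    \<lparr>carrier = (carrier R \<times> UNIV) // fraction_rel R f,
     monoid.mult = (\<lambda>S T. \<Union>(a, m)\<in>S. \<Union>(b, n)\<in>T. fraction R f (a \<otimes>\<^bsub>R\<^esub> b) (m + n)),
     one = fraction R f \<one>\<^bsub>R\<^esub> 0,
     ring.zero = fraction R f \<zero>\<^bsub>R\<^esub> 0,
     ring.add = (\<lambda>S T. \<Union>(a, m)\<in>S. \<Union>(b, n)\<in>T.
       fraction R f (f [^]\<^bsub>R\<^esub> n \<otimes>\<^bsub>R\<^esub> a \<oplus>\<^bsub>R\<^esub> f [^]\<^bsub>R\<^esub> m \<otimes>\<^bsub>R\<^esub> b) (m + n))\<rparr>"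

text \<open>The canonical map from the localization at \<open>f\<close> to the localization at \<open>f g\<close>.\<close>

definition localization_map ::
    "('a, 'm) ring_scheme \<Rightarrow> 'a \<Rightarrow> 'a \<Rightarrow> ('a \<times> nat) set \<Rightarrow> ('a \<times> nat) set"
  where "localization_map R f g S =
    (\<Union>(a, m)\<in>S. fraction R (f \<otimes>\<^bsub>R\<^esub> g) (a \<otimes>\<^bsub>R\<^esub> g [^]\<^bsub>R\<^esub> m) m)"

text \<open>The \<open>i\<close>-th term of the Cech complex of a sequence \<open>xs\<close> is the product of the localizations
  at \<open>\<Prod>j\<in>I. xs ! j\<close> over all sets \<open>I\<close> of \<open>i\<close> positions; on the component \<open>J\<close>, the differential
  is the alternating sum of the canonical maps from the components \<open>J - {j}\<close>.\<close>

definition position_sets :: "'a list \<Rightarrow> nat \<Rightarrow> nat set set"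
  where "position_sets xs i = {I. I \<subseteq> {..<length xs} \<and> card I = i}"

definition list_subprod :: "('a, 'm) ring_scheme \<Rightarrow> 'a list \<Rightarrow> nat set \<Rightarrow> 'a"
  where "list_subprod R xs I = (\<Otimes>\<^bsub>R\<^esub>j\<in>I. xs ! j)"

definition cech_group ::
    "('a, 'm) ring_scheme \<Rightarrow> 'a list \<Rightarrow> nat \<Rightarrow> (nat set \<Rightarrow> ('a \<times> nat) set) monoid"
  where "cech_group R xs i =
    product_group (position_sets xs i) (\<lambda>I. add_monoid (localization R (list_subprod R xs I)))"

definition cech_differential ::
    "('a, 'm) ring_scheme \<Rightarrow> 'a list \<Rightarrow> nat
     \<Rightarrow> (nat set \<Rightarrow> ('a \<times> nat) set) \<Rightarrow> (nat set \<Rightarrow> ('a \<times> nat) set)"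
  where "cech_differential R xs i c =
    (\<lambda>J\<in>position_sets xs (Suc i). \<Oplus>\<^bsub>localization R (list_subprod R xs J)\<^esub>j\<in>J.
       [((-1) ^ card {l \<in> J. l < j} :: int)] \<cdot>\<^bsub>localization R (list_subprod R xs J)\<^esub>
         localization_map R (list_subprod R xs (J - {j})) (xs ! j) (c (J - {j})))"

definition cech_cocycles ::
    "('a, 'm) ring_scheme \<Rightarrow> 'a list \<Rightarrow> nat \<Rightarrow> (nat set \<Rightarrow> ('a \<times> nat) set) set"
  where "cech_cocycles R xs i =
    kernel (cech_group R xs i) (cech_group R xs (Suc i)) (cech_differential R xs i)"

definition cech_coboundaries ::
    "('a, 'm) ring_scheme \<Rightarrow> 'a list \<Rightarrow> nat \<Rightarrow> (nat set \<Rightarrow> ('a \<times> nat) set) set"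
  where "cech_coboundaries R xs i =
    (case i of 0 \<Rightarrow> {\<one>\<^bsub>cech_group R xs 0\<^esub>}
     | Suc j \<Rightarrow> cech_differential R xs j ` carrier (cech_group R xs j))"

definition local_cohomology ::
    "('a, 'm) ring_scheme \<Rightarrow> 'a list \<Rightarrow> nat \<Rightarrow> (nat set \<Rightarrow> ('a \<times> nat) set) set monoid"
  where "local_cohomology R xs i =
    (cech_group R xs i)\<lparr>carrier := cech_cocycles R xs i\<rparr> Mod cech_coboundaries R xs i"

text \<open>The Frobenius of \<open>R\<close> induces the \<open>p\<close>-th power map on each localization of \<open>R\<close>, hence an
  endomorphism of the Cech complex and of its cohomology.\<close>

definition cech_frobenius ::
    "('a, 'm) ring_scheme \<Rightarrow> nat \<Rightarrow> 'a list \<Rightarrow> nat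
     \<Rightarrow> (nat set \<Rightarrow> ('a \<times> nat) set) \<Rightarrow> (nat set \<Rightarrow> ('a \<times> nat) set)"
  where "cech_frobenius R p xs i c =
    (\<lambda>I\<in>position_sets xs i. c I [^]\<^bsub>localization R (list_subprod R xs I)\<^esub> p)"

definition local_cohomology_frobenius ::
    "('a, 'm) ring_scheme \<Rightarrow> nat \<Rightarrow> 'a list \<Rightarrow> nat
     \<Rightarrow> (nat set \<Rightarrow> ('a \<times> nat) set) set \<Rightarrow> (nat set \<Rightarrow> ('a \<times> nat) set) set"
  where "local_cohomology_frobenius R p xs i Z =
    the_elem ((\<lambda>z. cech_coboundaries R xs i #>\<^bsub>cech_group R xs i\<^esub> cech_frobenius R p xs i z) ` Z)"

section \<open>Frobenius singularities\<close>

definition frobenius_image :: "nat \<Rightarrow> ('a, 'm) ring_scheme \<Rightarrow> 'a set"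
  where "frobenius_image p R = (\<lambda>t. t [^]\<^bsub>R\<^esub> p) ` carrier R"

text \<open>Local cohomology with support in a finitely generated ideal of a Noetherian ring is the
  cohomology of the Cech complex of any finite generating sequence, and the choice is immaterial
  up to isomorphism compatible with Frobenius. The rings in question are Noetherian, so
  generating sequences of \<open>\<mm>\<close> exist.\<close>

definition F_injective :: "nat \<Rightarrow> ('a, 'm) ring_scheme \<Rightarrow> 'a set \<Rightarrow> bool"
  where "F_injective p R \<mm> \<longleftrightarrow>
    (\<forall>xs. set xs \<subseteq> carrier R \<and> Idl\<^bsub>R\<^esub> (set xs) = \<mm> \<longrightarrow>
      (\<forall>i. inj_on (local_cohomology_frobenius R p xs i) (carrier (local_cohomology R xs i))))"

definition F_pure :: "'u itself \<Rightarrow> nat \<Rightarrow> ('a, 'm) ring_scheme \<Rightarrow> bool"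
  where "F_pure u p R \<longleftrightarrow> pure_subring u (frobenius_image p R) R"

definition F_split :: "nat \<Rightarrow> ('a, 'm) ring_scheme \<Rightarrow> bool"
  where "F_split p R \<longleftrightarrow>
    direct_summand (R\<lparr>carrier := frobenius_image p R\<rparr>) (self_module R) (frobenius_image p R)"

end

theory Submission
  imports Defs
begin

text \<open>The equivalences are organized around one arithmetic condition. For a cone \<open>C\<close> and a face \<open>D\<close>, call an
  element of the group of \<open>M C\<close> in the real span of \<open>M D\<close> torsion if it is not in the group of \<open>M D\<close> but its
  \<open>p\<close>-fold multiple is. The second statement says that there is no torsion
  (\<open>associated_prime_iff_torsion\<close>), and each of the other properties is compared with the absence of
  torsion. The geometric input is that a seminormal monoid contains every element of its group that lies in
  the interior of its cone (\<open>seminormal_interior\<close>).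

  If there is no torsion, a splitting of the Frobenius is given by \<open>c X\<^sup>a \<mapsto> \<lambda>(c) X\<^bsup>a/p\<^esup>\<close>, read as zero if
  \<open>a / p\<close> is not an exponent of the ring, where \<open>\<lambda>\<close> splits the Frobenius of the field. This is linear over the
  Frobenius if \<open>p a + b = p e\<close> forces \<open>b / p\<close> to be an exponent. Now \<open>b / p\<close> is an interior point
  of the smallest face that contains \<open>b\<close>; it belongs to the group of that face as there is no torsion, and
  thus to its monoid (\<open>no_torsion_imp_root\<close>, \<open>root_closed_imp_splitting\<close>). A splitting implies
  F-splitness and F-purity, and, as it extends to localizations, F-injectivity.

  Conversely, F-splitness and F-purity imply that every equation \<open>f\<^sup>p = g\<^sup>p r\<close> comes from
  a multiple of \<open>g\<close> by taking \<open>p\<close>-th powers. A torsion element, translated into the interior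
  of its face and written as \<open>u - v\<close>, contradicts this for \<open>f = X\<^sup>u\<close> and \<open>g = X\<^sup>v\<close>
  (\<open>contracted_imp_difference_mem\<close>, \<open>difference_closed_imp_no_torsion\<close>).

  For F-injectivity, let \<open>D\<close> be maximal among the faces with torsion and let \<open>a\<close> be a torsion element
  with \<open>- a\<close> in the interior of \<open>D\<close>. The homogeneous parts of degree \<open>a\<close> and \<open>p a\<close> of the
  Cech complex on monomial generators are cochain complexes of families of index sets: those
  whose smallest face contains \<open>D\<close> properly, and those whose smallest face contains \<open>D\<close>. The
  second family is acyclic (\<open>acyclic_meeting\<close>), while the sets whose smallest face is \<open>D\<close> are not
  (\<open>not_acyclic_meeting\<close>). The connecting map therefore produces a nonzero class in degree \<open>a\<close>
  that the Frobenius sends to zero (\<open>frobenius_not_injective\<close>). Both facts about families of index sets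
  follow by moving a point across the hyperplanes of the cone, one at a time, and comparing the
  families before and after.\<close>


section \<open>Cochains on families of finite sets\<close>

definition cosign :: "nat \<Rightarrow> nat set \<Rightarrow> 'k::comm_ring_1"
  where "cosign j J = (-1) ^ card {l \<in> J. l < j}"

definition coboundary :: "(nat set \<Rightarrow> 'k::comm_ring_1) \<Rightarrow> nat set \<Rightarrow> 'k"
  where "coboundary \<phi> J = (\<Sum>j\<in>J. cosign j J * \<phi> (J - {j}))"

definition supported :: "nat set set \<Rightarrow> (nat set \<Rightarrow> 'k::zero) \<Rightarrow> bool"
  where "supported \<F> \<phi> \<longleftrightarrow> (\<forall>I. I \<notin> \<F> \<longrightarrow> \<phi> I = 0)"

definition restrict_to :: "nat set set \<Rightarrow> (nat set \<Rightarrow> 'k::zero) \<Rightarrow> nat set \<Rightarrow> 'k"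
  where "restrict_to \<F> \<phi> I = (if I \<in> \<F> then \<phi> I else 0)"

text \<open>Convex families are the differences of two simplicial complexes. Convexity is what makes the
  coboundary followed by restriction to the family square to zero.\<close>

definition convex_family :: "nat set set \<Rightarrow> bool"
  where "convex_family \<F> \<longleftrightarrow>
    (\<forall>I\<in>\<F>. \<forall>K\<in>\<F>. \<forall>J. I \<subseteq> J \<longrightarrow> J \<subseteq> K \<longrightarrow> J \<in> \<F>) \<and> (\<forall>I\<in>\<F>. finite I)"

text \<open>Cochains of all degrees are treated at once; the coboundary raises the cardinality of the
  supporting sets by one, so this is exactness in every degree.\<close>

definition acyclic_family :: "'k::comm_ring_1 itself \<Rightarrow> nat set set \<Rightarrow> bool"
  where "acyclic_family _ \<F> \<longleftrightarrow>
    (\<forall>\<phi> :: nat set \<Rightarrow> 'k. supported \<F> \<phi> \<longrightarrow> (\<forall>J\<in>\<F>. coboundary \<phi> J = 0) \<longrightarrow>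
      (\<exists>\<psi>. supported \<F> \<psi> \<and> (\<forall>J\<in>\<F>. coboundary \<psi> J = \<phi> J)))"

lemma coboundary_diff: "coboundary (\<lambda>I. \<phi> I - \<psi> I) J = coboundary \<phi> J - coboundary \<psi> J"
  by (simp add: coboundary_def algebra_simps sum_subtractf)

lemma coboundary_cong: "(\<And>j. j \<in> J \<Longrightarrow> \<phi> (J - {j}) = \<psi> (J - {j})) \<Longrightarrow> coboundary \<phi> J = coboundary \<psi> J"
  by (simp add: coboundary_def)

lemma coboundary_eq_0: "(\<And>j. j \<in> J \<Longrightarrow> \<phi> (J - {j}) = 0) \<Longrightarrow> coboundary \<phi> J = 0"
  by (simp add: coboundary_def)

lemma cosign_swap:
  assumes "finite J" "j \<in> J" "l \<in> J" "j < l"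
  shows "cosign j J * cosign l (J - {j}) = - (cosign l J * cosign j (J - {l}) :: 'k::comm_ring_1)"
proof -
  define A where "A = {i \<in> J - {j}. i < l}"
  have A: "finite A" "j \<notin> A" using assms(1) by (auto simp: A_def)
  have a: "{i \<in> J. i < l} = insert j A" using assms by (auto simp: A_def)
  have b: "{i \<in> J - {l}. i < j} = {i \<in> J. i < j}" using assms(4) by auto
  have "card {i \<in> J. i < l} = Suc (card A)" using A unfolding a by (rule card_insert_disjoint)
  then show ?thesis unfolding cosign_def b A_def[symmetric] by simp
qed

text \<open>The terms for the ordered pairs \<open>(j, l)\<close> and \<open>(l, j)\<close> of removed elements cancel. Pairs are
  split by \<open>j < l\<close> and \<open>l < j\<close> because \<open>2\<close> may be zero in the coefficients.\<close>

lemma coboundary_coboundary: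
  assumes "finite J"
  shows "coboundary (coboundary \<phi>) J = (0::'k::comm_ring_1)"
proof -
  define f where "f = (\<lambda>(j, l). cosign j J * cosign l (J - {j}) * \<phi> (J - {j} - {l}))"
  define A where "A = {(j, l). j \<in> J \<and> l \<in> J \<and> j < l}"
  define B where "B = {(j, l). j \<in> J \<and> l \<in> J \<and> l < j}"
  have fin: "finite A" "finite B"
    using assms by (auto simp: A_def B_def intro: finite_subset[of _ "J \<times> J"])
  have "coboundary (coboundary \<phi>) J = (\<Sum>j\<in>J. \<Sum>l\<in>J - {j}. f (j, l))"
    by (simp add: coboundary_def f_def sum_distrib_left mult.assoc)
  also have "\<dots> = sum f (SIGMA j:J. J - {j})"
    using assms by (subst sum.Sigma) auto
  also have "\<dots> = sum f (A \<union> B)"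
  proof (rule arg_cong[of _ _ "sum f"], rule Set.set_eqI)
    fix x :: "nat \<times> nat"
    obtain j l where x: "x = (j, l)" by (cases x)
    have "j \<noteq> l \<longleftrightarrow> j < l \<or> l < j" by (rule neq_iff)
    then show "x \<in> (SIGMA j:J. J - {j}) \<longleftrightarrow> x \<in> A \<union> B"
      unfolding x A_def B_def by blast
  qed
  also have "\<dots> = sum f A + sum f B"
  proof (rule sum.union_disjoint[OF fin])
    show "A \<inter> B = {}" unfolding A_def B_def using less_asym by blast
  qed
  also have "\<dots> = sum f A + sum (\<lambda>(j, l). f (l, j)) A"
    by (intro arg_cong2[of _ _ _ _ "(+)"] refl
        sum.reindex_bij_witness[where i="\<lambda>(j, l). (l, j)" and j="\<lambda>(j, l). (l, j)"])
      (auto simp: A_def B_def)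
  also have "\<dots> = (\<Sum>(j, l)\<in>A. f (j, l) + f (l, j))"
    by (simp add: sum.distrib case_prod_unfold)
  also have "\<dots> = 0"
  proof (rule sum.neutral, clarify)
    fix j l assume "(j, l) \<in> A"
    then have "cosign j J * cosign l (J - {j}) = - (cosign l J * cosign j (J - {l}) :: 'k)"
      using cosign_swap assms by (auto simp: A_def)
    moreover have "\<phi> (J - {j} - {l}) = \<phi> (J - {l} - {j})" by (simp add: Diff_insert2[symmetric] insert_commute)
    ultimately show "f (j, l) + f (l, j) = 0" unfolding f_def prod.case by simp
  qed
  finally show ?thesis .
qed

text \<open>By convexity a set \<open>J - {j}\<close> outside the family has no subset in the family at all, so the
  intermediate coboundary already vanishes there and cutting it off changes nothing.\<close>

lemma coboundary_restricted_coboundary: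
  assumes "convex_family \<F>" "supported \<F> \<phi>" "J \<in> \<F>"
  shows "coboundary (restrict_to \<F> (coboundary \<phi>)) J = 0"
proof -
  have "restrict_to \<F> (coboundary \<phi>) (J - {j}) = coboundary \<phi> (J - {j})" for j
  proof (cases "J - {j} \<in> \<F>")
    case False
    have "coboundary \<phi> (J - {j}) = 0"
    proof (rule coboundary_eq_0)
      fix l
      have "J - {j} - {l} \<notin> \<F>"
        using False assms(1,3) unfolding convex_family_def by (meson Diff_subset)
      then show "\<phi> (J - {j} - {l}) = 0" using assms(2) by (simp add: supported_def)
    qed
    then show ?thesis using False by (simp add: restrict_to_def)
  qed (simp add: restrict_to_def)
  then have "coboundary (restrict_to \<F> (coboundary \<phi>)) J = coboundary (coboundary \<phi>) J"
    by (rule coboundary_cong)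
  also have "\<dots> = 0"
    using assms(1,3) unfolding convex_family_def by (intro coboundary_coboundary) blast
  finally show ?thesis .
qed

lemma acyclic_empty: "acyclic_family k {}"
  by (auto simp: acyclic_family_def)

text \<open>The full simplex is contracted by coning with one vertex. Taking the least vertex \<open>v\<close> makes its
  sign \<open>1\<close> in every set that contains it.\<close>

lemma acyclic_Pow:
  assumes "finite W" "W \<noteq> {}"
  shows "acyclic_family (k :: 'k::comm_ring_1 itself) (Pow W)"
  unfolding acyclic_family_def
proof (intro allI impI)
  fix \<phi> :: "nat set \<Rightarrow> 'k"
  assume supp: "supported (Pow W) \<phi>" and closed: "\<forall>J\<in>Pow W. coboundary \<phi> J = 0"
  define v where "v = Min W"
  have v: "v \<in> W" "\<And>w. w \<in> W \<Longrightarrow> v \<le> w" using assms by (auto simp: v_def)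
  define \<psi> where "\<psi> I = (if I \<subseteq> W \<and> v \<notin> I then \<phi> (insert v I) else 0)" for I
  have sv: "cosign v J = (1::'k)" if "J \<subseteq> W" for J
  proof -
    have *: "{l \<in> J. l < v} = {}" using v(2) that by force
    show ?thesis unfolding cosign_def * by simp
  qed
  have sj: "cosign j (insert v J) = (- cosign j J :: 'k)" if "J \<subseteq> W" "v \<notin> J" "j \<in> J" for j J
  proof -
    have "v < j" using v(2)[of j] that by (metis le_neq_implies_less subsetD)
    then have "{l \<in> insert v J. l < j} = insert v {l \<in> J. l < j}" by auto
    moreover have "finite J" using that assms finite_subset by blast
    ultimately show ?thesis using that by (simp add: cosign_def)
  qed
  have "coboundary \<psi> J = \<phi> J" if J: "J \<subseteq> W" for J
  proof (cases "v \<in> J")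
    case True
    have fin: "finite J" using J assms finite_subset by blast
    have "coboundary \<psi> J = cosign v J * \<psi> (J - {v}) + (\<Sum>j\<in>J - {v}. cosign j J * \<psi> (J - {j}))"
      using True fin by (simp add: coboundary_def sum.remove)
    moreover have "(\<Sum>j\<in>J - {v}. cosign j J * \<psi> (J - {j})) = 0"
      using True by (intro sum.neutral) (auto simp: \<psi>_def)
    moreover have "\<psi> (J - {v}) = \<phi> J"
      using J True by (auto simp: \<psi>_def insert_absorb)
    ultimately show ?thesis using sv[OF J] by simp
  next
    case False
    have fin: "finite J" using J assms finite_subset by blast
    have "0 = coboundary \<phi> (insert v J)" using closed J v(1) by auto
    also have "\<dots> = cosign v (insert v J) * \<phi> (insert v J - {v})
        + (\<Sum>j\<in>J. cosign j (insert v J) * \<phi> (insert v J - {j}))"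
      using False fin by (simp add: coboundary_def)
    finally have 0: "0 = cosign v (insert v J) * \<phi> (insert v J - {v})
        + (\<Sum>j\<in>J. cosign j (insert v J) * \<phi> (insert v J - {j}))" .
    have "(\<Sum>j\<in>J. cosign j (insert v J) * \<phi> (insert v J - {j})) = (\<Sum>j\<in>J. - (cosign j J * \<psi> (J - {j})))"
    proof (rule sum.cong[OF refl])
      fix j assume j: "j \<in> J"
      then have "insert v J - {j} = insert v (J - {j})" using False by auto
      moreover have "J - {j} \<subseteq> W" using J by auto
      ultimately show "cosign j (insert v J) * \<phi> (insert v J - {j}) = - (cosign j J * \<psi> (J - {j}))"
        using sj[OF J False j] False by (simp add: \<psi>_def)
    qed
    also have "\<dots> = - coboundary \<psi> J" by (simp add: coboundary_def sum_negf)
    finally show ?thesis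
      using 0 sv[of "insert v J"] J v(1) False by simp
  qed
  moreover have "supported (Pow W) \<psi>" by (auto simp: supported_def \<psi>_def)
  ultimately show "\<exists>\<psi>. supported (Pow W) \<psi> \<and> (\<forall>J\<in>Pow W. coboundary \<psi> J = \<phi> J)" by auto
qed

text \<open>The complex is the coefficient ring in degree zero. It is the only source of nontrivial
  cohomology below: larger families inherit theirs from it.\<close>

lemma not_acyclic_singleton_empty: "\<not> acyclic_family (k :: 'k::comm_ring_1 itself) {{}}"
proof
  assume *: "acyclic_family k {{}}"
  let ?\<phi> = "\<lambda>I::nat set. if I = {} then 1 else (0::'k)"
  have "\<exists>\<psi>. supported {{}} \<psi> \<and> (\<forall>J\<in>{{}}. coboundary \<psi> J = ?\<phi> J)"
    using *[unfolded acyclic_family_def, rule_format, of ?\<phi>]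
    by (simp add: supported_def coboundary_def)
  then show False by (simp add: coboundary_def)
qed

text \<open>If \<open>\<A>\<close> is an upper part of a convex family, its cochains form a subcomplex whose quotient is
  the complex of the complementary lower part \<open>\<B>\<close>. The results of this locale are the pieces of
  the resulting long exact sequence that the argument uses.\<close>

locale split_family =
  fixes \<A> \<B> :: "nat set set"
  assumes convex: "convex_family (\<A> \<union> \<B>)"
    and disj: "\<A> \<inter> \<B> = {}"
    and up: "I \<in> \<A> \<Longrightarrow> J \<in> \<A> \<union> \<B> \<Longrightarrow> I \<subseteq> J \<Longrightarrow> J \<in> \<A>"
begin

lemma coboundary_lower:
  assumes "supported (\<A> \<union> \<B>) \<phi>" "J \<in> \<B>"
  shows "coboundary (restrict_to \<B> \<phi>) J = coboundary \<phi> J"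
proof (rule coboundary_cong)
  fix j
  have "J - {j} \<notin> \<A>" using up[of "J - {j}" J] assms(2) disj by auto
  then show "restrict_to \<B> \<phi> (J - {j}) = \<phi> (J - {j})"
    using assms(1) by (auto simp: restrict_to_def supported_def)
qed

lemma acyclic_upper:
  assumes "acyclic_family (k :: 'k::comm_ring_1 itself) (\<A> \<union> \<B>)" "acyclic_family k \<B>"
  shows "acyclic_family k \<A>"
  unfolding acyclic_family_def
proof (intro allI impI)
  fix \<phi> :: "nat set \<Rightarrow> 'k"
  assume supp: "supported \<A> \<phi>" and closed: "\<forall>J\<in>\<A>. coboundary \<phi> J = 0"
  have s: "supported (\<A> \<union> \<B>) \<phi>" using supp by (auto simp: supported_def)
  have z: "restrict_to \<B> \<phi> = (\<lambda>_. 0)"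
    using supp disj by (auto simp: restrict_to_def supported_def fun_eq_iff)
  have "coboundary \<phi> J = 0" if "J \<in> \<B>" for J
    using coboundary_lower[OF s that] by (simp add: z coboundary_eq_0)
  then obtain \<psi> where \<psi>: "supported (\<A> \<union> \<B>) \<psi>" "\<And>J. J \<in> \<A> \<union> \<B> \<Longrightarrow> coboundary \<psi> J = \<phi> J"
    using assms(1) s closed unfolding acyclic_family_def by blast
  have "coboundary (restrict_to \<B> \<psi>) J = 0" if "J \<in> \<B>" for J
  proof -
    have "coboundary (restrict_to \<B> \<psi>) J = \<phi> J"
      using coboundary_lower[OF \<psi>(1) that] \<psi>(2)[of J] that by simp
    then show ?thesis using supp disj that by (auto simp: supported_def)
  qed
  moreover have "supported \<B> (restrict_to \<B> \<psi>)" by (auto simp: supported_def restrict_to_def)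
  ultimately obtain \<eta> where \<eta>: "supported \<B> \<eta>" "\<And>J. J \<in> \<B> \<Longrightarrow> coboundary \<eta> J = restrict_to \<B> \<psi> J"
    using assms(2) unfolding acyclic_family_def by blast
  have s\<eta>: "supported (\<A> \<union> \<B>) \<eta>" using \<eta>(1) by (auto simp: supported_def)
  define \<psi>' where "\<psi>' I = \<psi> I - restrict_to (\<A> \<union> \<B>) (coboundary \<eta>) I" for I
  have "supported \<A> \<psi>'"
    unfolding supported_def
  proof (intro allI impI)
    fix I assume "I \<notin> \<A>"
    then show "\<psi>' I = 0"
      using \<psi>(1) \<eta>(2)[of I] by (cases "I \<in> \<B>") (auto simp: \<psi>'_def restrict_to_def supported_def)
  qed
  moreover have "coboundary \<psi>' J = \<phi> J" if "J \<in> \<A>" for J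
    using coboundary_restricted_coboundary[OF convex s\<eta>, of J] \<psi>(2)[of J] that
    unfolding \<psi>'_def by (simp add: coboundary_diff)
  ultimately show "\<exists>\<psi>. supported \<A> \<psi> \<and> (\<forall>J\<in>\<A>. coboundary \<psi> J = \<phi> J)" by blast
qed

text \<open>The coboundary of a cocycle \<open>e\<close> of the quotient represents the image of \<open>e\<close> under the connecting
  map. If it is trivial on \<open>\<A>\<close>, then \<open>e - e'\<close> is a cocycle of the whole, acyclic complex, and a
  cochain bounding it restricts to one bounding \<open>e\<close>.\<close>

lemma connecting_injective:
  assumes ac: "acyclic_family (k :: 'k::comm_ring_1 itself) (\<A> \<union> \<B>)"
    and e: "supported \<B> (e :: nat set \<Rightarrow> 'k)" "\<And>J. J \<in> \<B> \<Longrightarrow> coboundary e J = 0"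
    and e': "supported \<A> e'" "\<And>J. J \<in> \<A> \<Longrightarrow> coboundary e' J = coboundary e J"
  obtains \<psi> where "supported \<B> \<psi>" "\<And>J. J \<in> \<B> \<Longrightarrow> coboundary \<psi> J = e J"
proof -
  define \<phi> where "\<phi> I = e I - e' I" for I
  have s: "supported (\<A> \<union> \<B>) \<phi>" "supported (\<A> \<union> \<B>) e'"
    using e(1) e'(1) by (auto simp: supported_def \<phi>_def)
  have z: "restrict_to \<B> e' = (\<lambda>_. 0)"
    using e'(1) disj by (auto simp: restrict_to_def supported_def fun_eq_iff)
  have "coboundary e' J = 0" if "J \<in> \<B>" for J
    using coboundary_lower[OF s(2) that] by (simp add: z coboundary_eq_0)
  then have "coboundary \<phi> J = 0" if "J \<in> \<A> \<union> \<B>" for J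
    using that e(2) e'(2) unfolding \<phi>_def by (auto simp: coboundary_diff)
  then obtain \<psi> where \<psi>: "supported (\<A> \<union> \<B>) \<psi>" "\<And>J. J \<in> \<A> \<union> \<B> \<Longrightarrow> coboundary \<psi> J = \<phi> J"
    using ac s(1) unfolding acyclic_family_def by blast
  have "coboundary (restrict_to \<B> \<psi>) J = e J" if "J \<in> \<B>" for J
  proof -
    have "e' J = 0" using e'(1) disj that by (auto simp: supported_def)
    then show ?thesis using coboundary_lower[OF \<psi>(1) that] \<psi>(2)[of J] that by (simp add: \<phi>_def)
  qed
  moreover have "supported \<B> (restrict_to \<B> \<psi>)" by (auto simp: supported_def restrict_to_def)
  ultimately show ?thesis using that by blast
qed

lemma acyclic_lower:
  assumes "acyclic_family (k :: 'k::comm_ring_1 itself) (\<A> \<union> \<B>)" "acyclic_family k \<A>"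
  shows "acyclic_family k \<B>"
  unfolding acyclic_family_def
proof (intro allI impI)
  fix e :: "nat set \<Rightarrow> 'k"
  assume e: "supported \<B> e" "\<forall>J\<in>\<B>. coboundary e J = 0"
  have s: "supported (\<A> \<union> \<B>) e" using e(1) by (auto simp: supported_def)
  have 0: "restrict_to (\<A> \<union> \<B>) (coboundary e) = restrict_to \<A> (coboundary e)"
    using e(2) by (auto simp: restrict_to_def fun_eq_iff)
  have "coboundary (restrict_to \<A> (coboundary e)) J = 0" if "J \<in> \<A>" for J
    using coboundary_restricted_coboundary[OF convex s, of J] that by (simp add: 0)
  moreover have "supported \<A> (restrict_to \<A> (coboundary e))" by (auto simp: supported_def restrict_to_def)
  ultimately obtain e' where e': "supported \<A> e'"
      "\<And>J. J \<in> \<A> \<Longrightarrow> coboundary e' J = restrict_to \<A> (coboundary e) J"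
    using assms(2) unfolding acyclic_family_def by blast
  have e'2: "coboundary e' J = coboundary e J" if "J \<in> \<A>" for J
    using e'(2)[OF that] that by (simp add: restrict_to_def)
  show "\<exists>\<psi>. supported \<B> \<psi> \<and> (\<forall>J\<in>\<B>. coboundary \<psi> J = e J)"
  proof (rule connecting_injective[OF assms(1) e(1) _ e'(1) e'2])
    show "coboundary e J = 0" if "J \<in> \<B>" for J using e(2) that by simp
  qed blast+
qed

end

text \<open>Cech cohomology is taken one degree at a time, so a nontrivial cocycle concentrated in a single
  cardinality is needed. If all homogeneous parts were coboundaries, so would be their sum.\<close>

lemma homogeneous_nontrivial_cocycle:
  assumes "\<not> acyclic_family (k :: 'k::comm_ring_1 itself) \<F>" "\<F> \<subseteq> Pow W" "finite W"
  obtains i and e :: "nat set \<Rightarrow> 'k::comm_ring_1" where "supported \<F> e" "\<And>I. card I \<noteq> i \<Longrightarrow> e I = 0"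
    "\<And>J. J \<in> \<F> \<Longrightarrow> coboundary e J = 0"
    "\<nexists>\<psi>. supported \<F> \<psi> \<and> (\<forall>J\<in>\<F>. coboundary \<psi> J = e J)"
proof -
  obtain \<phi> :: "nat set \<Rightarrow> 'k" where \<phi>: "supported \<F> \<phi>" "\<And>J. J \<in> \<F> \<Longrightarrow> coboundary \<phi> J = 0"
    "\<nexists>\<psi>. supported \<F> \<psi> \<and> (\<forall>J\<in>\<F>. coboundary \<psi> J = \<phi> J)"
    using assms(1) unfolding acyclic_family_def by blast
  define e where "e i I = (if card I = i then \<phi> I else 0)" for i I
  have fin: "finite J" if "J \<in> \<F>" for J using that assms finite_subset by blast
  have s: "supported \<F> (e i)" for i using \<phi>(1) by (auto simp: supported_def e_def)
  have c: "coboundary (e i) J = 0" if J: "J \<in> \<F>" for i J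
  proof (cases "card J = Suc i")
    case True
    then have "coboundary (e i) J = coboundary \<phi> J"
      using fin[OF J] by (intro coboundary_cong) (simp add: e_def)
    then show ?thesis using \<phi>(2)[OF J] by simp
  next
    case False
    have "e i (J - {j}) = 0" if "j \<in> J" for j
    proof -
      have "card J = Suc (card (J - {j}))" using fin[OF J] that by (rule card.remove)
      then have "card (J - {j}) \<noteq> i" using False by simp
      then show ?thesis unfolding e_def by simp
    qed
    then show ?thesis by (rule coboundary_eq_0)
  qed
  have "\<exists>i. \<nexists>\<psi>. supported \<F> \<psi> \<and> (\<forall>J\<in>\<F>. coboundary \<psi> J = e i J)"
  proof (rule ccontr)
    assume "\<not> ?thesis"
    then have "\<forall>i. \<exists>\<psi>. supported \<F> \<psi> \<and> (\<forall>J\<in>\<F>. coboundary \<psi> J = e i J)" by simp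
    from choice[OF this] obtain \<Psi> where \<Psi>: "\<And>i. supported \<F> (\<Psi> i)"
        "\<And>i J. J \<in> \<F> \<Longrightarrow> coboundary (\<Psi> i) J = e i J"
      by blast
    define \<psi> where "\<psi> I = (\<Sum>i\<le>card W. \<Psi> i I)" for I
    have "supported \<F> \<psi>" using \<Psi>(1) by (auto simp: \<psi>_def supported_def)
    moreover have "coboundary \<psi> J = \<phi> J" if J: "J \<in> \<F>" for J
    proof -
      have "coboundary \<psi> J = (\<Sum>j\<in>J. \<Sum>i\<le>card W. cosign j J * \<Psi> i (J - {j}))"
        by (simp add: coboundary_def \<psi>_def sum_distrib_left)
      also have "\<dots> = (\<Sum>i\<le>card W. coboundary (\<Psi> i) J)"
        unfolding coboundary_def by (rule sum.swap)
      also have "\<dots> = (\<Sum>i\<le>card W. if card J = i then \<phi> J else 0)" using \<Psi>(2)[OF J] by (simp add: e_def)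
      also have "\<dots> = \<phi> J"
      proof -
        have "card J \<le> card W" using card_mono[OF assms(3), of J] assms(2) J by auto
        then show ?thesis by simp
      qed
      finally show ?thesis .
    qed
    ultimately show False using \<phi>(3) by blast
  qed
  then obtain i where "\<nexists>\<psi>. supported \<F> \<psi> \<and> (\<forall>J\<in>\<F>. coboundary \<psi> J = e i J)" by blast
  moreover have "e i I = 0" if "card I \<noteq> i" for I using that by (simp add: e_def)
  ultimately show ?thesis using that s c by blast
qed


section \<open>Families of vertex sets cut out by half-spaces\<close>

text \<open>The vectors \<open>Y j\<close> play the role of generators of the cone cut out by the half-spaces with inner
  normals \<open>H\<close>.\<close>

locale cone_vertices =
  fixes H :: "'a::real_inner set" and Y :: "nat \<Rightarrow> 'a" and V :: "nat set"
  assumes finite_H: "finite H" and finite_V: "finite V"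
    and vertex_nonneg: "j \<in> V \<Longrightarrow> a \<in> H \<Longrightarrow> 0 \<le> a \<bullet> Y j"
begin

text \<open>By \<open>eventually_in_cone\<close> below, \<open>I\<close> belongs to this family iff some \<open>b + n * (\<Sum>j\<in>I. Y j)\<close> lies in
  the cone. For a lattice point \<open>b\<close> these are the index sets whose localization has a
  component of degree \<open>b\<close>.\<close>

definition hitting :: "'a \<Rightarrow> nat set \<Rightarrow> nat set set"
  where "hitting b W = {I. I \<subseteq> W \<and> (\<forall>a\<in>H. a \<bullet> b < 0 \<longrightarrow> (\<exists>j\<in>I. 0 < a \<bullet> Y j))}"

text \<open>The index set of a face, described without facets or dimensions: every point of the cone that
  is in the span of the vertices in \<open>W\<close> is a nonnegative combination of them.\<close>

definition spans_face :: "nat set \<Rightarrow> bool"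
  where "spans_face W \<longleftrightarrow> W \<subseteq> V \<and>
    (\<forall>y\<in>span (Y ` W). (\<forall>a\<in>H. 0 \<le> a \<bullet> y) \<longrightarrow>
      (\<exists>c. (\<forall>j\<in>W. 0 \<le> c j) \<and> y = (\<Sum>j\<in>W. c j *\<^sub>R Y j)))"

lemma sum_in_span: "(\<Sum>j\<in>W. c j *\<^sub>R Y j) \<in> span (Y ` W)"
  by (intro span_sum span_scale span_base imageI)

lemma convex_hitting: "W \<subseteq> V \<Longrightarrow> convex_family (hitting b W)"
  unfolding convex_family_def
proof (intro conjI ballI allI impI)
  fix I J K assume "I \<in> hitting b W" "K \<in> hitting b W" "I \<subseteq> J" "J \<subseteq> K"
  then show "J \<in> hitting b W" unfolding hitting_def by blast
next
  fix I assume "W \<subseteq> V" "I \<in> hitting b W"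
  then have "I \<subseteq> V" unfolding hitting_def by blast
  then show "finite I" using finite_V by (rule finite_subset)
qed

lemma inner_span_eq_0:
  assumes "y \<in> span (Y ` W)" "\<And>j. j \<in> W \<Longrightarrow> a \<bullet> Y j = 0"
  shows "a \<bullet> y = 0"
  using assms(1)
proof (induction rule: span_induct_alt)
  case (step c x y)
  then show ?case using assms(2) by (auto simp: inner_add_right)
qed simp

text \<open>A nonnegative combination on which \<open>a\<close> vanishes only involves vertices on which \<open>a\<close> vanishes.\<close>

lemma spans_face_slice:
  assumes W: "spans_face W" and a: "a \<in> H"
  shows "spans_face {j \<in> W. a \<bullet> Y j = 0}"
  unfolding spans_face_def
proof (intro conjI ballI impI)
  let ?W = "{j \<in> W. a \<bullet> Y j = 0}"
  show "?W \<subseteq> V" using W unfolding spans_face_def by blast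
  fix y assume y: "y \<in> span (Y ` ?W)" and pos: "\<forall>a\<in>H. 0 \<le> a \<bullet> y"
  have WV: "W \<subseteq> V" using W unfolding spans_face_def by blast
  have fin: "finite W" using WV finite_V finite_subset by blast
  have "y \<in> span (Y ` W)" using y span_mono[of "Y ` ?W" "Y ` W"] by blast
  then obtain c where c: "\<forall>j\<in>W. 0 \<le> c j" "y = (\<Sum>j\<in>W. c j *\<^sub>R Y j)"
    using W pos unfolding spans_face_def by blast
  have "a \<bullet> y = 0" by (rule inner_span_eq_0[OF y]) simp
  then have "(\<Sum>j\<in>W. c j * (a \<bullet> Y j)) = 0" unfolding c(2) by (simp add: inner_sum_right)
  then have z: "c j * (a \<bullet> Y j) = 0" if "j \<in> W" for j
    using that c(1) WV vertex_nonneg[OF _ a] fin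
    by (subst (asm) sum_nonneg_eq_0_iff) auto
  have "y = (\<Sum>j\<in>?W. c j *\<^sub>R Y j)"
    unfolding c(2) using z fin by (intro sum.mono_neutral_right) auto
  then show "\<exists>c. (\<forall>j\<in>?W. 0 \<le> c j) \<and> y = (\<Sum>j\<in>?W. c j *\<^sub>R Y j)" using c(1) by blast
qed

lemma eventually_in_cone:
  assumes I: "I \<subseteq> V" and hit: "\<And>a. a \<in> H \<Longrightarrow> a \<bullet> b < 0 \<Longrightarrow> \<exists>j\<in>I. 0 < a \<bullet> Y j"
  shows "\<forall>\<^sub>F N in sequentially. \<forall>a\<in>H. 0 \<le> a \<bullet> (b + real N *\<^sub>R (\<Sum>j\<in>I. Y j))"
proof (rule eventually_ball_finite[OF finite_H], rule ballI)
  fix a assume a: "a \<in> H"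
  have fin: "finite I" using I finite_V finite_subset by blast
  define s where "s = (\<Sum>j\<in>I. a \<bullet> Y j)"
  have nn: "0 \<le> a \<bullet> Y j" if "j \<in> I" for j using that I a vertex_nonneg by blast
  have s0: "0 \<le> s" unfolding s_def using nn by (rule sum_nonneg)
  have eq: "a \<bullet> (b + real N *\<^sub>R (\<Sum>j\<in>I. Y j)) = a \<bullet> b + real N * s" for N
    by (simp add: inner_add_right inner_sum_right s_def)
  show "\<forall>\<^sub>F N in sequentially. 0 \<le> a \<bullet> (b + real N *\<^sub>R (\<Sum>j\<in>I. Y j))"
  proof (cases "a \<bullet> b < 0")
    case True
    then obtain j where "j \<in> I" "0 < a \<bullet> Y j" using hit[OF a] by blast
    then have "0 < s" unfolding s_def using sum_pos2[OF fin, of j "\<lambda>j. a \<bullet> Y j"] nn by blast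
    have "0 \<le> a \<bullet> b + real N * s" if "N \<ge> nat \<lceil>- (a \<bullet> b) / s\<rceil>" for N
    proof -
      have "- (a \<bullet> b) / s \<le> real N" using that by linarith
      then show ?thesis using \<open>0 < s\<close> by (simp add: field_simps)
    qed
    then show ?thesis unfolding eq eventually_sequentially by blast
  next
    case False
    then have "0 \<le> a \<bullet> b + real N * s" for N using s0 by simp
    then show ?thesis unfolding eq by simp
  qed
qed

text \<open>If the combination found so far lies on one more hyperplane \<open>f\<close>, move it towards a vertex off
  that hyperplane, by a length that differs from the finitely many lengths at which some
  hyperplane of \<open>F\<close> would be met.\<close>

lemma generic_combination:
  assumes "finite F" "finite W" "\<And>f. f \<in> F \<Longrightarrow> \<exists>j\<in>W. f \<bullet> Y j \<noteq> 0"
  shows "\<exists>c. (\<forall>j\<in>W. 0 < c j) \<and> (\<forall>f\<in>F. f \<bullet> (\<Sum>j\<in>W. c j *\<^sub>R Y j) \<noteq> (0::real))"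
  using assms(1,3)
proof (induction F rule: finite_induct)
  case empty
  show ?case by (intro exI[of _ "\<lambda>_. 1"]) simp
next
  case (insert f F)
  then obtain c where c: "\<forall>j\<in>W. 0 < c j" "\<forall>g\<in>F. g \<bullet> (\<Sum>j\<in>W. c j *\<^sub>R Y j) \<noteq> 0" by blast
  obtain j where j: "j \<in> W" "f \<bullet> Y j \<noteq> 0" using insert.prems by blast
  let ?m = "\<Sum>j\<in>W. c j *\<^sub>R Y j"
  define S where "S = insert 0 ((\<lambda>g. - (g \<bullet> ?m) / (g \<bullet> Y j)) ` insert f F)"
  define e where "e = Max S + 1"
  have "finite S" using insert.hyps by (simp add: S_def)
  then have e: "s < e" if "s \<in> S" for s using Max_ge[of S s] that unfolding e_def by linarith
  have "0 < e" by (rule e) (simp add: S_def)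
  define c' where "c' i = (if i = j then c i + e else c i)" for i
  have "(\<Sum>i\<in>W. c' i *\<^sub>R Y i) = (\<Sum>i\<in>W. c i *\<^sub>R Y i + (if i = j then e *\<^sub>R Y j else 0))"
    by (intro sum.cong) (auto simp: c'_def scaleR_left_distrib)
  also have "\<dots> = ?m + e *\<^sub>R Y j" using j(1) assms(2) by (simp add: sum.distrib)
  finally have m': "(\<Sum>i\<in>W. c' i *\<^sub>R Y i) = ?m + e *\<^sub>R Y j" .
  have "g \<bullet> (?m + e *\<^sub>R Y j) \<noteq> 0" if g: "g \<in> insert f F" for g
  proof (cases "g \<bullet> Y j = 0")
    case True
    then have "g \<in> F" using g j(2) by blast
    then show ?thesis using c(2) True by (simp add: inner_add_right)
  next
    case False
    have "e \<noteq> - (g \<bullet> ?m) / (g \<bullet> Y j)" using e[of "- (g \<bullet> ?m) / (g \<bullet> Y j)"] g unfolding S_def by blast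
    then show ?thesis using False by (simp add: inner_add_right field_simps)
  qed
  moreover have "\<forall>i\<in>W. 0 < c' i" using c(1) \<open>0 < e\<close> by (simp add: c'_def add_pos_pos)
  ultimately show ?case unfolding m'[symmetric] by blast
qed

text \<open>Move from a point \<open>m\<close> in the interior of the face of \<open>W\<close> towards \<open>b\<close>. The family starts as the full
  simplex and shrinks whenever a hyperplane is crossed. At the last crossing point \<open>b'\<close>, the
  functionals that change sign are proportional on \<open>W\<close> if \<open>m\<close> is generic, hence cut the same
  smaller face \<open>W'\<close>, and the sets that are lost form the family of \<open>b'\<close> on \<open>W'\<close>. The family of \<open>b'\<close> on
  \<open>W\<close> is acyclic because fewer half-spaces are violated, the one on \<open>W'\<close> because the face is smaller,
  so the difference is acyclic as well. The last hypothesis says that \<open>- b\<close> is not an interior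
  point of the face; for such points the induction would end at the non-acyclic family \<open>{{}}\<close>.\<close>

theorem acyclic_hitting:
  assumes "spans_face W" "b \<in> span (Y ` W)"
    and "\<exists>a\<in>H. \<exists>j\<in>W. 0 < a \<bullet> Y j \<and> 0 \<le> a \<bullet> b"
  shows "acyclic_family (k :: 'k::comm_ring_1 itself) (hitting b W)"
proof -
  have "finite W" using assms(1) finite_V finite_subset unfolding spans_face_def by blast
  then show ?thesis using assms
  proof (induction W arbitrary: b rule: finite_psubset_induct)
    case (psubset W)
    note outer = psubset.IH and W = psubset.prems(1) and finW = psubset.hyps
    have WV: "W \<subseteq> V" using W unfolding spans_face_def by blast
    have nn: "0 \<le> a \<bullet> Y j" if "j \<in> W" "a \<in> H" for a j using that WV vertex_nonneg by blast
    from psubset.prems(2,3) show ?case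
    proof (induction "card {a \<in> H. a \<bullet> b < 0}" arbitrary: b rule: less_induct)
      case less
      note inner = less.hyps and b = less.prems(1)
      define S where "S = {a \<in> H. a \<bullet> b < 0}"
      have finS: "finite S" using finite_H by (simp add: S_def)
      obtain a0 j0 where a0: "a0 \<in> H" "j0 \<in> W" "0 < a0 \<bullet> Y j0" "0 \<le> a0 \<bullet> b"
        using less.prems(2) by blast
      consider "S = {}" | a where "a \<in> S" "\<forall>j\<in>W. a \<bullet> Y j = 0"
        | "S \<noteq> {}" "\<And>a. a \<in> S \<Longrightarrow> \<exists>j\<in>W. a \<bullet> Y j \<noteq> 0" by blast
      then show ?case
      proof cases
        case 1
        then have "hitting b W = Pow W" unfolding hitting_def S_def by blast
        moreover have "W \<noteq> {}" using a0 by blast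
        ultimately show ?thesis using acyclic_Pow[OF finW] by simp
      next
        case 2
        have "\<not> (\<exists>j\<in>I. 0 < a \<bullet> Y j)" if "I \<subseteq> W" for I
          using 2(2) that by (metis less_irrefl subsetD)
        then have "hitting b W = {}" using 2(1) unfolding hitting_def S_def by blast
        then show ?thesis using acyclic_empty by simp
      next
        case 3
        \<comment> \<open>A zero of one of these functionals at \<open>m\<close> means that \<open>a\<close> and \<open>a'\<close> are crossed simultaneously.\<close>
        define F where "F = {f \<in> (\<lambda>(a, a'). (a' \<bullet> b) *\<^sub>R a - (a \<bullet> b) *\<^sub>R a') ` (S \<times> S). \<exists>j\<in>W. f \<bullet> Y j \<noteq> 0}"
        have "finite F" using finS by (simp add: F_def)
        then have "\<exists>c. (\<forall>j\<in>W. 0 < c j) \<and> (\<forall>f\<in>F. f \<bullet> (\<Sum>j\<in>W. c j *\<^sub>R Y j) \<noteq> (0::real))"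
          using finW by (rule generic_combination) (simp add: F_def)
        then obtain c where c: "\<And>j. j \<in> W \<Longrightarrow> (0::real) < c j"
            "\<And>f. f \<in> F \<Longrightarrow> f \<bullet> (\<Sum>j\<in>W. c j *\<^sub>R Y j) \<noteq> 0"
          by blast
        define m where "m = (\<Sum>j\<in>W. c j *\<^sub>R Y j)"
        have mspan: "m \<in> span (Y ` W)" unfolding m_def by (rule sum_in_span)
        have am: "a \<bullet> m = (\<Sum>j\<in>W. c j * (a \<bullet> Y j))" for a by (simp add: m_def inner_sum_right)
        have m_nonneg: "0 \<le> a \<bullet> m" if "a \<in> H" for a
          unfolding am using c(1) nn[OF _ that] by (intro sum_nonneg mult_nonneg_nonneg) (auto intro: less_imp_le)
        have m_pos: "0 < a \<bullet> m" if a: "a \<in> H" and j: "j \<in> W" "a \<bullet> Y j \<noteq> 0" for a j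
        proof -
          have "0 < c j * (a \<bullet> Y j)" using c(1)[OF j(1)] nn[OF j(1) a] j(2) by simp
          moreover have "0 \<le> c i * (a \<bullet> Y i)" if "i \<in> W" for i
            using c(1)[OF that] nn[OF that a] by simp
          ultimately show ?thesis
            unfolding am using sum_pos2[OF finW j(1), of "\<lambda>j. c j * (a \<bullet> Y j)"] by blast
        qed
        have SH: "a \<in> H" "a \<bullet> b < 0" if "a \<in> S" for a using that by (auto simp: S_def)
        have Spos: "0 < a \<bullet> m" if "a \<in> S" for a using 3(2)[OF that] m_pos[OF SH(1)[OF that]] by blast
        \<comment> \<open>The half-space \<open>a\<close> is left at \<open>b + m / r a\<close>, so the largest ratio belongs to the last crossing.\<close>
        define r where "r a = (a \<bullet> m) / - (a \<bullet> b)" for a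
        have rpos: "0 < r a" if "a \<in> S" for a
          unfolding r_def using Spos[OF that] SH[OF that] by (intro divide_pos_pos) simp_all
        define \<rho> where "\<rho> = Max (r ` S)"
        have \<rho>: "\<rho> \<in> r ` S" "\<And>a. a \<in> S \<Longrightarrow> r a \<le> \<rho>" unfolding \<rho>_def using finS 3(1) by auto
        then obtain t where t: "t \<in> S" "r t = \<rho>" by blast
        have "0 < \<rho>" using rpos[OF t(1)] t(2) by simp
        define b' where "b' = b + (1 / \<rho>) *\<^sub>R m"
        have b'span: "b' \<in> span (Y ` W)" unfolding b'_def using b mspan by (intro span_add span_scale)
        have ab': "a \<bullet> b' = a \<bullet> b + (a \<bullet> m) / \<rho>" for a by (simp add: b'_def inner_add_right)
        have ab'S: "a \<bullet> b' = (- (a \<bullet> b) / \<rho>) * (r a - \<rho>)" if "a \<in> S" for a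
          unfolding ab' r_def using SH[OF that] \<open>0 < \<rho>\<close> by (simp add: field_simps)
        have neg: "a \<bullet> b' < 0 \<longleftrightarrow> r a < \<rho>" if "a \<in> S" for a
        proof -
          have aux: "x * (y - z) < 0 \<longleftrightarrow> y < z" if "0 < x" for x y z :: real
            using that by (simp add: mult_less_0_iff)
          have "0 < - (a \<bullet> b) / \<rho>"
            using SH[OF that] \<open>0 < \<rho>\<close> by (intro divide_pos_pos) simp_all
          then show ?thesis unfolding ab'S[OF that] by (rule aux)
        qed
        have nonneg: "0 \<le> a \<bullet> b'" if "a \<in> H" "a \<notin> S" for a
          unfolding ab' using that m_nonneg[OF that(1)] \<open>0 < \<rho>\<close> by (simp add: S_def)
        have negset: "{a \<in> H. a \<bullet> b' < 0} = {a \<in> S. r a < \<rho>}"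
          using neg nonneg SH(1) by (force simp: not_le[symmetric])
        have tb': "t \<bullet> b' = 0" unfolding ab'S[OF t(1)] t(2) by simp
        define W' where "W' = {j \<in> W. t \<bullet> Y j = 0}"
        have W'W: "W' \<subset> W" using 3(2)[OF t(1)] unfolding W'_def by blast
        have same: "a \<bullet> Y j = 0 \<longleftrightarrow> t \<bullet> Y j = 0" if a: "a \<in> S" "r a = \<rho>" and j: "j \<in> W" for a j
        proof -
          have *: "(t \<bullet> b) * (a \<bullet> m) - (a \<bullet> b) * (t \<bullet> m) = 0"
          proof -
            have "(a \<bullet> m) / - (a \<bullet> b) = (t \<bullet> m) / - (t \<bullet> b)"
              using a(2) t(2) unfolding r_def by simp
            then have "(a \<bullet> m) * - (t \<bullet> b) = (t \<bullet> m) * - (a \<bullet> b)"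
              using SH(2)[OF a(1)] SH(2)[OF t(1)] by (subst (asm) frac_eq_eq) simp_all
            then show ?thesis by (simp add: algebra_simps)
          qed
          let ?f = "(t \<bullet> b) *\<^sub>R a - (a \<bullet> b) *\<^sub>R t"
          have "?f \<bullet> m = 0" using * by (simp add: inner_diff_left)
          then have "?f \<notin> F" using c(2)[of ?f] unfolding m_def by blast
          moreover have "?f \<in> (\<lambda>(a, a'). (a' \<bullet> b) *\<^sub>R a - (a \<bullet> b) *\<^sub>R a') ` (S \<times> S)"
            using a(1) t(1) by (intro image_eqI[of _ _ "(a, t)"]) auto
          ultimately have "?f \<bullet> Y j = 0" using j unfolding F_def by blast
          then have "(t \<bullet> b) * (a \<bullet> Y j) = (a \<bullet> b) * (t \<bullet> Y j)" by (simp add: inner_diff_left)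
          then show ?thesis using SH(2)[OF a(1)] SH(2)[OF t(1)] by auto
        qed
        let ?A = "hitting b W" and ?B = "hitting b' W'"
        have union: "?A \<union> ?B = hitting b' W"
        proof (intro equalityI subsetI)
          fix I assume "I \<in> ?A \<union> ?B"
          then show "I \<in> hitting b' W"
          proof
            assume "I \<in> ?A"
            then show ?thesis using negset unfolding hitting_def S_def by blast
          next
            assume "I \<in> ?B"
            then show ?thesis using W'W unfolding hitting_def by blast
          qed
        next
          fix I assume I: "I \<in> hitting b' W"
          show "I \<in> ?A \<union> ?B"
          proof (cases "\<exists>a\<in>S. r a = \<rho> \<and> \<not> (\<exists>j\<in>I. 0 < a \<bullet> Y j)")
            case True
            then obtain a where a: "a \<in> S" "r a = \<rho>" "\<And>j. j \<in> I \<Longrightarrow> \<not> 0 < a \<bullet> Y j" by blast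
            have "I \<subseteq> W'"
            proof
              fix j assume j: "j \<in> I"
              then have jW: "j \<in> W" using I unfolding hitting_def by blast
              have "a \<bullet> Y j = 0" using a(3)[OF j] nn[OF jW SH(1)[OF a(1)]] by linarith
              then show "j \<in> W'" using same[OF a(1,2) jW] jW by (simp add: W'_def)
            qed
            then show ?thesis using I unfolding hitting_def by blast
          next
            case False
            have "\<exists>j\<in>I. 0 < a \<bullet> Y j" if a: "a \<in> H" "a \<bullet> b < 0" for a
            proof -
              have aS: "a \<in> S" using a by (simp add: S_def)
              show ?thesis
              proof (cases "r a = \<rho>")
                case True
                then show ?thesis using False aS by blast
              next
                case neq: False
                then have "a \<bullet> b' < 0" using neg[OF aS] \<rho>(2)[OF aS] by linarith
                then show ?thesis using I a(1) unfolding hitting_def by blast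
              qed
            qed
            then show ?thesis using I unfolding hitting_def by blast
          qed
        qed
        have split: "split_family ?A ?B"
        proof
          show "convex_family (?A \<union> ?B)" unfolding union using WV by (rule convex_hitting)
          have "\<not> (\<exists>j\<in>I. 0 < t \<bullet> Y j)" if "I \<subseteq> W'" for I
          proof
            assume "\<exists>j\<in>I. 0 < t \<bullet> Y j"
            then obtain j where j: "j \<in> I" "0 < t \<bullet> Y j" by blast
            then have "t \<bullet> Y j = 0" using that unfolding W'_def by blast
            with j(2) show False by simp
          qed
          then show "?A \<inter> ?B = {}" using SH[OF t(1)] unfolding hitting_def by blast
          fix I J assume "I \<in> ?A" "J \<in> ?A \<union> ?B" "I \<subseteq> J"
          then show "J \<in> ?A" using W'W unfolding hitting_def by blast
        qed
        have "acyclic_family k (hitting b' W)"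
        proof (rule inner[OF _ b'span])
          have "{a \<in> H. a \<bullet> b' < 0} \<subset> S" unfolding negset using t by blast
          then show "card {a \<in> H. a \<bullet> b' < 0} < card {a \<in> H. a \<bullet> b < 0}"
            unfolding S_def[symmetric] by (rule psubset_card_mono[OF finS])
          obtain j where j: "j \<in> W" "t \<bullet> Y j \<noteq> 0" using 3(2)[OF t(1)] by blast
          then have "0 < t \<bullet> Y j" using nn[OF j(1) SH(1)[OF t(1)]] by linarith
          then show "\<exists>a\<in>H. \<exists>j\<in>W. 0 < a \<bullet> Y j \<and> 0 \<le> a \<bullet> b'"
            using SH(1)[OF t(1)] j(1) tb' by (intro bexI[of _ t] bexI[of _ j]) simp_all
        qed
        moreover have "acyclic_family k ?B"
        proof (cases "b' \<in> span (Y ` W')")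
          case True
          show ?thesis
          proof (rule outer[OF W'W _ True])
            show "spans_face W'" unfolding W'_def by (rule spans_face_slice[OF W SH(1)[OF t(1)]])
            have "0 < a0 \<bullet> m" using m_pos[OF a0(1,2)] a0(3) by simp
            then have pos: "0 < a0 \<bullet> b'" unfolding ab' using a0(4) \<open>0 < \<rho>\<close> by (simp add: add_nonneg_pos)
            have "\<exists>j\<in>W'. a0 \<bullet> Y j \<noteq> 0"
            proof (rule ccontr)
              assume "\<not> ?thesis"
              then have "a0 \<bullet> b' = 0" by (intro inner_span_eq_0[OF True]) blast
              with pos show False by simp
            qed
            then obtain j where j: "j \<in> W'" "a0 \<bullet> Y j \<noteq> 0" by blast
            moreover have "0 \<le> a0 \<bullet> Y j" using j(1) W'W nn[OF _ a0(1)] by blast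
            ultimately have "0 < a0 \<bullet> Y j" by linarith
            then show "\<exists>a\<in>H. \<exists>j\<in>W'. 0 < a \<bullet> Y j \<and> 0 \<le> a \<bullet> b'"
              using a0(1) j(1) pos by (intro bexI[of _ a0] bexI[of _ j]) simp_all
          qed
        next
          case False
          \<comment> \<open>A set in the family would move \<open>b'\<close> into the cone, hence into the face of \<open>W'\<close> and its span.\<close>
          have "?B = {}"
          proof (rule ccontr)
            assume "?B \<noteq> {}"
            then obtain I where I: "I \<subseteq> W'" "\<And>a. a \<in> H \<Longrightarrow> a \<bullet> b' < 0 \<Longrightarrow> \<exists>j\<in>I. 0 < a \<bullet> Y j"
              unfolding hitting_def by blast
            have IV: "I \<subseteq> V" using I(1) W'W WV by blast
            obtain N where N: "\<forall>a\<in>H. 0 \<le> a \<bullet> (b' + real N *\<^sub>R (\<Sum>j\<in>I. Y j))"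
              using eventually_happens'[OF _ eventually_in_cone[OF IV I(2)]] by auto
            define s where "s = (\<Sum>j\<in>I. Y j)"
            have sW': "s \<in> span (Y ` W')" unfolding s_def using I(1)
              by (intro span_sum span_base) blast
            then have sW: "s \<in> span (Y ` W)" using span_mono[of "Y ` W'" "Y ` W"] W'W by blast
            have "b' + real N *\<^sub>R s \<in> span (Y ` W)" using b'span sW by (intro span_add span_scale)
            then obtain d where d: "\<forall>j\<in>W. 0 \<le> d j" "b' + real N *\<^sub>R s = (\<Sum>j\<in>W. d j *\<^sub>R Y j)"
              using W N unfolding spans_face_def s_def[symmetric] by blast
            have "t \<bullet> s = 0" by (rule inner_span_eq_0[OF sW']) (simp add: W'_def)
            then have "t \<bullet> (\<Sum>j\<in>W. d j *\<^sub>R Y j) = 0"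
              unfolding d(2)[symmetric] using tb' by (simp add: inner_add_right)
            then have "(\<Sum>j\<in>W. d j * (t \<bullet> Y j)) = 0" by (simp add: inner_sum_right)
            then have z: "d j * (t \<bullet> Y j) = 0" if "j \<in> W" for j
              using that d(1) nn[OF _ SH(1)[OF t(1)]] finW
              by (subst (asm) sum_nonneg_eq_0_iff) auto
            have "(\<Sum>j\<in>W. d j *\<^sub>R Y j) = (\<Sum>j\<in>W'. d j *\<^sub>R Y j)"
              using z finW W'W by (intro sum.mono_neutral_right) (auto simp: W'_def)
            then have "b' + real N *\<^sub>R s \<in> span (Y ` W')" using d(2) sum_in_span by simp
            then have "b' + real N *\<^sub>R s - real N *\<^sub>R s \<in> span (Y ` W')"
              using sW' by (intro span_diff span_scale)
            then show False using False by simp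
          qed
          then show ?thesis using acyclic_empty by simp
        qed
        ultimately show ?thesis
          using split_family.acyclic_upper[OF split] unfolding union by blast
      qed
    qed
  qed
qed

text \<open>If \<open>W\<close> and \<open>U\<close> index faces, these are the sets of vertices of the larger face \<open>U\<close> that are contained
  in no face except those that contain \<open>W\<close>.\<close>

definition meeting :: "nat set \<Rightarrow> nat set \<Rightarrow> nat set set"
  where "meeting W U = {I. I \<subseteq> U \<and> (\<forall>a\<in>H. (\<exists>j\<in>W. 0 < a \<bullet> Y j) \<longrightarrow> (\<exists>j\<in>I. 0 < a \<bullet> Y j))}"

lemma hitting_minus_sum:
  assumes W: "W \<subseteq> V"
  shows "hitting (- (\<Sum>j\<in>W. Y j)) U = meeting W U"
proof -
  have "a \<bullet> (- (\<Sum>j\<in>W. Y j)) < 0 \<longleftrightarrow> (\<exists>j\<in>W. 0 < a \<bullet> Y j)" if a: "a \<in> H" for a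
  proof -
    have fin: "finite W" using W finite_V finite_subset by blast
    have eq: "a \<bullet> (- (\<Sum>j\<in>W. Y j)) = - (\<Sum>j\<in>W. a \<bullet> Y j)" by (simp add: inner_sum_right)
    have nn: "0 \<le> a \<bullet> Y j" if "j \<in> W" for j using that W a vertex_nonneg by blast
    show ?thesis
    proof
      assume "\<exists>j\<in>W. 0 < a \<bullet> Y j"
      then obtain j where "j \<in> W" "0 < a \<bullet> Y j" by blast
      then show "a \<bullet> (- (\<Sum>j\<in>W. Y j)) < 0"
        unfolding eq using sum_pos2[OF fin, of j "\<lambda>j. a \<bullet> Y j"] nn by simp
    next
      assume "a \<bullet> (- (\<Sum>j\<in>W. Y j)) < 0"
      then have "\<not> (\<Sum>j\<in>W. a \<bullet> Y j) \<le> 0" unfolding eq by simp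
      then show "\<exists>j\<in>W. 0 < a \<bullet> Y j" using sum_nonpos[of W "\<lambda>j. a \<bullet> Y j"] not_less by blast
    qed
  qed
  then show ?thesis unfolding hitting_def meeting_def by blast
qed

text \<open>The case \<open>b = - (\<Sum>j\<in>W. Y j)\<close> of \<open>acyclic_hitting\<close>; the functional \<open>a\<close> witnesses that \<open>W\<close> is a proper
  face of \<open>U\<close>.\<close>

theorem acyclic_meeting:
  assumes U: "spans_face U" and WU: "W \<subseteq> U"
    and a: "a \<in> H" "j \<in> U" "0 < a \<bullet> Y j" "\<And>i. i \<in> W \<Longrightarrow> a \<bullet> Y i = 0"
  shows "acyclic_family (k :: 'k::comm_ring_1 itself) (meeting W U)"
proof -
  have WV: "W \<subseteq> V" using U WU unfolding spans_face_def by blast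
  have "acyclic_family k (hitting (- (\<Sum>j\<in>W. Y j)) U)"
  proof (rule acyclic_hitting[OF U])
    show "- (\<Sum>j\<in>W. Y j) \<in> span (Y ` U)"
      using WU by (intro span_neg span_sum span_base) blast
    have "a \<bullet> (- (\<Sum>j\<in>W. Y j)) = 0" using a(4) by (simp add: inner_sum_right)
    then show "\<exists>a\<in>H. \<exists>j\<in>U. 0 < a \<bullet> Y j \<and> 0 \<le> a \<bullet> (- (\<Sum>j\<in>W. Y j))"
      using a(1,2,3) by (intro bexI[of _ a] bexI[of _ j]) simp_all
  qed
  then show ?thesis unfolding hitting_minus_sum[OF WV] .
qed

lemma split_meeting:
  assumes "W \<subseteq> U" "U \<subseteq> V"
  shows "split_family {I \<in> meeting W U. \<not> I \<subseteq> W} (meeting W W)"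
proof
  have union: "{I \<in> meeting W U. \<not> I \<subseteq> W} \<union> meeting W W = meeting W U"
    using assms(1) unfolding meeting_def by blast
  have "W \<subseteq> V" using assms by blast
  then show "convex_family ({I \<in> meeting W U. \<not> I \<subseteq> W} \<union> meeting W W)"
    unfolding union using convex_hitting[OF assms(2)] hitting_minus_sum[of W U] by metis
  show "{I \<in> meeting W U. \<not> I \<subseteq> W} \<inter> meeting W W = {}" unfolding meeting_def by blast
  fix I J assume "I \<in> {I \<in> meeting W U. \<not> I \<subseteq> W}" "I \<subseteq> J"
    and "J \<in> {I \<in> meeting W U. \<not> I \<subseteq> W} \<union> meeting W W"
  then show "J \<in> {I \<in> meeting W U. \<not> I \<subseteq> W}" unfolding union by blast
qed

lemma meeting_union:
  "W \<subseteq> U \<Longrightarrow> {I \<in> meeting W U. \<not> I \<subseteq> W} \<union> meeting W W = meeting W U"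
  unfolding meeting_def by blast

text \<open>The family consists of the vertex sets in the interior of the face, whose cohomology is that of
  an open ball. For a facet \<open>W'\<close> of \<open>W\<close>, the acyclic family \<open>meeting W' W\<close> splits into \<open>meeting W W\<close> above
  and \<open>meeting W' W'\<close> below, which carries the cohomology over from \<open>W'\<close> to \<open>W\<close>. The induction starts
  with the family \<open>{{}}\<close> of the zero face.\<close>

theorem not_acyclic_meeting:
  assumes "spans_face W" and pointed: "\<And>j. j \<in> V \<Longrightarrow> \<exists>a\<in>H. 0 < a \<bullet> Y j"
  shows "\<not> acyclic_family (k :: 'k::comm_ring_1 itself) (meeting W W)"
proof -
  have "finite W" using assms(1) finite_V finite_subset unfolding spans_face_def by blast
  then show ?thesis using assms(1)
  proof (induction W rule: finite_psubset_induct)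
    case (psubset W)
    note W = psubset.prems(1) and finW = psubset.hyps
    have WV: "W \<subseteq> V" using W unfolding spans_face_def by blast
    have nn: "0 \<le> a \<bullet> Y j" if "j \<in> W" "a \<in> H" for a j using that WV vertex_nonneg by blast
    show ?case
    proof (cases "W = {}")
      case True
      then have "meeting W W = {{}}" unfolding meeting_def by auto
      then show ?thesis using not_acyclic_singleton_empty by simp
    next
      case False
      define P where "P = {a \<in> H. \<exists>j\<in>W. 0 < a \<bullet> Y j}"
      have "finite P" using finite_H by (simp add: P_def)
      moreover have "P \<noteq> {}" using False pointed WV unfolding P_def by blast
      \<comment> \<open>A facet is a proper zero set of maximal cardinality.\<close>
      ultimately have "Max ((\<lambda>a. card {j \<in> W. a \<bullet> Y j = 0}) ` P) \<in> (\<lambda>a. card {j \<in> W. a \<bullet> Y j = 0}) ` P"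
        by (intro Max_in) simp_all
      then obtain a where aP: "a \<in> P"
          "card {j \<in> W. a \<bullet> Y j = 0} = Max ((\<lambda>a. card {j \<in> W. a \<bullet> Y j = 0}) ` P)"
        by (metis (no_types, lifting) imageE)
      have a: "a \<in> P"
          "\<And>a'. a' \<in> P \<Longrightarrow> card {j \<in> W. a' \<bullet> Y j = 0} \<le> card {j \<in> W. a \<bullet> Y j = 0}"
        unfolding aP(2) using aP(1) \<open>finite P\<close> by (auto intro!: Max_ge)
      have aH: "a \<in> H" and aW: "\<exists>j\<in>W. 0 < a \<bullet> Y j" using a(1) by (auto simp: P_def)
      define W' where "W' = {j \<in> W. a \<bullet> Y j = 0}"
      have W'W: "W' \<subset> W" using aW unfolding W'_def by force
      obtain j0 where j0: "j0 \<in> W" "0 < a \<bullet> Y j0" using aW by blast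
      have acyc: "acyclic_family k (meeting W' W)"
        using W'W by (intro acyclic_meeting[OF W _ aH j0]) (auto simp: W'_def)
      let ?A = "{I \<in> meeting W' W. \<not> I \<subseteq> W'}"
      have "?A = meeting W W"
      proof (intro equalityI subsetI)
        fix I assume I: "I \<in> meeting W W"
        have "\<exists>j\<in>I. 0 < a \<bullet> Y j" using I aH aW unfolding meeting_def by blast
        then have "\<not> I \<subseteq> W'" unfolding W'_def by force
        then show "I \<in> ?A" using I W'W unfolding meeting_def by blast
      next
        fix I assume "I \<in> ?A"
        then have I: "I \<subseteq> W" "\<And>a'. a' \<in> H \<Longrightarrow> \<exists>j\<in>W'. 0 < a' \<bullet> Y j \<Longrightarrow> \<exists>j\<in>I. 0 < a' \<bullet> Y j"
          and "\<not> I \<subseteq> W'" unfolding meeting_def by blast+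
        then obtain i where i: "i \<in> I" "i \<notin> W'" by blast
        have "\<exists>j\<in>I. 0 < a' \<bullet> Y j" if a': "a' \<in> H" "\<exists>j\<in>W. 0 < a' \<bullet> Y j" for a'
        proof (cases "\<exists>j\<in>W'. 0 < a' \<bullet> Y j")
          case True
          then show ?thesis using I(2) a'(1) by blast
        next
          case no: False
          have zero: "a' \<bullet> Y j = 0" if j: "j \<in> W'" for j
          proof -
            have "0 \<le> a' \<bullet> Y j" using nn[of j a'] j W'W a'(1) by blast
            moreover have "\<not> 0 < a' \<bullet> Y j" using no j by blast
            ultimately show ?thesis by linarith
          qed
          have sub: "W' \<subseteq> {j \<in> W. a' \<bullet> Y j = 0}" using W'W zero by blast
          have "card {j \<in> W. a' \<bullet> Y j = 0} \<le> card W'"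
            unfolding W'_def using a(2)[of a'] a' by (simp add: P_def)
          then have "W' = {j \<in> W. a' \<bullet> Y j = 0}" using finW by (intro card_seteq[OF _ sub]) auto
          then have "a' \<bullet> Y i \<noteq> 0" using i I(1) by blast
          moreover have "0 \<le> a' \<bullet> Y i" using nn[of i a'] i I(1) a'(1) by blast
          ultimately have "0 < a' \<bullet> Y i" by linarith
          then show ?thesis using i(1) by blast
        qed
        then show "I \<in> meeting W W" unfolding meeting_def using I(1) by blast
      qed
      moreover have "\<not> acyclic_family k (meeting W' W')"
        using W'W spans_face_slice[OF W aH] by (intro psubset.IH) (simp_all add: W'_def)
      moreover have "W' \<subseteq> W" using W'W by blast
      ultimately show ?thesis
        using split_family.acyclic_lower[OF split_meeting[OF \<open>W' \<subseteq> W\<close> WV]] acyc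
          meeting_union[OF \<open>W' \<subseteq> W\<close>] by metis
    qed
  qed
qed

end


section \<open>Affine monoids and the cones they span\<close>

lemma real_vec_add: "real_vec (x + y) = real_vec x + real_vec y"
  by (simp add: real_vec_def vec_eq_iff)

lemma real_vec_diff: "real_vec (x - y) = real_vec x - real_vec y"
  by (simp add: real_vec_def vec_eq_iff)

lemma real_vec_uminus: "real_vec (- x) = - real_vec x"
  by (simp add: real_vec_def vec_eq_iff)

lemma real_vec_zero [simp]: "real_vec 0 = 0"
  by (simp add: real_vec_def vec_eq_iff)

lemma real_vec_smult: "real_vec (c *s x) = real_of_int c *\<^sub>R real_vec x"
  by (simp add: real_vec_def vec_eq_iff)

lemma real_vec_sum: "real_vec (\<Sum>i\<in>I. f i) = (\<Sum>i\<in>I. real_vec (f i))"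
  by (simp add: real_vec_def vec_eq_iff)

lemma real_vec_eq_iff [simp]: "real_vec x = real_vec y \<longleftrightarrow> x = y"
  by (simp add: real_vec_def vec_eq_iff)

lemma smult_left_cancel: "(c::int) \<noteq> 0 \<Longrightarrow> c *s x = c *s y \<longleftrightarrow> x = y"
  by (simp add: vec_eq_iff)

lemma submonoid_zero: "add_submonoid M \<Longrightarrow> 0 \<in> M"
  by (simp add: add_submonoid_def)

lemma submonoid_add: "add_submonoid M \<Longrightarrow> x \<in> M \<Longrightarrow> y \<in> M \<Longrightarrow> x + y \<in> M"
  by (simp add: add_submonoid_def)

lemma submonoid_smult: "add_submonoid M \<Longrightarrow> x \<in> M \<Longrightarrow> int n *s x \<in> (M :: (int ^ 'd) set)"
proof (induction n)
  case (Suc n)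
  have "int (Suc n) *s x = x + int n *s x" by (simp add: vec_eq_iff algebra_simps)
  then show ?case using Suc submonoid_add by metis
qed (simp add: submonoid_zero)

lemma submonoid_sum: "add_submonoid M \<Longrightarrow> (\<And>i. i \<in> I \<Longrightarrow> f i \<in> M) \<Longrightarrow> (\<Sum>i\<in>I. f i) \<in> M"
  by (induction I rule: infinite_finite_induct) (simp_all add: submonoid_zero submonoid_add)

lemma affine_monoid_submonoid: "affine_monoid M \<Longrightarrow> add_submonoid M"
  by (simp add: affine_monoid_def)

lemma affine_monoid_generators:
  assumes "affine_monoid M"
  obtains G where "finite G" "G \<subseteq> M"
    "\<And>x. x \<in> M \<Longrightarrow> \<exists>n. x = (\<Sum>g\<in>G. int (n g) *s g)"
proof -
  obtain G where G: "finite G" "M = add_submonoid hull G" using assms unfolding affine_monoid_def by blast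
  let ?S = "{x. \<exists>n. x = (\<Sum>g\<in>G. int (n g) *s g)}"
  have "add_submonoid ?S"
    unfolding add_submonoid_def
  proof (intro conjI ballI)
    show "0 \<in> ?S" by (intro CollectI exI[of _ "\<lambda>_. 0"]) simp
    fix x y assume "x \<in> ?S" "y \<in> ?S"
    then obtain n m where "x = (\<Sum>g\<in>G. int (n g) *s g)" "y = (\<Sum>g\<in>G. int (m g) *s g)" by blast
    then have "x + y = (\<Sum>g\<in>G. int (n g + m g) *s g)" by (simp add: sum.distrib)
    then show "x + y \<in> ?S" by (intro CollectI exI[of _ "\<lambda>g. n g + m g"])
  qed
  moreover have "G \<subseteq> ?S"
  proof
    fix g assume g: "g \<in> G"
    have "(\<Sum>h\<in>G. int (if h = g then 1 else 0) *s h) = (\<Sum>h\<in>G. if h = g then h else 0)"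
      by (intro sum.cong) auto
    also have "\<dots> = g" using g G(1) by simp
    finally show "g \<in> ?S" by (intro CollectI exI[of _ "\<lambda>h. if h = g then 1 else 0"]) simp
  qed
  ultimately have "M \<subseteq> ?S" unfolding G(2) by (intro hull_minimal)
  moreover have "G \<subseteq> M" unfolding G(2) by (rule hull_subset)
  ultimately show ?thesis using that G(1) by blast
qed

lemma group_closure_smult: "x \<in> group_closure M \<Longrightarrow> c *s x \<in> group_closure (M :: (int ^ 'd) set)"
proof -
  assume x: "x \<in> group_closure M"
  have nat: "int n *s x \<in> group_closure M" for n
  proof (induction n)
    case (Suc n)
    have "int (Suc n) *s x = x + int n *s x" by (simp add: vec_eq_iff algebra_simps)
    then show ?case using Suc x group_closure_add by metis
  qed simp
  show ?thesis
  proof (cases "0 \<le> c")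
    case True
    then show ?thesis using nat[of "nat c"] by simp
  next
    case False
    then have "c *s x = - (int (nat (- c)) *s x)" by (simp add: vec_eq_iff)
    then show ?thesis using nat[of "nat (- c)"] by (metis group_closure_minus_iff)
  qed
qed

lemma group_closure_subset: "M \<subseteq> group_closure M"
  by (auto intro: group_closure.base)

lemma group_closure_least:
  assumes "0 \<in> G" "\<And>x y. x \<in> G \<Longrightarrow> y \<in> G \<Longrightarrow> x - y \<in> G" "M \<subseteq> G"
  shows "group_closure M \<subseteq> G"
proof
  fix x assume "x \<in> group_closure M"
  then show "x \<in> G" using assms by (induction rule: group_closure.induct) auto
qed

lemma group_closure_mono: "M \<subseteq> N \<Longrightarrow> group_closure M \<subseteq> group_closure N"
  using group_closure_subset[of N] by (intro group_closure_least) (auto intro: group_closure.diff)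

lemma group_closure_submonoid:
  assumes "add_submonoid M"
  shows "group_closure M = {u - v | u v. u \<in> M \<and> v \<in> (M :: 'a::ab_group_add set)}" (is "_ = ?D")
proof
  show "group_closure M \<subseteq> ?D"
  proof (rule group_closure_least)
    show "0 \<in> ?D" using submonoid_zero[OF assms] by force
    show "M \<subseteq> ?D" using submonoid_zero[OF assms] by force
    fix x y assume "x \<in> ?D" "y \<in> ?D"
    then obtain u v u' v' where *: "x = u - v" "y = u' - v'" "u \<in> M" "v \<in> M" "u' \<in> M" "v' \<in> M" by blast
    have "x - y = (u + v') - (v + u')" by (simp add: *)
    moreover have "u + v' \<in> M" "v + u' \<in> M" using * submonoid_add[OF assms] by simp_all
    ultimately show "x - y \<in> ?D" by blast
  qed
  show "?D \<subseteq> group_closure M" using group_closure_subset by (blast intro: group_closure.diff)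
qed

definition convex_cone_set :: "(real ^ 'd) set \<Rightarrow> bool"
  where "convex_cone_set S \<longleftrightarrow> 0 \<in> S \<and> (\<forall>x\<in>S. \<forall>y\<in>S. x + y \<in> S) \<and> (\<forall>x\<in>S. \<forall>c\<ge>0. c *\<^sub>R x \<in> S)"

lemma cone_zero: "convex_cone_set S \<Longrightarrow> 0 \<in> S"
  and cone_add: "convex_cone_set S \<Longrightarrow> x \<in> S \<Longrightarrow> y \<in> S \<Longrightarrow> x + y \<in> S"
  and cone_scale: "convex_cone_set S \<Longrightarrow> x \<in> S \<Longrightarrow> 0 \<le> c \<Longrightarrow> c *\<^sub>R x \<in> S"
  by (simp_all add: convex_cone_set_def)

lemma cone_sum:
  "convex_cone_set S \<Longrightarrow> (\<And>i. i \<in> I \<Longrightarrow> f i \<in> S) \<Longrightarrow> (\<Sum>i\<in>I. f i) \<in> S"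
  by (induction I rule: infinite_finite_induct) (simp_all add: cone_zero cone_add)

lemma nonneg_span_generators:
  assumes G: "finite G" "G \<subseteq> M" "\<And>x. x \<in> M \<Longrightarrow> \<exists>n. x = (\<Sum>g\<in>G. int (n g) *s g)"
  shows "nonneg_span M = {\<Sum>g\<in>G. c g *\<^sub>R real_vec g | c. \<forall>g\<in>G. 0 \<le> c g}"
proof
  show "nonneg_span M \<subseteq> {\<Sum>g\<in>G. c g *\<^sub>R real_vec g | c. \<forall>g\<in>G. 0 \<le> c g}"
  proof
    fix y assume "y \<in> nonneg_span M"
    then obtain F c where F: "finite F" "F \<subseteq> M" "\<forall>x\<in>F. 0 \<le> c x" "y = (\<Sum>x\<in>F. c x *\<^sub>R real_vec x)"
      unfolding nonneg_span_def by blast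
    have "\<forall>x\<in>F. \<exists>n. x = (\<Sum>g\<in>G. int (n g) *s g)" using F(2) G(3) by blast
    from bchoice[OF this] obtain n where n: "\<And>x. x \<in> F \<Longrightarrow> x = (\<Sum>g\<in>G. int (n x g) *s g)" by blast
    have "y = (\<Sum>x\<in>F. \<Sum>g\<in>G. (c x * real (n x g)) *\<^sub>R real_vec g)"
      unfolding F(4)
    proof (rule sum.cong[OF refl])
      fix x assume x: "x \<in> F"
      have "real_vec x = (\<Sum>g\<in>G. real (n x g) *\<^sub>R real_vec g)"
        by (subst n[OF x]) (simp add: real_vec_sum real_vec_smult)
      then show "c x *\<^sub>R real_vec x = (\<Sum>g\<in>G. (c x * real (n x g)) *\<^sub>R real_vec g)"
        by (simp add: scaleR_sum_right)
    qed
    also have "\<dots> = (\<Sum>g\<in>G. (\<Sum>x\<in>F. c x * real (n x g)) *\<^sub>R real_vec g)"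
      by (subst sum.swap) (simp add: scaleR_sum_left)
    finally have "y = (\<Sum>g\<in>G. (\<Sum>x\<in>F. c x * real (n x g)) *\<^sub>R real_vec g)" .
    moreover have "\<forall>g\<in>G. 0 \<le> (\<Sum>x\<in>F. c x * real (n x g))" using F(3) by (simp add: sum_nonneg)
    ultimately show "y \<in> {\<Sum>g\<in>G. c g *\<^sub>R real_vec g | c. \<forall>g\<in>G. 0 \<le> c g}"
      by (intro CollectI exI[of _ "\<lambda>g. \<Sum>x\<in>F. c x * real (n x g)"] conjI)
  qed
  show "{\<Sum>g\<in>G. c g *\<^sub>R real_vec g | c. \<forall>g\<in>G. 0 \<le> c g} \<subseteq> nonneg_span M"
    unfolding nonneg_span_def using G(1,2) by blast
qed

lemma convex_cone_nonneg_span: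
  assumes "affine_monoid M"
  shows "convex_cone_set (nonneg_span M)"
proof -
  obtain G where G: "finite G" "G \<subseteq> M" "\<And>x. x \<in> M \<Longrightarrow> \<exists>n. x = (\<Sum>g\<in>G. int (n g) *s g)"
    using affine_monoid_generators[OF assms] by blast
  define S where "S = {\<Sum>g\<in>G. c g *\<^sub>R real_vec g | c. \<forall>g\<in>G. 0 \<le> c g}"
  have "0 \<in> S" unfolding S_def by (intro CollectI exI[of _ "\<lambda>_. 0"]) simp
  moreover have "x + y \<in> S" if "x \<in> S" "y \<in> S" for x y
  proof -
    obtain c where c: "x = (\<Sum>g\<in>G. c g *\<^sub>R real_vec g)" "\<forall>g\<in>G. 0 \<le> c g"
      using \<open>x \<in> S\<close> unfolding S_def by blast
    obtain d where d: "y = (\<Sum>g\<in>G. d g *\<^sub>R real_vec g)" "\<forall>g\<in>G. 0 \<le> d g"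
      using \<open>y \<in> S\<close> unfolding S_def by blast
    show ?thesis unfolding S_def
      using c d by (intro CollectI exI[of _ "\<lambda>g. c g + d g"]) (simp add: scaleR_left_distrib sum.distrib)
  qed
  moreover have "t *\<^sub>R x \<in> S" if "x \<in> S" "0 \<le> t" for x t
  proof -
    obtain c where c: "x = (\<Sum>g\<in>G. c g *\<^sub>R real_vec g)" "\<forall>g\<in>G. 0 \<le> c g"
      using \<open>x \<in> S\<close> unfolding S_def by blast
    show ?thesis unfolding S_def
      using c that(2) by (intro CollectI exI[of _ "\<lambda>g. t * c g"]) (simp add: scaleR_sum_right)
  qed
  moreover have "nonneg_span M = S" unfolding S_def by (rule nonneg_span_generators[OF G])
  ultimately show ?thesis unfolding convex_cone_set_def by blast
qed

lemma real_vec_in_nonneg_span: "x \<in> M \<Longrightarrow> real_vec x \<in> nonneg_span M"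
  unfolding nonneg_span_def by (intro CollectI exI[of _ "{x}"] exI[of _ "\<lambda>_. 1"]) simp

lemma nonneg_span_subset_span: "nonneg_span M \<subseteq> span (real_vec ` M)"
proof
  fix y assume "y \<in> nonneg_span M"
  then obtain F c where F: "F \<subseteq> M" "y = (\<Sum>x\<in>F. c x *\<^sub>R real_vec x)"
    unfolding nonneg_span_def by blast
  show "y \<in> span (real_vec ` M)"
    unfolding F(2) using F(1) by (intro span_sum span_scale span_base imageI) blast
qed

text \<open>Used for \<open>\<rat>\<close>-linear maps from \<open>\<real>\<close> to \<open>\<rat>\<close>, and for the field \<open>k\<close> as a vector space over itself through the
  Frobenius.\<close>

lemma exists_linear_functional:
  fixes s :: "'a::field \<Rightarrow> 'b::ab_group_add \<Rightarrow> 'b"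
  assumes "vector_space s" "v \<noteq> 0"
  obtains g where "\<And>x y. g (x + y) = g x + g y" "\<And>a x. g (s a x) = a * g x" "g v = 1"
proof -
  interpret V: vector_space s by fact
  interpret P: vector_space_pair s "(*) :: 'a \<Rightarrow> 'a \<Rightarrow> 'a"
    by unfold_locales (simp_all add: algebra_simps)
  have "V.independent {v}" using assms(2) by simp
  from P.linear_independent_extend[OF this, of "\<lambda>_. 1"] obtain g where
    g: "Vector_Spaces.linear s (*) g" "g v = 1" by auto
  interpret L: Vector_Spaces.linear s "(*)" g by (rule g(1))
  show ?thesis using that[of g] g(2) L.add L.scale by blast
qed

lemma rational_functional:
  obtains g :: "real \<Rightarrow> rat" where "\<And>x y. g (x + y) = g x + g y"
    "\<And>n x. g (real_of_int n * x) = of_int n * g x" "g 1 = 1"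
proof -
  have "vector_space (\<lambda>q x. of_rat q * x :: real)"
    by unfold_locales (simp_all add: algebra_simps of_rat_add of_rat_mult)
  then obtain g :: "real \<Rightarrow> rat" where g: "\<And>x y. g (x + y) = g x + g y"
    "\<And>a x. g (of_rat a * x) = a * g x" "g 1 = 1"
    by (rule exists_linear_functional[of _ 1]) auto
  have "g (real_of_int n * x) = of_int n * g x" for n x
    using g(2)[of "of_int n" x] by simp
  then show ?thesis using that g by blast
qed

text \<open>All coordinates of \<open>z\<close> and of the vectors \<open>x\<close> are integers, so a \<open>\<rat>\<close>-linear map may be applied to the
  coefficients of a linear relation between them.\<close>

lemma rational_relation:
  assumes "finite F" "real_vec z = (\<Sum>x\<in>F. c x *\<^sub>R real_vec x)"
    and add: "\<And>x y. (g :: real \<Rightarrow> rat) (x + y) = g x + g y"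
    and scale: "\<And>n x. g (real_of_int n * x) = of_int n * g x" and one: "g 1 = 1"
  shows "real_vec z = (\<Sum>x\<in>F. real_of_rat (g (c x)) *\<^sub>R real_vec x)"
proof -
  have g0: "g 0 = 0" using add[of 0 0] by simp
  have gsum: "g (\<Sum>x\<in>F. f x) = (\<Sum>x\<in>F. g (f x))" for f
    using assms(1) by (induction F rule: finite_induct) (simp_all add: g0 add)
  have "real_of_int (z $ i) = (\<Sum>x\<in>F. real_of_rat (g (c x)) * real_of_int (x $ i))" for i
  proof -
    have "real_of_int (z $ i) = (\<Sum>x\<in>F. c x * real_of_int (x $ i))"
      using assms(2) by (simp add: real_vec_def vec_eq_iff)
    then have "g (real_of_int (z $ i) * 1) = g (\<Sum>x\<in>F. real_of_int (x $ i) * c x)"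
      by (simp add: mult.commute)
    then have "of_int (z $ i) = (\<Sum>x\<in>F. of_int (x $ i) * g (c x))"
      unfolding gsum scale one by simp
    then have "real_of_rat (of_int (z $ i)) = real_of_rat (\<Sum>x\<in>F. of_int (x $ i) * g (c x))" by simp
    then show ?thesis by (simp add: of_rat_sum of_rat_mult mult.commute)
  qed
  then show ?thesis by (simp add: real_vec_def vec_eq_iff)
qed

text \<open>Take a nonnegative combination with the fewest terms. Replacing its coefficients by rational ones
  as in \<open>rational_relation\<close> yields the same vector. If the coefficients changed, their
  difference would be a linear relation, along which one coefficient can be moved to zero while
  the others stay nonnegative.\<close>

lemma rational_coefficients:
  assumes z: "real_vec z \<in> nonneg_span M"
  obtains F c where "finite F" "F \<subseteq> M" "\<And>x. x \<in> F \<Longrightarrow> (0::rat) \<le> c x"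
    "real_vec z = (\<Sum>x\<in>F. real_of_rat (c x) *\<^sub>R real_vec x)"
proof -
  obtain g :: "real \<Rightarrow> rat" where g: "\<And>x y. g (x + y) = g x + g y"
    "\<And>n x. g (real_of_int n * x) = of_int n * g x" "g 1 = 1"
    by (rule rational_functional) blast
  define P where "P F \<longleftrightarrow> finite F \<and> F \<subseteq> M \<and>
    (\<exists>c. (\<forall>x\<in>F. (0::real) \<le> c x) \<and> real_vec z = (\<Sum>x\<in>F. c x *\<^sub>R real_vec x))" for F
  have "\<exists>F. P F" using z unfolding nonneg_span_def P_def by blast
  then obtain F where F: "P F" "\<And>F'. P F' \<Longrightarrow> card F \<le> card F'"
    using ex_has_least_nat[of P _ card] by blast
  then obtain c where c: "finite F" "F \<subseteq> M" "\<And>x. x \<in> F \<Longrightarrow> 0 \<le> c x"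
      "real_vec z = (\<Sum>x\<in>F. c x *\<^sub>R real_vec x)"
    unfolding P_def by blast
  define d where "d x = real_of_rat (g (c x))" for x
  have d: "real_vec z = (\<Sum>x\<in>F. d x *\<^sub>R real_vec x)"
    unfolding d_def by (rule rational_relation[OF c(1,4) g])
  have no_relation: False
    if e: "(\<Sum>x\<in>F. e x *\<^sub>R real_vec x) = 0" and neg: "x0 \<in> F" "e x0 < 0" for e x0
  proof -
    define N where "N = {x \<in> F. e x < 0}"
    have N: "finite N" "N \<noteq> {}" using c(1) neg by (auto simp: N_def)
    \<comment> \<open>The first moment at which a coefficient \<open>c x + t * e x\<close> becomes zero.\<close>
    define t where "t = Min ((\<lambda>x. c x / - e x) ` N)"
    have "t \<in> (\<lambda>x. c x / - e x) ` N" unfolding t_def using N by (intro Min_in) simp_all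
    then obtain x1 where x1: "x1 \<in> N" "t = c x1 / - e x1" by blast
    have x1F: "x1 \<in> F" "e x1 < 0" using x1(1) by (auto simp: N_def)
    have t0: "0 \<le> t" unfolding x1(2) using c(3)[OF x1F(1)] x1F(2) by (intro divide_nonneg_pos) simp_all
    have nonneg: "0 \<le> c x + t * e x" if x: "x \<in> F" for x
    proof (cases "e x < 0")
      case True
      then have "t \<le> c x / - e x" unfolding t_def using N x by (intro Min_le) (auto simp: N_def)
      then have "t * - e x \<le> c x" using True by (subst (asm) pos_le_divide_eq) simp_all
      then show ?thesis by simp
    next
      case False
      then show ?thesis using c(3)[OF x] t0 by simp
    qed
    have zero: "c x1 + t * e x1 = 0" unfolding x1(2) using x1F(2) by simp
    have "real_vec z = (\<Sum>x\<in>F. (c x + t * e x) *\<^sub>R real_vec x)"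
    proof -
      have "(\<Sum>x\<in>F. (c x + t * e x) *\<^sub>R real_vec x)
          = (\<Sum>x\<in>F. c x *\<^sub>R real_vec x) + t *\<^sub>R (\<Sum>x\<in>F. e x *\<^sub>R real_vec x)"
        by (simp add: scaleR_left_distrib sum.distrib scaleR_sum_right)
      then show ?thesis using c(4) e by simp
    qed
    also have "\<dots> = (\<Sum>x\<in>F - {x1}. (c x + t * e x) *\<^sub>R real_vec x)"
      using c(1) x1F(1) zero by (simp add: sum.remove)
    finally have "P (F - {x1})" using c(1,2) nonneg unfolding P_def
      by (intro conjI exI[of _ "\<lambda>x. c x + t * e x"]) auto
    then have "card F \<le> card (F - {x1})" by (rule F(2))
    then show False using c(1) x1F(1) card_Diff1_less by (metis not_le)
  qed
  have "d x = c x" if x: "x \<in> F" for x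
  proof (rule ccontr)
    assume ne: "d x \<noteq> c x"
    have 1: "(\<Sum>x\<in>F. (d x - c x) *\<^sub>R real_vec x) = 0"
      using c(4) d by (simp add: scaleR_left_diff_distrib sum_subtractf)
    have 2: "(\<Sum>x\<in>F. (c x - d x) *\<^sub>R real_vec x) = 0"
      using c(4) d by (simp add: scaleR_left_diff_distrib sum_subtractf)
    show False using no_relation[OF 1 x] no_relation[OF 2 x] ne by linarith
  qed
  then have dc: "real_of_rat (g (c x)) = c x" if "x \<in> F" for x using that by (simp add: d_def)
  have "0 \<le> g (c x)" if "x \<in> F" for x using dc[OF that] c(3)[OF that] by (metis zero_le_of_rat_iff)
  then show ?thesis using that[OF c(1,2), of "\<lambda>x. g (c x)"] d unfolding d_def by blast
qed

lemma integer_point_multiple: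
  assumes "affine_monoid M" "real_vec z \<in> nonneg_span M"
  shows "\<exists>r>0. int r *s z \<in> M"
proof -
  obtain F c where F: "finite F" "F \<subseteq> M" "\<And>x. x \<in> F \<Longrightarrow> (0::rat) \<le> c x"
    "real_vec z = (\<Sum>x\<in>F. real_of_rat (c x) *\<^sub>R real_vec x)"
    by (rule rational_coefficients[OF assms(2)]) blast
  have "\<exists>r>0. \<forall>x\<in>F. \<exists>n::nat. of_nat r * c x = of_nat n"
    using F(1,3)
  proof (induction F rule: finite_induct)
    case (insert x F)
    then obtain r where r: "r > 0" "\<forall>x\<in>F. \<exists>n::nat. of_nat r * c x = of_nat n" by auto
    obtain a b where ab: "quotient_of (c x) = (a, b)" by (cases "quotient_of (c x)")
    have b: "b > 0" "c x = of_int a / of_int b"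
      using quotient_of_denom_pos[OF ab] quotient_of_div[OF ab] by simp_all
    have cx: "0 \<le> c x" using insert.prems by simp
    have "0 \<le> a"
    proof (rule ccontr)
      assume "\<not> 0 \<le> a"
      then have "(of_int a :: rat) / of_int b < 0" using b(1) by (intro divide_neg_pos) simp_all
      with cx b(2) show False by simp
    qed
    have r': "r * nat b > 0" using r(1) b(1) by simp
    have bq: "(of_nat (nat b) :: rat) = of_int b" using b(1) by simp
    have aq: "(of_nat (nat a) :: rat) = of_int a" using \<open>0 \<le> a\<close> by simp
    have "of_nat (r * nat b) * c x = of_nat (r * nat a)"
      unfolding of_nat_mult bq aq b(2) using b(1) by simp
    moreover have "\<exists>n::nat. of_nat (r * nat b) * c y = of_nat n" if y: "y \<in> F" for y
    proof -
      obtain n where "of_nat r * c y = of_nat n" using r(2) y by blast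
      then have "of_nat (r * nat b) * c y = of_nat (nat b * n)" by (simp add: mult_ac)
      then show ?thesis by blast
    qed
    ultimately have "\<forall>y\<in>insert x F. \<exists>n::nat. of_nat (r * nat b) * c y = of_nat n" by blast
    then show ?case using r' by blast
  qed auto
  then obtain r where r: "r > 0" "\<forall>x\<in>F. \<exists>n::nat. of_nat r * c x = of_nat n" by blast
  from bchoice[OF r(2)] obtain n :: "int ^ 'a \<Rightarrow> nat" where n: "\<And>x. x \<in> F \<Longrightarrow> of_nat r * c x = of_nat (n x)" by blast
  have "real_vec (int r *s z) = (\<Sum>x\<in>F. (real r * real_of_rat (c x)) *\<^sub>R real_vec x)"
    by (simp add: real_vec_smult F(4) scaleR_sum_right)
  also have "\<dots> = (\<Sum>x\<in>F. real (n x) *\<^sub>R real_vec x)"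
  proof (rule sum.cong[OF refl])
    fix x assume "x \<in> F"
    then have "real_of_rat (of_nat r * c x) = real_of_rat (of_nat (n x))" using n by simp
    then show "(real r * real_of_rat (c x)) *\<^sub>R real_vec x = real (n x) *\<^sub>R real_vec x"
      by (simp add: of_rat_mult)
  qed
  also have "\<dots> = real_vec (\<Sum>x\<in>F. int (n x) *s x)" by (simp add: real_vec_sum real_vec_smult)
  finally have eq: "int r *s z = (\<Sum>x\<in>F. int (n x) *s x)" by simp
  have "int r *s z \<in> M" unfolding eq
    using F(2) affine_monoid_submonoid[OF assms(1)] by (intro submonoid_sum submonoid_smult) auto
  then show ?thesis using r(1) by blast
qed

text \<open>The relative interior of a convex cone in terms of its order: some multiple of \<open>y\<close> dominates any
  given element.\<close>

definition interior_point :: "(real ^ 'd) set \<Rightarrow> real ^ 'd \<Rightarrow> bool"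
  where "interior_point S y \<longleftrightarrow> y \<in> S \<and> (\<forall>z\<in>S. \<exists>N::nat. real N *\<^sub>R y - z \<in> S)"

lemma interior_point_add:
  assumes "convex_cone_set S" "interior_point S y" "x \<in> S"
  shows "interior_point S (y + x)"
  unfolding interior_point_def
proof (intro conjI ballI)
  show "y + x \<in> S" using assms cone_add unfolding interior_point_def by blast
  fix z assume "z \<in> S"
  then obtain N :: nat where N: "real N *\<^sub>R y - z \<in> S" using assms(2) unfolding interior_point_def by blast
  have "(real N *\<^sub>R y - z) + real N *\<^sub>R x \<in> S" 
    using cone_add[OF assms(1) N] cone_scale[OF assms(1,3), of "real N"] by simp
  then show "\<exists>N::nat. real N *\<^sub>R (y + x) - z \<in> S"
    by (intro exI[of _ N]) (simp add: algebra_simps)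
qed

lemma interior_point_scale:
  assumes "convex_cone_set S" "interior_point S (c *\<^sub>R y)" "0 < c"
  shows "interior_point S y"
  unfolding interior_point_def
proof (intro conjI ballI)
  have "(1 / c) *\<^sub>R (c *\<^sub>R y) \<in> S"
    using assms(2,3) unfolding interior_point_def by (intro cone_scale[OF assms(1), of "c *\<^sub>R y"]) simp_all
  then show y: "y \<in> S" using assms(3) by simp
  fix z assume "z \<in> S"
  then obtain N :: nat where N: "real N *\<^sub>R (c *\<^sub>R y) - z \<in> S"
    using assms(2) unfolding interior_point_def by blast
  obtain K :: nat where K: "real N * c \<le> real K" using real_arch_simple by blast
  have "(real N *\<^sub>R (c *\<^sub>R y) - z) + (real K - real N * c) *\<^sub>R y \<in> S"
    using N y K by (intro cone_add[OF assms(1)] cone_scale[OF assms(1)]) auto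
  then show "\<exists>N::nat. real N *\<^sub>R y - z \<in> S"
    by (intro exI[of _ K]) (simp add: algebra_simps)
qed

text \<open>The sum \<open>m\<close> of a finite generating set has this property: subtracting a monoid element from a large
  multiple of \<open>m\<close> leaves nonnegative coefficients.\<close>

lemma sum_generators_absorbs:
  assumes aff: "affine_monoid M"
  obtains m where "m \<in> M"
    "\<And>x. x \<in> span (real_vec ` M) \<Longrightarrow> \<exists>N::nat. real N *\<^sub>R real_vec m + x \<in> nonneg_span M"
proof -
  obtain G where G: "finite G" "G \<subseteq> M" "\<And>x. x \<in> M \<Longrightarrow> \<exists>n. x = (\<Sum>g\<in>G. int (n g) *s g)"
    using affine_monoid_generators[OF aff] by blast
  note cone = convex_cone_nonneg_span[OF aff]
  define S where "S = nonneg_span M"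
  define m where "m = (\<Sum>g\<in>G. g)"
  have mM: "m \<in> M" unfolding m_def using G(2) affine_monoid_submonoid[OF aff] by (intro submonoid_sum) auto
  have mS: "real_vec m \<in> S" unfolding S_def by (rule real_vec_in_nonneg_span[OF mM])
  have neg: "\<exists>K\<ge>0. K *\<^sub>R real_vec m - real_vec x \<in> S" if x: "x \<in> M" for x
  proof -
    obtain n where n: "x = (\<Sum>g\<in>G. int (n g) *s g)" using G(3)[OF x] by blast
    define K where "K = (\<Sum>g\<in>G. real (n g))"
    have nK: "real (n g) \<le> K" if "g \<in> G" for g
      unfolding K_def using G(1) that by (intro member_le_sum) auto
    have "K *\<^sub>R real_vec m - real_vec x = (\<Sum>g\<in>G. (K - real (n g)) *\<^sub>R real_vec g)"
      unfolding m_def n by (simp add: real_vec_sum real_vec_smult scaleR_sum_right scaleR_left_diff_distrib sum_subtractf)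
    also have "\<dots> \<in> S" unfolding S_def
      using G(2) nK by (intro cone_sum[OF cone] cone_scale[OF cone] real_vec_in_nonneg_span) auto
    finally show ?thesis unfolding K_def by (intro exI[of _ "\<Sum>g\<in>G. real (n g)"]) (simp add: sum_nonneg)
  qed
  have abs: "\<exists>t\<ge>0. t *\<^sub>R real_vec m + x \<in> S" if "x \<in> span (real_vec ` M)" for x
    using that
  proof (induction rule: span_induct_alt)
    case base
    show ?case using cone_zero[OF cone] by (intro exI[of _ 0]) (simp add: S_def)
  next
    case (step c x y)
    then obtain t w where t: "0 \<le> t" "t *\<^sub>R real_vec m + y \<in> S" "w \<in> M" "x = real_vec w" by blast
    show ?case
    proof (cases "0 \<le> c")
      case True
      have "c *\<^sub>R x + (t *\<^sub>R real_vec m + y) \<in> S"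
        using cone_add[OF cone cone_scale[OF cone real_vec_in_nonneg_span[OF t(3)] True]] t(2)
        unfolding S_def t(4) by blast
      then show ?thesis using t(1) by (intro exI[of _ t]) (simp add: algebra_simps)
    next
      case False
      obtain K where K: "0 \<le> K" "K *\<^sub>R real_vec m - real_vec w \<in> S" using neg[OF t(3)] by blast
      have "(- c) *\<^sub>R (K *\<^sub>R real_vec m - real_vec w) + (t *\<^sub>R real_vec m + y) \<in> S"
        using cone_add[OF cone cone_scale[OF cone, of _ "- c"]] t(2) K(2) False unfolding S_def by simp
      moreover have "(- c) *\<^sub>R (K *\<^sub>R real_vec m - real_vec w) + (t *\<^sub>R real_vec m + y)
          = (t + - c * K) *\<^sub>R real_vec m + (c *\<^sub>R x + y)"
        unfolding t(4) by (simp add: algebra_simps)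
      moreover have "0 \<le> - c * K" using K(1) False by (intro mult_nonneg_nonneg) simp_all
      ultimately have "0 \<le> t + - c * K \<and> (t + - c * K) *\<^sub>R real_vec m + (c *\<^sub>R x + y) \<in> S"
        using t(1) by (metis add_nonneg_nonneg)
      then show ?thesis by blast
    qed
  qed
  have "\<exists>N::nat. real N *\<^sub>R real_vec m + x \<in> S" if x: "x \<in> span (real_vec ` M)" for x
  proof -
    obtain t where t: "0 \<le> t" "t *\<^sub>R real_vec m + x \<in> S" using abs[OF x] by blast
    obtain N :: nat where N: "t \<le> real N" using real_arch_simple by blast
    have "(t *\<^sub>R real_vec m + x) + (real N - t) *\<^sub>R real_vec m \<in> S"
      using cone_add[OF cone _ cone_scale[OF cone, of "real_vec m" "real N - t"]] t(2) N mS
      unfolding S_def by simp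
    then show ?thesis by (intro exI[of _ N]) (simp add: algebra_simps)
  qed
  then show ?thesis using that mM unfolding S_def by blast
qed

text \<open>Write \<open>y = u - v\<close>. Since \<open>y\<close> is interior, a multiple of it dominates \<open>v\<close>, and clearing denominators gives
  \<open>K * y - v \<in> M\<close> for some \<open>K\<close>; hence all large multiples of \<open>y\<close> lie in \<open>M\<close>. If all multiples from
  \<open>n \<ge> 2\<close> on lie in \<open>M\<close>, then so do the double and the triple of \<open>(n - 1) * y\<close>, and seminormality lowers \<open>n\<close>.\<close>

theorem seminormal_interior:
  assumes aff: "affine_monoid M" and sn: "seminormal M"
    and y: "y \<in> group_closure M" and int: "interior_point (nonneg_span M) (real_vec y)"
  shows "y \<in> M"
proof -
  note sub = affine_monoid_submonoid[OF aff] and cone = convex_cone_nonneg_span[OF aff]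
  obtain u v where uv: "u \<in> M" "v \<in> M" "y = u - v" using y group_closure_submonoid[OF sub] by blast
  obtain N :: nat where N: "real N *\<^sub>R real_vec y - real_vec v \<in> nonneg_span M"
    using int real_vec_in_nonneg_span[OF uv(2)] unfolding interior_point_def by blast
  have "(real N *\<^sub>R real_vec y - real_vec v) + real_vec y \<in> nonneg_span M"
    using N int cone_add[OF cone] unfolding interior_point_def by blast
  moreover have "real_vec (int (Suc N) *s y - v) = (real N *\<^sub>R real_vec y - real_vec v) + real_vec y"
    by (simp only: real_vec_diff real_vec_smult of_int_of_nat_eq) (simp add: algebra_simps)
  ultimately obtain r where r: "r > 0" "int r *s (int (Suc N) *s y - v) \<in> M"
    using integer_point_multiple[OF aff, of "int (Suc N) *s y - v"] by auto
  define K where "K = r * Suc N"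
  have K0: "K > 0" using r(1) by (simp add: K_def)
  define w where "w = int K *s y - v"
  have "w = int r *s (int (Suc N) *s y - v) + int (r - 1) *s v"
    using r(1) unfolding w_def K_def by (simp add: vec_eq_iff of_nat_diff algebra_simps)
  then have wM: "w \<in> M" using r(2) uv(2) sub by (simp add: submonoid_add submonoid_smult)
  have large: "int n *s y \<in> M" if n: "n \<ge> K * K" for n
  proof -
    define c s where "c = n div K" and "s = n mod K"
    have s: "s < K" and ncs: "n = K * c + s" using K0 by (simp_all add: c_def s_def)
    have "c \<ge> K" unfolding c_def using n K0 by (metis div_le_mono nonzero_mult_div_cancel_right not_less_zero)
    then have "s \<le> c" using s by simp
    then have "int n *s y = (int (c - s) *s (w + v) + int s *s w) + int s *s u"
      unfolding ncs w_def uv(3) by (simp add: vec_eq_iff of_nat_diff algebra_simps)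
    then show ?thesis using wM uv sub by (simp add: submonoid_add submonoid_smult)
  qed
  define n where "n = (LEAST n. \<forall>n'\<ge>n. int n' *s y \<in> M)"
  have "\<forall>n'\<ge>K * K. int n' *s y \<in> M" using large by blast
  from LeastI[of "\<lambda>n. \<forall>n'\<ge>n. int n' *s y \<in> M", OF this]
  have n: "\<forall>n'\<ge>n. int n' *s y \<in> M" unfolding n_def .
  have "n \<le> 1"
  proof (rule ccontr)
    assume "\<not> n \<le> 1"
    then have n2: "n \<ge> 2" by simp
    define l where "l = n - 1"
    have nl: "n = Suc l" "l \<ge> 1" using n2 by (simp_all add: l_def)
    have "2 *s (int l *s y) = int (2 * l) *s y" "3 *s (int l *s y) = int (3 * l) *s y"
      by (simp_all add: vec_eq_iff)
    moreover have "n \<le> 2 * l" "n \<le> 3 * l" using nl by simp_all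
    then have "int (2 * l) *s y \<in> M" "int (3 * l) *s y \<in> M" using n by blast+
    ultimately have "int l *s y \<in> M"
      using sn group_closure_smult[OF y] unfolding seminormal_def by metis
    have "int n' *s y \<in> M" if "l \<le> n'" for n'
    proof (cases "n' = l")
      case False
      then have "n \<le> n'" using that nl(1) by simp
      then show ?thesis using n by blast
    qed (use \<open>int l *s y \<in> M\<close> in simp)
    then have "\<forall>n'\<ge>l. int n' *s y \<in> M" by blast
    from Least_le[of "\<lambda>n. \<forall>n'\<ge>n. int n' *s y \<in> M", OF this]
    have "n \<le> l" unfolding n_def .
    then show False using nl by simp
  qed
  then have "int 1 *s y \<in> M" using n by blast
  then show ?thesis by simp
qed

section \<open>Faces of rational cones\<close>

lemma rational_coneE:
  assumes "rational_cone C"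
  obtains H where "finite H" "C = {x. \<forall>a\<in>H. 0 \<le> a \<bullet> x}"
proof -
  obtain H :: "(int ^ 'a) set" where "finite H" "C = {x. \<forall>a\<in>H. 0 \<le> real_vec a \<bullet> x}"
    using assms unfolding rational_cone_def by blast
  then show ?thesis using that[of "real_vec ` H"] by simp
qed

lemma convex_cone_rational_cone: "rational_cone C \<Longrightarrow> convex_cone_set C"
  by (erule rational_coneE) (simp add: convex_cone_set_def inner_add_right)

lemma cone_face_subset: "cone_face D C \<Longrightarrow> D \<subseteq> C"
  by (auto simp: cone_face_def)

lemma cone_face_left:
  assumes "cone_face D C" "u \<in> C" "v \<in> C" "u + v \<in> D"
  shows "u \<in> D"
proof -
  consider "D = C" | a where "\<forall>x\<in>C. 0 \<le> a \<bullet> x" "D = C \<inter> {x. a \<bullet> x = 0}"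
    using assms(1) unfolding cone_face_def by blast
  then show ?thesis
  proof cases
    case 2
    have "a \<bullet> u + a \<bullet> v = 0" using assms(4) 2(2) by (simp add: inner_add_right)
    moreover have "0 \<le> a \<bullet> u" "0 \<le> a \<bullet> v" using 2(1) assms(2,3) by blast+
    ultimately have "a \<bullet> u = 0" by linarith
    then show ?thesis using 2(2) assms(2) by simp
  qed (use assms in simp)
qed

lemma pointed_cone_antisym:
  assumes "pointed_cone C" "x \<in> C" "- x \<in> C"
  shows "x = 0"
proof -
  have "cone_face {0} C" using assms(1) by (simp add: pointed_cone_def)
  from cone_face_left[OF this assms(2,3)] show ?thesis by simp
qed

text \<open>The smallest face of \<open>C\<close> that contains \<open>y\<close>, by the lemmas below.\<close>

definition face_hull :: "(real ^ 'd) set \<Rightarrow> real ^ 'd \<Rightarrow> (real ^ 'd) set"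
  where "face_hull C y = {x \<in> C. \<exists>N::nat. real N *\<^sub>R y - x \<in> C}"

lemma half_spaces_absorb:
  assumes H: "finite H" "C = {x. \<forall>a\<in>H. 0 \<le> a \<bullet> x}" and y: "y \<in> C"
    and z: "\<And>a. a \<in> H \<Longrightarrow> a \<bullet> y = 0 \<Longrightarrow> 0 \<le> a \<bullet> z"
  shows "\<exists>N::nat. real N *\<^sub>R y + z \<in> C"
proof -
  have "\<forall>\<^sub>F N in sequentially. \<forall>a\<in>H. 0 \<le> a \<bullet> (real N *\<^sub>R y + z)"
  proof (rule eventually_ball_finite[OF H(1)], rule ballI)
    fix a assume a: "a \<in> H"
    show "\<forall>\<^sub>F N in sequentially. 0 \<le> a \<bullet> (real N *\<^sub>R y + z)"
    proof (cases "a \<bullet> y = 0")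
      case True
      then show ?thesis using z[OF a] by (simp add: inner_add_right)
    next
      case False
      moreover have "0 \<le> a \<bullet> y" using y a unfolding H(2) by blast
      ultimately have pos: "0 < a \<bullet> y" by simp
      have "0 \<le> real N * (a \<bullet> y) + a \<bullet> z" if "N \<ge> nat \<lceil>- (a \<bullet> z) / (a \<bullet> y)\<rceil>" for N
      proof -
        have "- (a \<bullet> z) / (a \<bullet> y) \<le> real N" using that by linarith
        then show ?thesis using pos by (simp add: field_simps)
      qed
      then show ?thesis unfolding eventually_sequentially inner_add_right inner_scaleR_right by blast
    qed
  qed
  then have "\<exists>N. \<forall>a\<in>H. 0 \<le> a \<bullet> (real N *\<^sub>R y + z)"
    using eventually_happens'[OF sequentially_bot] by blast
  then show ?thesis unfolding H(2) by blast
qed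

text \<open>The face is cut out by the sum \<open>s\<close> of the normals that vanish at \<open>y\<close>. If \<open>s = 0\<close>, these normals vanish
  on all of \<open>C\<close> and the face is \<open>C\<close> itself.\<close>

lemma cone_face_face_hull:
  assumes "rational_cone C" "y \<in> C"
  shows "cone_face (face_hull C y) C"
proof -
  obtain H where H: "finite H" "C = {x. \<forall>a\<in>H. 0 \<le> a \<bullet> x}" using rational_coneE[OF assms(1)] by blast
  define A where "A = {a \<in> H. a \<bullet> y = 0}"
  define s where "s = (\<Sum>a\<in>A. a)"
  have finA: "finite A" using H(1) by (simp add: A_def)
  have nn: "0 \<le> a \<bullet> x" if "a \<in> A" "x \<in> C" for a x using that unfolding A_def H(2) by blast
  have s: "s \<bullet> x = (\<Sum>a\<in>A. a \<bullet> x)" for x by (simp add: s_def inner_sum_left)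
  have eq: "face_hull C y = C \<inter> {x. s \<bullet> x = 0}"
  proof (intro equalityI subsetI)
    fix x assume "x \<in> face_hull C y"
    then obtain N :: nat where x: "x \<in> C" "real N *\<^sub>R y - x \<in> C" unfolding face_hull_def by blast
    have "a \<bullet> x = 0" if a: "a \<in> A" for a
    proof -
      have "0 \<le> a \<bullet> (real N *\<^sub>R y - x)" using nn[OF a x(2)] .
      then have "a \<bullet> x \<le> 0" using a by (simp add: A_def inner_diff_right)
      then show ?thesis using nn[OF a x(1)] by simp
    qed
    then show "x \<in> C \<inter> {x. s \<bullet> x = 0}" using x(1) s by simp
  next
    fix x assume x: "x \<in> C \<inter> {x. s \<bullet> x = 0}"
    then have "(\<Sum>a\<in>A. a \<bullet> x) = 0" using s by simp
    then have "\<forall>a\<in>A. a \<bullet> x = 0" using finA nn x by (subst (asm) sum_nonneg_eq_0_iff) auto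
    then have "\<exists>N::nat. real N *\<^sub>R y + - x \<in> C"
      by (intro half_spaces_absorb[OF H assms(2)]) (simp add: A_def)
    then show "x \<in> face_hull C y" using x unfolding face_hull_def by simp
  qed
  have "\<forall>x\<in>C. 0 \<le> s \<bullet> x" using nn unfolding s by (simp add: sum_nonneg)
  then show ?thesis
    using eq unfolding cone_face_def by (cases "s = 0") auto
qed

lemma in_face_hull: "convex_cone_set C \<Longrightarrow> y \<in> C \<Longrightarrow> y \<in> face_hull C y"
  unfolding face_hull_def by (intro CollectI conjI exI[of _ 1]) (simp_all add: cone_zero)

lemma convex_cone_face:
  assumes "convex_cone_set C" "cone_face D C"
  shows "convex_cone_set D"
proof -
  consider "D = C" | a where "D = C \<inter> {x. a \<bullet> x = 0}"
    using assms(2) unfolding cone_face_def by blast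
  then show ?thesis
    using assms(1) by cases (auto simp: convex_cone_set_def inner_add_right)
qed

lemma interior_point_face_hull:
  assumes "rational_cone C" "y \<in> C"
  shows "interior_point (face_hull C y) y"
  unfolding interior_point_def
proof (intro conjI ballI)
  note cone = convex_cone_rational_cone[OF assms(1)] and face = cone_face_face_hull[OF assms]
  show y: "y \<in> face_hull C y" by (rule in_face_hull[OF cone assms(2)])
  fix z assume z: "z \<in> face_hull C y"
  then obtain N :: nat where N: "z \<in> C" "real N *\<^sub>R y - z \<in> C" unfolding face_hull_def by blast
  have "real N *\<^sub>R y \<in> face_hull C y"
    by (intro cone_scale[OF convex_cone_face[OF cone face]] y) simp
  then have "real N *\<^sub>R y - z \<in> face_hull C y"
    using cone_face_left[OF face N(2,1)] by simp
  then show "\<exists>N::nat. real N *\<^sub>R y - z \<in> face_hull C y" by blast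
qed

section \<open>Seminormal monoidal complexes\<close>

locale seminormal_fan =
  fixes \<Sigma> :: "(real ^ 'd) set set" and M :: "(real ^ 'd) set \<Rightarrow> (int ^ 'd) set"
  assumes fan: "rational_pointed_fan \<Sigma>" and complex: "seminormal_complex \<Sigma> M"
begin

lemma rational: "C \<in> \<Sigma> \<Longrightarrow> rational_cone C"
  and pointed: "C \<in> \<Sigma> \<Longrightarrow> pointed_cone C"
  using fan by (simp_all add: rational_pointed_fan_def)

lemma face_in_fan: "C \<in> \<Sigma> \<Longrightarrow> cone_face D C \<Longrightarrow> D \<in> \<Sigma>"
  using fan unfolding rational_pointed_fan_def by blast

lemma inter_face: "C \<in> \<Sigma> \<Longrightarrow> D \<in> \<Sigma> \<Longrightarrow> cone_face (C \<inter> D) C"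
  and inter_face': "C \<in> \<Sigma> \<Longrightarrow> D \<in> \<Sigma> \<Longrightarrow> cone_face (C \<inter> D) D"
  using fan by (simp_all add: rational_pointed_fan_def)

lemma affine: "C \<in> \<Sigma> \<Longrightarrow> affine_monoid (M C)"
  and seminormal: "C \<in> \<Sigma> \<Longrightarrow> seminormal (M C)"
  and monoid_subset: "C \<in> \<Sigma> \<Longrightarrow> real_vec ` M C \<subseteq> C"
  and span_monoid: "C \<in> \<Sigma> \<Longrightarrow> nonneg_span (M C) = C"
  using complex by (simp_all add: seminormal_complex_def monoidal_complex_def)

lemma face_monoid: "C \<in> \<Sigma> \<Longrightarrow> cone_face D C \<Longrightarrow> M D = {x \<in> M C. real_vec x \<in> D}"
  using complex unfolding seminormal_complex_def monoidal_complex_def by blast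

lemma submonoid: "C \<in> \<Sigma> \<Longrightarrow> add_submonoid (M C)"
  by (rule affine_monoid_submonoid[OF affine])

lemma cone: "C \<in> \<Sigma> \<Longrightarrow> convex_cone_set C"
  by (rule convex_cone_rational_cone[OF rational])

lemma in_cone: "C \<in> \<Sigma> \<Longrightarrow> a \<in> M C \<Longrightarrow> real_vec a \<in> C"
  using monoid_subset by blast

lemma face_monoid_subset: "C \<in> \<Sigma> \<Longrightarrow> cone_face D C \<Longrightarrow> M D \<subseteq> M C"
  using face_monoid by blast

lemma monoid_transfer:
  assumes "C \<in> \<Sigma>" "D \<in> \<Sigma>" "a \<in> M C" "real_vec a \<in> D"
  shows "a \<in> M D"
proof -
  have "a \<in> M (C \<inter> D)"
    using assms in_cone face_monoid[OF assms(1) inter_face[OF assms(1,2)]] by blast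
  then show ?thesis using face_monoid[OF assms(2) inter_face'[OF assms(1,2)]] by blast
qed

lemma summand_in_monoid:
  assumes "C \<in> \<Sigma>" "D \<in> \<Sigma>" "a \<in> M C" "b \<in> M C" "a + b \<in> M D"
  shows "a \<in> M D"
proof -
  have ab: "a + b \<in> M C" using assms submonoid submonoid_add by blast
  have "real_vec a + real_vec b \<in> C \<inter> D"
    using in_cone[OF assms(1) ab] in_cone[OF assms(2,5)] by (simp add: real_vec_add)
  then have "real_vec a \<in> C \<inter> D"
    using cone_face_left[OF inter_face[OF assms(1,2)]] in_cone assms by blast
  then show ?thesis using monoid_transfer assms by blast
qed

lemma sum_eq_zero:
  assumes "C \<in> \<Sigma>" "a \<in> M C" "b \<in> M C" "a + b = 0"
  shows "a = 0"
proof -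
  have "real_vec b = - real_vec a" using assms(4) by (metis add_eq_0_iff real_vec_uminus)
  then have "real_vec a = 0"
    using pointed_cone_antisym[OF pointed[OF assms(1)]] in_cone[OF assms(1)] assms(2,3) by metis
  then show ?thesis by (metis real_vec_eq_iff real_vec_zero)
qed

lemma in_maximal_cone:
  assumes "C \<in> \<Sigma>"
  obtains D where "D \<in> maximal_cones \<Sigma>" "C \<subseteq> D"
proof -
  have "finite \<Sigma>" using fan by (simp add: rational_pointed_fan_def)
  then obtain D where "D \<in> \<Sigma>" "C \<subseteq> D" "\<And>E. E \<in> \<Sigma> \<Longrightarrow> D \<subseteq> E \<Longrightarrow> D = E"
    using finite_has_maximal2[OF _ assms] by blast
  then show ?thesis using that[of D] unfolding maximal_cones_def by blast
qed

lemma maximal_in_fan: "C \<in> maximal_cones \<Sigma> \<Longrightarrow> C \<in> \<Sigma>"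
  by (simp add: maximal_cones_def)

text \<open>Together with \<open>face_hull\<close> this describes a seminormal monoid as the union, over the faces \<open>D\<close>, of the
  interior points of \<open>D\<close> in the group of \<open>M D\<close>.\<close>

lemma interior_in_monoid:
  assumes "C \<in> \<Sigma>" "y \<in> group_closure (M C)" "interior_point C (real_vec y)"
  shows "y \<in> M C"
  using seminormal_interior[OF affine seminormal] span_monoid assms by metis

end


section \<open>Frobenius splittings\<close>

locale frobenius_ring = cring R for R (structure) +
  fixes p :: nat
  assumes p_pos: "0 < p"
    and frobenius_add: "a \<in> carrier R \<Longrightarrow> b \<in> carrier R \<Longrightarrow>
      (a \<oplus> b) [^] p = a [^] p \<oplus> b [^] p"
begin

abbreviation "A \<equiv> frobenius_image p R"

abbreviation "RA \<equiv> R\<lparr>carrier := A\<rparr>"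

lemma frobenius_zero: "\<zero> [^] p = \<zero>"
  using p_pos by (simp add: nat_pow_zero)

lemma frobenius_mult: "a \<in> carrier R \<Longrightarrow> b \<in> carrier R \<Longrightarrow> (a \<otimes> b) [^] p = a [^] p \<otimes> b [^] p"
  by (simp add: nat_pow_distrib)

lemma frobenius_uminus:
  assumes "a \<in> carrier R"
  shows "(\<ominus> a) [^] p = \<ominus> (a [^] p)"
proof -
  have "a [^] p \<oplus> (\<ominus> a) [^] p = \<zero>"
    using frobenius_add[of a "\<ominus> a"] assms by (simp add: r_neg frobenius_zero)
  then show ?thesis using assms by (metis a_inv_closed add.inv_equality nat_pow_closed a_comm)
qed

lemma frobenius_diff:
  "a \<in> carrier R \<Longrightarrow> b \<in> carrier R \<Longrightarrow> (a \<ominus> b) [^] p = a [^] p \<ominus> b [^] p"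
  by (simp add: a_minus_def frobenius_add frobenius_uminus)

lemma in_frobenius_image: "a \<in> carrier R \<Longrightarrow> a [^] p \<in> A"
  by (simp add: frobenius_image_def)

lemma frobenius_imageE:
  assumes "x \<in> A" obtains a where "a \<in> carrier R" "x = a [^] p"
  using assms by (auto simp: frobenius_image_def)

lemma frobenius_image_carrier: "A \<subseteq> carrier R"
  by (auto simp: frobenius_image_def)

lemma subring_frobenius_image: "subring A R"
proof (rule subringI)
  show "A \<subseteq> carrier R" by (rule frobenius_image_carrier)
  show "\<one> \<in> A" using in_frobenius_image[of \<one>] by simp
  show "\<ominus> h \<in> A" if "h \<in> A" for h
  proof -
    obtain a where "a \<in> carrier R" "h = a [^] p" using frobenius_imageE[OF \<open>h \<in> A\<close>] .
    then show ?thesis using in_frobenius_image[of "\<ominus> a"] by (simp add: frobenius_uminus)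
  qed
  show "h \<otimes> h' \<in> A" if "h \<in> A" "h' \<in> A" for h h'
  proof -
    obtain a where a: "a \<in> carrier R" "h = a [^] p" using frobenius_imageE[OF \<open>h \<in> A\<close>] .
    obtain b where b: "b \<in> carrier R" "h' = b [^] p" using frobenius_imageE[OF \<open>h' \<in> A\<close>] .
    show ?thesis using in_frobenius_image[of "a \<otimes> b"] a b by (simp add: frobenius_mult)
  qed
  show "h \<oplus> h' \<in> A" if "h \<in> A" "h' \<in> A" for h h'
  proof -
    obtain a where a: "a \<in> carrier R" "h = a [^] p" using frobenius_imageE[OF \<open>h \<in> A\<close>] .
    obtain b where b: "b \<in> carrier R" "h' = b [^] p" using frobenius_imageE[OF \<open>h' \<in> A\<close>] .
    show ?thesis using in_frobenius_image[of "a \<oplus> b"] a b by (simp add: frobenius_add)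
  qed
qed

lemma cring_frobenius_image: "cring RA"
proof (intro cring.intro)
  show "ring RA" by (rule subring_is_ring[OF subring_frobenius_image])
  show "comm_monoid RA"
    using submonoid_is_comm_monoid[OF subring.axioms(2)[OF subring_frobenius_image]] by simp
qed

text \<open>The common consequence of splitting and purity that is strong enough to exclude torsion: an
  equation \<open>f\<^sup>p \<in> g\<^sup>p R\<close> is explained by divisibility before taking \<open>p\<close>-th powers.\<close>

definition frobenius_contracted :: bool
  where "frobenius_contracted \<longleftrightarrow>
    (\<forall>f\<in>carrier R. \<forall>g\<in>carrier R. \<forall>r\<in>carrier R. f [^] p = g [^] p \<otimes> r \<longrightarrow>
      (\<exists>h\<in>carrier R. f [^] p = (g \<otimes> h) [^] p))"

lemma submodule_self_iff:
  "submodule H RA (self_module R) \<longleftrightarrow>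
    subgroup H (add_monoid R) \<and> (\<forall>a\<in>A. \<forall>x\<in>H. a \<otimes> x \<in> H)"
proof -
  have "subgroup H (add_monoid (self_module R)) \<longleftrightarrow> subgroup H (add_monoid R)"
    by (simp add: subgroup_def m_inv_def self_module_def)
  then have "submodule H RA (self_module R) \<longleftrightarrow>
      subgroup H (add_monoid R) \<and> (\<forall>a x. a \<in> A \<longrightarrow> x \<in> H \<longrightarrow> a \<otimes> x \<in> H)"
    unfolding submodule_def submodule_axioms_def by (simp add: self_module_def[of R])
  then show ?thesis by blast
qed

text \<open>Decompose \<open>r = h\<^sup>p + q\<close> along the complement \<open>Q\<close>. Then \<open>g\<^sup>p q = (f - g h)\<^sup>p\<close> lies in both summands and
  vanishes.\<close>

lemma F_split_imp_contracted:
  assumes "F_split p R"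
  shows "frobenius_contracted"
  unfolding frobenius_contracted_def
proof (intro ballI impI)
  fix f g r assume f: "f \<in> carrier R" and g: "g \<in> carrier R" and r: "r \<in> carrier R"
    and eq: "f [^] p = g [^] p \<otimes> r"
  obtain Q where Q: "submodule Q RA (self_module R)" "A \<inter> Q = {\<zero>}" "A <+>\<^bsub>R\<^esub> Q = carrier R"
  proof -
    obtain Q where Q: "submodule Q RA (self_module R)" "A \<inter> Q = {\<zero>\<^bsub>self_module R\<^esub>}"
        "A <+>\<^bsub>self_module R\<^esub> Q = carrier (self_module R)"
      using assms unfolding F_split_def direct_summand_def by blast
    have "A \<inter> Q = {\<zero>}" "A <+>\<^bsub>R\<^esub> Q = carrier R"
      using Q(2,3) by (simp_all add: self_module_def set_add_def set_mult_def)
    then show thesis using that Q(1) by blast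
  qed
  have Q': "subgroup Q (add_monoid R)" "\<And>a x. a \<in> A \<Longrightarrow> x \<in> Q \<Longrightarrow> a \<otimes> x \<in> Q"
    using Q(1) unfolding submodule_self_iff by blast+
  have QR: "Q \<subseteq> carrier R" using subgroup.subset[OF Q'(1)] by simp
  have "r \<in> A <+>\<^bsub>R\<^esub> Q" using r Q(3) by simp
  then obtain a q where aq: "a \<in> A" "q \<in> Q" "r = a \<oplus> q"
    by (auto simp: set_add_def set_mult_def)
  obtain h where h: "h \<in> carrier R" "a = h [^] p" using frobenius_imageE[OF aq(1)] .
  have qR: "q \<in> carrier R" using aq(2) QR by blast
  have gh: "(g \<otimes> h) [^] p = g [^] p \<otimes> a" using g h frobenius_mult by simp
  have "f [^] p = g [^] p \<otimes> a \<oplus> g [^] p \<otimes> q"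
    unfolding eq aq(3) using g h qR by (simp add: r_distr)
  then have "g [^] p \<otimes> q = f [^] p \<ominus> (g \<otimes> h) [^] p"
  proof -
    have cancel: "(x \<oplus> y) \<ominus> x = y" if "x \<in> carrier R" "y \<in> carrier R" for x y
    proof -
      have "(x \<oplus> y) \<ominus> x = (y \<oplus> x) \<oplus> \<ominus> x" using that by (simp add: a_minus_def a_comm)
      also have "\<dots> = y" using that by (simp add: a_assoc r_neg)
      finally show ?thesis .
    qed
    assume "f [^] p = g [^] p \<otimes> a \<oplus> g [^] p \<otimes> q"
    then show ?thesis unfolding gh
      using cancel[of "g [^] p \<otimes> a" "g [^] p \<otimes> q"] g qR frobenius_image_carrier aq(1) by auto
  qed
  then have "g [^] p \<otimes> q = (f \<ominus> g \<otimes> h) [^] p" using f g h by (simp add: frobenius_diff)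
  then have "g [^] p \<otimes> q \<in> A" using f g h in_frobenius_image by simp
  moreover have "g [^] p \<otimes> q \<in> Q" using Q'(2) in_frobenius_image[OF g] aq(2) by blast
  ultimately have "g [^] p \<otimes> q = \<zero>" using Q(2) by blast
  then have "f [^] p = (g \<otimes> h) [^] p"
    using \<open>f [^] p = g [^] p \<otimes> a \<oplus> g [^] p \<otimes> q\<close> gh g h by simp
  then show "\<exists>h\<in>carrier R. f [^] p = (g \<otimes> h) [^] p" using h(1) by blast
qed

lemma tensor_relations_carrier:
  assumes "Module.module RA N"
  shows "tensor_relations RA N (self_module R) \<subseteq> carrier (free_Abelian_group (carrier N \<times> carrier R))"
proof -
  interpret N: Module.module RA N by fact
  let ?G = "free_Abelian_group (carrier N \<times> carrier R)"
  have diff: "x - y \<in> carrier ?G" if "x \<in> carrier ?G" "y \<in> carrier ?G" for x y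
    using that keys_diff[of x y] by auto
  have AR: "\<And>x. x \<in> A \<Longrightarrow> x \<in> carrier R" using frobenius_image_carrier by blast
  have frag: "frag_of (x, y) \<in> carrier ?G" if "x \<in> carrier N" "y \<in> carrier R" for x y
    using that by (simp del: carrier_free_Abelian_group_iff)
  have smult: "a \<odot>\<^bsub>N\<^esub> x \<in> carrier N" if "a \<in> A" "x \<in> carrier N" for a x
    using N.smult_closed that by simp
  show ?thesis
    unfolding tensor_relations_def self_module_def using AR smult
    by (auto simp del: carrier_free_Abelian_group_iff intro!: diff frag)
qed

text \<open>Purity is applied to the cyclic module \<open>N = A / g\<^sup>p A\<close>. The class of \<open>f\<^sup>p\<close> becomes zero in the tensor
  product with \<open>R\<close>, since \<open>f\<^sup>p \<otimes> 1 = 1 \<otimes> g\<^sup>p r = g\<^sup>p \<otimes> r\<close>; hence \<open>f\<^sup>p \<in> g\<^sup>p A\<close>. The injection \<open>\<iota>\<close> moves the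
  cosets into the carrier type over which purity quantifies, by reading ring elements as constant
  sequences.\<close>

lemma F_pure_imp_contracted:
  fixes u :: "'u itself"
  assumes "F_pure u p R"
  shows "frobenius_contracted"
  unfolding frobenius_contracted_def
proof (intro ballI impI)
  fix f g r assume f: "f \<in> carrier R" and g: "g \<in> carrier R" and r: "r \<in> carrier R"
    and eq: "f [^] p = g [^] p \<otimes> r"
  interpret RA: cring RA by (rule cring_frobenius_image)
  define I where "I = PIdl\<^bsub>RA\<^esub> (g [^] p)"
  have I: "ideal I RA"
    unfolding I_def using in_frobenius_image[OF g] by (intro RA.cgenideal_ideal) simp
  interpret I: ideal I RA by (rule I)
  define Q where "Q = RA Quot I"
  interpret Q: cring Q unfolding Q_def by (rule I.quotient_is_cring[OF cring_frobenius_image])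
  define \<pi> where "\<pi> = (\<lambda>a. I +>\<^bsub>RA\<^esub> a)"
  have hom: "\<pi> \<in> ring_hom RA Q" unfolding \<pi>_def Q_def by (rule I.rcos_ring_hom)
  have \<pi>_closed: "\<pi> a \<in> carrier Q" if "a \<in> A" for a
    using ring_hom_closed[OF hom] that by simp
  have \<pi>_add: "\<pi> (a \<oplus> b) = \<pi> a \<oplus>\<^bsub>Q\<^esub> \<pi> b" if "a \<in> A" "b \<in> A" for a b
    using ring_hom_add[OF hom, of a b] that by simp
  have \<pi>_mult: "\<pi> (a \<otimes> b) = \<pi> a \<otimes>\<^bsub>Q\<^esub> \<pi> b" if "a \<in> A" "b \<in> A" for a b
    using ring_hom_mult[OF hom, of a b] that by simp
  have \<pi>_one: "\<pi> \<one> = \<one>\<^bsub>Q\<^esub>" using ring_hom_one[OF hom] by simp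
  define \<iota> :: "'a set \<Rightarrow> 'u + (nat \<Rightarrow> 'a) set" where "\<iota> = (\<lambda>S. Inr ((\<lambda>x _. x) ` S))"
  have "inj \<iota>"
  proof (rule injI)
    fix S T assume "\<iota> S = \<iota> T"
    then have "(\<lambda>x (_ :: nat). x) ` S = (\<lambda>x _. x) ` T" by (simp add: \<iota>_def)
    moreover have "inj (\<lambda>(x :: 'a) (_ :: nat). x)" by (rule injI) (metis)
    ultimately show "S = T" by (simp add: inj_image_eq_iff)
  qed
  define \<kappa> where "\<kappa> = inv_into UNIV \<iota>"
  have [simp]: "\<kappa> (\<iota> S) = S" for S using \<open>inj \<iota>\<close> by (simp add: \<kappa>_def)
  define N :: "('a, 'u + (nat \<Rightarrow> 'a) set) module" where "N = \<lparr>carrier = \<iota> ` carrier Q, monoid.mult = undefined, one = undefined,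
    ring.zero = \<iota> \<zero>\<^bsub>Q\<^esub>, ring.add = (\<lambda>S T. \<iota> (\<kappa> S \<oplus>\<^bsub>Q\<^esub> \<kappa> T)),
    module.smult = (\<lambda>a S. \<iota> (\<pi> a \<otimes>\<^bsub>Q\<^esub> \<kappa> S))\<rparr>"
  have N: "carrier N = \<iota> ` carrier Q" "\<zero>\<^bsub>N\<^esub> = \<iota> \<zero>\<^bsub>Q\<^esub>" "\<iota> s \<oplus>\<^bsub>N\<^esub> \<iota> t = \<iota> (s \<oplus>\<^bsub>Q\<^esub> t)"
    "a \<odot>\<^bsub>N\<^esub> \<iota> s = \<iota> (\<pi> a \<otimes>\<^bsub>Q\<^esub> s)" for a s t
    by (simp_all add: N_def)
  have mod: "Module.module RA N"
  proof (rule moduleI)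
    show "cring RA" by (rule cring_frobenius_image)
    show "abelian_group N"
    proof (rule abelian_groupI)
      show "\<exists>y\<in>carrier N. y \<oplus>\<^bsub>N\<^esub> x = \<zero>\<^bsub>N\<^esub>" if "x \<in> carrier N" for x
      proof -
        obtain s where s: "s \<in> carrier Q" "x = \<iota> s" using \<open>x \<in> carrier N\<close> unfolding N by blast
        show ?thesis using s by (intro bexI[of _ "\<iota> (\<ominus>\<^bsub>Q\<^esub> s)"]) (simp_all add: N Q.l_neg)
      qed
    qed (auto simp: N Q.a_ac)
    fix a b x y assume a: "a \<in> carrier RA" and x: "x \<in> carrier N"
    obtain s where s: "s \<in> carrier Q" "x = \<iota> s" using x unfolding N by blast
    have a': "a \<in> A" using a by simp
    show "a \<odot>\<^bsub>N\<^esub> x \<in> carrier N" using s \<pi>_closed[OF a'] by (simp add: N)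
    show "a \<odot>\<^bsub>N\<^esub> (x \<oplus>\<^bsub>N\<^esub> y) = a \<odot>\<^bsub>N\<^esub> x \<oplus>\<^bsub>N\<^esub> a \<odot>\<^bsub>N\<^esub> y" if "y \<in> carrier N"
    proof -
      obtain t where t: "t \<in> carrier Q" "y = \<iota> t" using \<open>y \<in> carrier N\<close> unfolding N by blast
      show ?thesis using s t \<pi>_closed[OF a'] by (simp add: N Q.r_distr)
    qed
    show "(a \<oplus>\<^bsub>RA\<^esub> b) \<odot>\<^bsub>N\<^esub> x = a \<odot>\<^bsub>N\<^esub> x \<oplus>\<^bsub>N\<^esub> b \<odot>\<^bsub>N\<^esub> x" if "b \<in> carrier RA"
      using s a' that \<pi>_closed by (simp add: N \<pi>_add Q.l_distr)
    show "(a \<otimes>\<^bsub>RA\<^esub> b) \<odot>\<^bsub>N\<^esub> x = a \<odot>\<^bsub>N\<^esub> (b \<odot>\<^bsub>N\<^esub> x)" if "b \<in> carrier RA"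
      using s a' that \<pi>_closed by (simp add: N \<pi>_mult Q.m_assoc)
  next
    fix x assume "x \<in> carrier N"
    then obtain s where "s \<in> carrier Q" "x = \<iota> s" unfolding N by blast
    then show "\<one>\<^bsub>RA\<^esub> \<odot>\<^bsub>N\<^esub> x = x" by (simp add: N \<pi>_one)
  qed
  then have inj: "inj_on (\<lambda>x. pure_tensor RA N (self_module R) x \<one>) (carrier N)"
    using assms unfolding F_pure_def pure_subring_def by blast
  let ?G = "free_Abelian_group (carrier N \<times> carrier R)"
  let ?rel = "tensor_relations RA N (self_module R)"
  interpret G: group ?G by simp
  have rel_carrier: "?rel \<subseteq> carrier ?G" by (rule tensor_relations_carrier[OF mod])
  define K where "K = generate ?G ?rel"
  have K: "subgroup K ?G" unfolding K_def by (rule G.generate_is_subgroup[OF rel_carrier])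
  have K_diff: "x - y \<in> K" if "x \<in> K" "y \<in> K" for x y
  proof -
    have "y \<in> carrier ?G" using subgroup.subset[OF K] that(2) by blast
    then have "inv\<^bsub>?G\<^esub> y = - y" by simp
    then have "- y \<in> K" using subgroup.m_inv_closed[OF K that(2)] by simp
    from subgroup.m_closed[OF K that(1) this] show ?thesis by simp
  qed
  have K_zero: "0 \<in> K" using subgroup.one_closed[OF K] by simp
  have K_add: "x + y \<in> K" if "x \<in> K" "y \<in> K" for x y
    using subgroup.m_closed[OF K that] by simp
  have zN: "\<zero>\<^bsub>N\<^esub> \<in> carrier N" by (simp add: N)
  have biadd: "frag_of (x \<oplus>\<^bsub>N\<^esub> x', y) - frag_of (x, y) - frag_of (x', y) \<in> ?rel"
    if "x \<in> carrier N" "x' \<in> carrier N" "y \<in> carrier R" for x x' y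
    unfolding tensor_relations_def
    by (rule UnI1, rule UnI1, rule CollectI, rule exI[of _ x], rule exI[of _ x'], rule exI[of _ y])
      (use that in \<open>simp add: self_module_def\<close>)
  have zero_left: "frag_of (\<zero>\<^bsub>N\<^esub>, y) \<in> K" if y: "y \<in> carrier R" for y
  proof -
    have "\<zero>\<^bsub>N\<^esub> \<oplus>\<^bsub>N\<^esub> \<zero>\<^bsub>N\<^esub> = \<zero>\<^bsub>N\<^esub>" by (simp add: N)
    then have "frag_of (\<zero>\<^bsub>N\<^esub>, y) - frag_of (\<zero>\<^bsub>N\<^esub>, y) - frag_of (\<zero>\<^bsub>N\<^esub>, y) \<in> ?rel"
      using biadd[OF zN zN y] by simp
    then have "frag_of (\<zero>\<^bsub>N\<^esub>, y) - frag_of (\<zero>\<^bsub>N\<^esub>, y) - frag_of (\<zero>\<^bsub>N\<^esub>, y) \<in> K"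
      unfolding K_def by (rule generate.incl)
    then have "- frag_of (\<zero>\<^bsub>N\<^esub>, y) \<in> K" by simp
    from K_diff[OF K_zero this] show ?thesis by simp
  qed
  have move: "frag_of (a \<odot>\<^bsub>N\<^esub> x, y) - frag_of (x, a \<otimes> y) \<in> K"
    if "a \<in> A" "x \<in> carrier N" "y \<in> carrier R" for a x y
  proof -
    have "frag_of (a \<odot>\<^bsub>N\<^esub> x, y) - frag_of (x, a \<otimes> y) \<in> ?rel"
      unfolding tensor_relations_def self_module_def using that by auto
    then show ?thesis unfolding K_def by (rule generate.incl)
  qed
  define e where "e = \<iota> \<one>\<^bsub>Q\<^esub>"
  have e: "e \<in> carrier N" by (simp add: e_def N)
  have ae: "a \<odot>\<^bsub>N\<^esub> e = \<iota> (\<pi> a)" if "a \<in> A" for a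
    using \<pi>_closed[OF that] by (simp add: e_def N)
  define x where "x = f [^] p \<odot>\<^bsub>N\<^esub> e"
  have xN: "x \<in> carrier N" unfolding x_def ae[OF in_frobenius_image[OF f]]
    using \<pi>_closed[OF in_frobenius_image[OF f]] by (simp add: N)
  have gA: "g [^] p \<in> A" by (rule in_frobenius_image[OF g])
  have "\<pi> (g [^] p) = \<zero>\<^bsub>Q\<^esub>"
    unfolding \<pi>_def Q_def using RA.cgenideal_self[of "g [^] p"] gA
    by (simp add: I_def FactRing_def I.a_rcos_const[unfolded I_def])
  then have ge: "g [^] p \<odot>\<^bsub>N\<^esub> e = \<zero>\<^bsub>N\<^esub>" unfolding ae[OF gA] by (simp add: N)
  have 1: "frag_of (x, \<one>) - frag_of (e, f [^] p) \<in> K"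
    using move[OF in_frobenius_image[OF f] e one_closed] f by (simp add: x_def)
  have 2: "frag_of (\<zero>\<^bsub>N\<^esub>, r) - frag_of (e, f [^] p) \<in> K"
    using move[OF gA e r] unfolding ge eq .
  have "(frag_of (x, \<one>) - frag_of (e, f [^] p)) - (frag_of (\<zero>\<^bsub>N\<^esub>, r) - frag_of (e, f [^] p)) \<in> K"
    by (rule K_diff[OF 1 2])
  then have "frag_of (x, \<one>) - frag_of (\<zero>\<^bsub>N\<^esub>, r) \<in> K" by simp
  from K_add[OF this K_diff[OF zero_left[OF r] zero_left[OF one_closed]]]
  have k: "frag_of (x, \<one>) - frag_of (\<zero>\<^bsub>N\<^esub>, \<one>) \<in> K" by simp
  have fz: "frag_of (\<zero>\<^bsub>N\<^esub>, \<one>) \<in> carrier ?G"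
    using zN by (simp del: carrier_free_Abelian_group_iff)
  have "K #>\<^bsub>?G\<^esub> frag_of (x, \<one>) = K #>\<^bsub>?G\<^esub> frag_of (\<zero>\<^bsub>N\<^esub>, \<one>)"
  proof (rule G.repr_independence[OF _ fz K, symmetric])
    show "frag_of (x, \<one>) \<in> K #>\<^bsub>?G\<^esub> frag_of (\<zero>\<^bsub>N\<^esub>, \<one>)"
      unfolding r_coset_def using k by force
  qed
  then have "pure_tensor RA N (self_module R) x \<one> = pure_tensor RA N (self_module R) \<zero>\<^bsub>N\<^esub> \<one>"
    by (simp add: pure_tensor_def Let_def self_module_def K_def)
  then have "x = \<zero>\<^bsub>N\<^esub>" using inj_onD[OF inj] xN zN by blast
  then have "\<iota> (\<pi> (f [^] p)) = \<iota> \<zero>\<^bsub>Q\<^esub>" unfolding x_def ae[OF in_frobenius_image[OF f]] by (simp add: N)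
  then have "\<pi> (f [^] p) = \<zero>\<^bsub>Q\<^esub>" using \<open>inj \<iota>\<close> by (simp add: inj_eq)
  then have "f [^] p \<in> I"
    unfolding \<pi>_def Q_def FactRing_def using I.a_rcos_self[of "f [^] p"] in_frobenius_image[OF f] by simp
  then obtain t where t: "t \<in> A" "f [^] p = t \<otimes> g [^] p"
    unfolding I_def cgenideal_def by auto
  obtain h where h: "h \<in> carrier R" "t = h [^] p" using frobenius_imageE[OF t(1)] .
  have "f [^] p = (g \<otimes> h) [^] p" using t h g by (simp add: frobenius_mult m_comm)
  then show "\<exists>h\<in>carrier R. f [^] p = (g \<otimes> h) [^] p" using h(1) by blast
qed

text \<open>A splitting inverts the Frobenius from the left, and \<open>r \<mapsto> (\<theta> r)\<^sup>p\<close> is then a retraction of \<open>R\<close> onto \<open>A\<close>.\<close>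

definition splitting :: "('a \<Rightarrow> 'a) \<Rightarrow> bool"
  where "splitting \<theta> \<longleftrightarrow> \<theta> \<in> carrier R \<rightarrow> carrier R \<and>
    (\<forall>a\<in>carrier R. \<forall>b\<in>carrier R. \<theta> (a \<oplus> b) = \<theta> a \<oplus> \<theta> b) \<and>
    (\<forall>a\<in>carrier R. \<forall>b\<in>carrier R. \<theta> (a [^] p \<otimes> b) = a \<otimes> \<theta> b) \<and> \<theta> \<one> = \<one>"

lemma splitting_imp_F_split:
  assumes "splitting \<theta>"
  shows "F_split p R"
proof -
  have closed: "\<theta> a \<in> carrier R" if "a \<in> carrier R" for a using assms that unfolding splitting_def by blast
  have add: "\<theta> (a \<oplus> b) = \<theta> a \<oplus> \<theta> b" if "a \<in> carrier R" "b \<in> carrier R" for a b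
    using assms that unfolding splitting_def by blast
  have lin: "\<theta> (a [^] p \<otimes> b) = a \<otimes> \<theta> b" if "a \<in> carrier R" "b \<in> carrier R" for a b
    using assms that unfolding splitting_def by blast
  have pow: "\<theta> (a [^] p) = a" if "a \<in> carrier R" for a
    using lin[OF that one_closed] assms that unfolding splitting_def by simp
  have zero: "\<theta> \<zero> = \<zero>" using pow[OF zero_closed] by (simp add: frobenius_zero)
  have minus: "\<theta> (\<ominus> a) = \<ominus> \<theta> a" if "a \<in> carrier R" for a
  proof -
    have "\<theta> a \<oplus> \<theta> (\<ominus> a) = \<zero>" using add[of a "\<ominus> a"] that zero by (simp add: r_neg)
    then show ?thesis using closed that by (metis a_inv_closed add.inv_equality a_comm)
  qed
  define Q where "Q = {x \<in> carrier R. \<theta> x = \<zero>}"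
  have "submodule A RA (self_module R)"
    unfolding submodule_self_iff
  proof (intro conjI ballI)
    show "subgroup A (add_monoid R)" by (rule subring.axioms(1)[OF subring_frobenius_image])
    show "a \<otimes> x \<in> A" if "a \<in> A" "x \<in> A" for a x
      using subringE(6)[OF subring_frobenius_image] that by blast
  qed
  moreover have "submodule Q RA (self_module R)"
    unfolding submodule_self_iff
  proof (intro conjI ballI)
    show "subgroup Q (add_monoid R)"
    proof (rule subgroup.intro)
      show "inv\<^bsub>add_monoid R\<^esub> x \<in> Q" if "x \<in> Q" for x
        using that minus by (simp add: Q_def a_inv_def[symmetric])
    qed (auto simp: Q_def add zero)
    show "a \<otimes> x \<in> Q" if a: "a \<in> A" and x: "x \<in> Q" for a x
    proof -
      obtain b where b: "b \<in> carrier R" "a = b [^] p" using frobenius_imageE[OF a] .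
      then show ?thesis using x lin[of b x] by (simp add: Q_def)
    qed
  qed
  moreover have "A \<inter> Q = {\<zero>}"
  proof (intro equalityI subsetI)
    fix x assume x: "x \<in> A \<inter> Q"
    then obtain b where b: "b \<in> carrier R" "x = b [^] p" using frobenius_imageE by blast
    then have "b = \<zero>" using x pow[of b] by (simp add: Q_def)
    then show "x \<in> {\<zero>}" using b by (simp add: frobenius_zero)
  next
    fix x assume "x \<in> {\<zero>}"
    then show "x \<in> A \<inter> Q" using in_frobenius_image[of \<zero>] zero by (simp add: Q_def frobenius_zero)
  qed
  moreover have "A <+>\<^bsub>R\<^esub> Q = carrier R"
  proof (intro equalityI subsetI)
    fix x assume "x \<in> A <+>\<^bsub>R\<^esub> Q"
    then show "x \<in> carrier R" using frobenius_image_carrier by (auto simp: set_add_def set_mult_def Q_def)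
  next
    fix x assume x: "x \<in> carrier R"
    let ?a = "\<theta> x [^] p"
    have a: "?a \<in> carrier R" using x closed by simp
    have "\<theta> (x \<ominus> ?a) = \<zero>"
      using x a closed by (simp add: a_minus_def add minus pow r_neg)
    then have "x \<ominus> ?a \<in> Q" using x a by (simp add: Q_def)
    moreover have "x = ?a \<oplus> (x \<ominus> ?a)"
      using x a by (simp add: a_minus_def a_lcomm r_neg)
    moreover have "?a \<in> A" using x closed in_frobenius_image by simp
    ultimately show "x \<in> A <+>\<^bsub>R\<^esub> Q" unfolding set_add_def set_mult_def by auto
  qed
  ultimately show ?thesis
    unfolding F_split_def direct_summand_def
    by (intro conjI exI[of _ Q]) (simp_all add: self_module_def set_add_def set_mult_def)
qed

text \<open>The retraction \<open>\<rho>\<close> induces a map from the tensor product to \<open>N\<close> with \<open>x \<otimes> r \<mapsto> \<rho> r * x\<close>, which recovers \<open>x\<close>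
  from \<open>x \<otimes> 1\<close>.\<close>

lemma splitting_imp_F_pure:
  fixes u :: "'u itself"
  assumes "splitting \<theta>"
  shows "F_pure u p R"
  unfolding F_pure_def pure_subring_def
proof (intro conjI allI impI)
  show "subring A R" by (rule subring_frobenius_image)
  have closed: "\<theta> a \<in> carrier R" if "a \<in> carrier R" for a using assms that unfolding splitting_def by blast
  have add: "\<theta> (a \<oplus> b) = \<theta> a \<oplus> \<theta> b" if "a \<in> carrier R" "b \<in> carrier R" for a b
    using assms that unfolding splitting_def by blast
  have lin: "\<theta> (a [^] p \<otimes> b) = a \<otimes> \<theta> b" if "a \<in> carrier R" "b \<in> carrier R" for a b
    using assms that unfolding splitting_def by blast
  have one: "\<theta> \<one> = \<one>" using assms unfolding splitting_def by blast
  define \<rho> where "\<rho> r = \<theta> r [^] p" for r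
  have \<rho>A: "\<rho> r \<in> A" if "r \<in> carrier R" for r
    unfolding \<rho>_def using closed[OF that] by (rule in_frobenius_image)
  have \<rho>_add: "\<rho> (a \<oplus> b) = \<rho> a \<oplus> \<rho> b" if "a \<in> carrier R" "b \<in> carrier R" for a b
    using that closed by (simp add: \<rho>_def add frobenius_add)
  have \<rho>_lin: "\<rho> (a \<otimes> b) = a \<otimes> \<rho> b" if a: "a \<in> A" and b: "b \<in> carrier R" for a b
  proof -
    obtain c where "c \<in> carrier R" "a = c [^] p" using frobenius_imageE[OF a] .
    then show ?thesis using b closed lin by (simp add: \<rho>_def frobenius_mult)
  qed
  fix N :: "('a, 'u + (nat \<Rightarrow> 'a) set) module"
  assume mod: "Module.module RA N"
  interpret N: Module.module RA N by (rule mod)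
  let ?S = "carrier N \<times> carrier R"
  let ?G = "free_Abelian_group ?S"
  have cg: "comm_group (add_monoid N)" by (rule N.a_comm_group)
  have "(\<lambda>(x, r). \<rho> r \<odot>\<^bsub>N\<^esub> x) ` ?S \<subseteq> carrier (add_monoid N)"
    using \<rho>A N.smult_closed by auto
  from comm_group.free_Abelian_group_universal[OF cg this] obtain h where
    h: "h \<in> hom ?G (add_monoid N)" "\<And>s. s \<in> ?S \<Longrightarrow> h (frag_of s) = (case s of (x, r) \<Rightarrow> \<rho> r \<odot>\<^bsub>N\<^esub> x)"
    by blast
  interpret h: group_hom ?G "add_monoid N" h
    using h(1) by (intro group_hom.intro group_hom_axioms.intro) (simp_all add: N.a_group)
  have hfrag: "h (frag_of (x, r)) = \<rho> r \<odot>\<^bsub>N\<^esub> x" if "x \<in> carrier N" "r \<in> carrier R" for x r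
    using h(2)[of "(x, r)"] that by simp
  have frag: "frag_of (x, y) \<in> carrier ?G" if "x \<in> carrier N" "y \<in> carrier R" for x y
    using that by (simp del: carrier_free_Abelian_group_iff)
  have hadd: "h (x + y) = h x \<oplus>\<^bsub>N\<^esub> h y" if "x \<in> carrier ?G" "y \<in> carrier ?G" for x y
    using h.hom_mult[OF that] by simp
  have hclosed: "h x \<in> carrier N" if "x \<in> carrier ?G" for x
    using h.hom_closed[OF that] by simp
  have sm: "a \<odot>\<^bsub>N\<^esub> x \<in> carrier N" if "a \<in> A" "x \<in> carrier N" for a x
    using N.smult_closed that by simp
  have AR: "\<And>x. x \<in> A \<Longrightarrow> x \<in> carrier R" using frobenius_image_carrier by blast
  have kill: "h z = \<zero>\<^bsub>N\<^esub>" if "z \<in> carrier ?G" "y \<in> carrier ?G" "h (z + y) = h y" for y z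
    using hadd[OF that(1,2)] that(3) N.add.r_cancel_one[OF hclosed[OF that(2)] hclosed[OF that(1)]]
    by simp
  have carr: "tensor_relations RA N (self_module R) \<subseteq> carrier ?G"
    by (rule tensor_relations_carrier[OF mod])
  have rel: "h z = \<zero>\<^bsub>N\<^esub>" if z: "z \<in> tensor_relations RA N (self_module R)" for z
  proof -
    have zG: "z \<in> carrier ?G" using z carr by blast
    from z consider
        (1) x x' y where "z = frag_of (x \<oplus>\<^bsub>N\<^esub> x', y) - frag_of (x, y) - frag_of (x', y)"
          "x \<in> carrier N" "x' \<in> carrier N" "y \<in> carrier R"
      | (2) x y y' where "z = frag_of (x, y \<oplus> y') - frag_of (x, y) - frag_of (x, y')"
          "x \<in> carrier N" "y \<in> carrier R" "y' \<in> carrier R"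
      | (3) a x y where "z = frag_of (a \<odot>\<^bsub>N\<^esub> x, y) - frag_of (x, a \<otimes> y)"
          "a \<in> A" "x \<in> carrier N" "y \<in> carrier R"
      unfolding tensor_relations_def self_module_def by auto
    then show ?thesis
    proof cases
      case 1
      have f: "frag_of (x, y) \<in> carrier ?G" "frag_of (x', y) \<in> carrier ?G"
        by (rule frag[OF 1(2,4)], rule frag[OF 1(3,4)])
      have "h (frag_of (x, y) + frag_of (x', y)) = h (frag_of (x \<oplus>\<^bsub>N\<^esub> x', y))"
        using hadd[OF f] 1 \<rho>A[OF 1(4)] by (simp add: hfrag N.smult_r_distr)
      then show ?thesis
        using f h.G.m_closed[OF f] by (intro kill[OF zG, of "frag_of (x, y) + frag_of (x', y)"]) (simp_all add: 1(1))
    next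
      case 2
      have f: "frag_of (x, y) \<in> carrier ?G" "frag_of (x, y') \<in> carrier ?G"
        by (rule frag[OF 2(2,3)], rule frag[OF 2(2,4)])
      have "h (frag_of (x, y) + frag_of (x, y')) = h (frag_of (x, y \<oplus> y'))"
        using hadd[OF f] 2 \<rho>A[OF 2(3)] \<rho>A[OF 2(4)] N.smult_l_distr[of "\<rho> y" "\<rho> y'" x]
        by (simp add: hfrag \<rho>_add)
      then show ?thesis
        using f h.G.m_closed[OF f] by (intro kill[OF zG, of "frag_of (x, y) + frag_of (x, y')"]) (simp_all add: 2(1))
    next
      case 3
      have f: "frag_of (x, a \<otimes> y) \<in> carrier ?G"
        using 3 AR by (intro frag) simp_all
      have "h (frag_of (x, a \<otimes> y)) = h (frag_of (a \<odot>\<^bsub>N\<^esub> x, y))"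
      proof -
        have "(\<rho> y \<otimes> a) \<odot>\<^bsub>N\<^esub> x = \<rho> y \<odot>\<^bsub>N\<^esub> (a \<odot>\<^bsub>N\<^esub> x)"
          using N.smult_assoc1[of "\<rho> y" a x] 3 \<rho>A[OF 3(4)] by simp
        moreover have "a \<otimes> \<rho> y = \<rho> y \<otimes> a" using 3 AR \<rho>A[OF 3(4)] by (simp add: m_comm)
        ultimately show ?thesis using 3 AR sm[OF 3(2,3)] by (simp add: hfrag \<rho>_lin)
      qed
      then show ?thesis
        using f by (intro kill[OF zG, of "frag_of (x, a \<otimes> y)"]) (simp_all add: 3(1))
    qed
  qed
  let ?K = "generate ?G (tensor_relations RA N (self_module R))"
  have K: "?K \<subseteq> kernel ?G (add_monoid N) h"
  proof (rule h.G.generate_subgroup_incl[OF _ h.subgroup_kernel])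
    show "tensor_relations RA N (self_module R) \<subseteq> kernel ?G (add_monoid N) h"
    proof
      fix z assume z: "z \<in> tensor_relations RA N (self_module R)"
      then have "z \<in> carrier ?G" using carr by blast
      then show "z \<in> kernel ?G (add_monoid N) h" using rel[OF z] unfolding kernel_def by simp
    qed
  qed
  have KG: "subgroup ?K ?G" by (rule h.G.generate_is_subgroup[OF carr])
  show "inj_on (\<lambda>x. pure_tensor RA N (self_module R) x \<one>) (carrier N)"
  proof (rule inj_onI)
    fix x y assume x: "x \<in> carrier N" and y: "y \<in> carrier N"
      and eq: "pure_tensor RA N (self_module R) x \<one> = pure_tensor RA N (self_module R) y \<one>"
    have fx: "frag_of (x, \<one>) \<in> carrier ?G" and fy: "frag_of (y, \<one>) \<in> carrier ?G"
      using x y by (intro frag; simp)+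
    have "?K #>\<^bsub>?G\<^esub> frag_of (x, \<one>) = ?K #>\<^bsub>?G\<^esub> frag_of (y, \<one>)"
      using eq by (simp add: pure_tensor_def Let_def self_module_def)
    then have "frag_of (x, \<one>) \<in> ?K #>\<^bsub>?G\<^esub> frag_of (y, \<one>)"
      using h.G.rcos_self[OF fx KG] by simp
    then obtain k where k: "k \<in> ?K" "frag_of (x, \<one>) = k + frag_of (y, \<one>)"
      unfolding r_coset_def by auto
    have kG: "k \<in> carrier ?G" using k(1) subgroup.subset[OF KG] by blast
    have "h k = \<zero>\<^bsub>N\<^esub>" using k(1) K unfolding kernel_def by auto
    then have "h (frag_of (x, \<one>)) = h (frag_of (y, \<one>))"
      unfolding k(2) using hadd[OF kG fy] hclosed[OF fy] by simp
    then show "x = y" using x y one N.smult_one by (simp add: hfrag \<rho>_def)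
  qed
qed

end


section \<open>Localizations\<close>

context cring
begin

lemma fraction_rel_iff:
  "((a, m), (b, n)) \<in> fraction_rel R f \<longleftrightarrow> a \<in> carrier R \<and> b \<in> carrier R \<and>
    (\<exists>l::nat. f [^] l \<otimes> (f [^] n \<otimes> a) = f [^] l \<otimes> (f [^] m \<otimes> b))"
  by (simp add: fraction_rel_def)

text \<open>Two fractions are equal iff they have a common expansion by powers of the denominator. This form
  of the relation makes all well-definedness arguments reduce to \<open>fraction_step\<close>.\<close>

lemma fraction_rel_common:
  assumes f: "f \<in> carrier R" and rel: "((a, m), (b, n)) \<in> fraction_rel R f"
  obtains i j where "m + i = n + j" "f [^] i \<otimes> a = f [^] j \<otimes> b"
proof -
  obtain l :: nat where ab: "a \<in> carrier R" "b \<in> carrier R"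
      and l: "f [^] l \<otimes> (f [^] n \<otimes> a) = f [^] l \<otimes> (f [^] m \<otimes> b)"
    using rel unfolding fraction_rel_iff by blast
  have "f [^] (l + n) \<otimes> a = f [^] (l + m) \<otimes> b"
    using l ab f by (simp add: nat_pow_mult[symmetric] m_assoc)
  then show ?thesis using that[of "l + n" "l + m"] by simp
qed

lemma fraction_rel_expand:
  assumes f: "f \<in> carrier R" and ab: "a \<in> carrier R" "b \<in> carrier R"
    and ij: "m + i = n + j" "f [^] (i::nat) \<otimes> a = f [^] (j::nat) \<otimes> b"
  shows "((a, m), (b, n)) \<in> fraction_rel R f"
proof -
  have "f [^] i \<otimes> (f [^] n \<otimes> a) = f [^] n \<otimes> (f [^] i \<otimes> a)" using f ab by (simp add: m_lcomm)
  also have "\<dots> = f [^] (n + j) \<otimes> b" unfolding ij(2) using f ab by (simp add: nat_pow_mult[symmetric] m_assoc)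
  also have "\<dots> = f [^] i \<otimes> (f [^] m \<otimes> b)"
    unfolding ij(1)[symmetric] using f ab by (simp add: nat_pow_mult[symmetric] m_ac)
  finally show ?thesis unfolding fraction_rel_iff using ab by blast
qed

lemma equiv_fraction_rel:
  assumes f: "f \<in> carrier R"
  shows "equiv (carrier R \<times> UNIV) (fraction_rel R f)"
proof (rule equivI)
  show "fraction_rel R f \<subseteq> (carrier R \<times> UNIV) \<times> (carrier R \<times> UNIV)"
    by (auto simp: fraction_rel_def)
  show "refl_on (carrier R \<times> UNIV) (fraction_rel R f)"
    by (auto simp: refl_on_def fraction_rel_def)
  show "sym (fraction_rel R f)"
    unfolding sym_def fraction_rel_def by (auto, metis)
  show "trans (fraction_rel R f)"
  proof (rule transI)
    fix x y z assume xy: "(x, y) \<in> fraction_rel R f" and yz: "(y, z) \<in> fraction_rel R f"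
    obtain a m b n c k where eq: "x = (a, m)" "y = (b, n)" "z = (c, k)" by (metis surj_pair)
    have abc: "a \<in> carrier R" "b \<in> carrier R" "c \<in> carrier R"
      using xy yz unfolding eq fraction_rel_iff by blast+
    obtain i j where ij: "m + i = n + j" "f [^] i \<otimes> a = f [^] j \<otimes> b"
      using fraction_rel_common[OF f xy[unfolded eq]] .
    obtain i' j' where ij': "n + i' = k + j'" "f [^] i' \<otimes> b = f [^] j' \<otimes> c"
      using fraction_rel_common[OF f yz[unfolded eq]] .
    have "f [^] (i' + i) \<otimes> a = f [^] i' \<otimes> (f [^] j \<otimes> b)"
      using f abc by (simp add: nat_pow_mult[symmetric] m_assoc ij(2))
    also have "\<dots> = f [^] j \<otimes> (f [^] i' \<otimes> b)" using f abc by (simp add: m_lcomm)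
    also have "\<dots> = f [^] (j + j') \<otimes> c"
      unfolding ij'(2) using f abc by (simp add: nat_pow_mult[symmetric] m_assoc)
    finally show "(x, z) \<in> fraction_rel R f"
      unfolding eq using f abc ij(1) ij'(1) by (intro fraction_rel_expand[of f a c m "i' + i" k "j + j'"]) simp_all
  qed
qed

lemma fraction_eq_iff:
  assumes "f \<in> carrier R" "a \<in> carrier R" "b \<in> carrier R"
  shows "fraction R f a m = fraction R f b n \<longleftrightarrow>
    (\<exists>l::nat. f [^] l \<otimes> (f [^] n \<otimes> a) = f [^] l \<otimes> (f [^] m \<otimes> b))"
  unfolding fraction_def
  using eq_equiv_class_iff[OF equiv_fraction_rel[OF assms(1)], of "(a, m)" "(b, n)"] assms(2,3)
  by (simp add: fraction_rel_iff)

lemma fraction_expand: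
  assumes f: "f \<in> carrier R" and a: "a \<in> carrier R"
  shows "fraction R f (f [^] (i::nat) \<otimes> a) (m + i) = fraction R f a m"
proof -
  have "((f [^] i \<otimes> a, m + i), (a, m)) \<in> fraction_rel R f"
    using f a by (intro fraction_rel_expand[where i=0 and j=i]) simp_all
  then show ?thesis
    unfolding fraction_def by (rule equiv_class_eq[OF equiv_fraction_rel[OF f]])
qed

lemma fraction_step:
  assumes f: "f \<in> carrier R" and a: "a \<in> carrier R"
  shows "fraction R f (f \<otimes> a) (Suc m) = fraction R f a m"
  using fraction_expand[OF f a, of 1 m] f by simp

text \<open>The operations on localizations are unions over representatives. A function of numerator and
  exponent that is invariant under expansion by one factor \<open>f\<close> is constant on a fraction.\<close>

lemma fraction_lift:
  assumes f: "f \<in> carrier R" and a: "a \<in> carrier R"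
    and step: "\<And>b n. b \<in> carrier R \<Longrightarrow> G (f \<otimes> b) (Suc n) = G b n"
  shows "(\<Union>(b, n)\<in>fraction R f a m. G b n) = G a m"
proof -
  have expand: "G (f [^] i \<otimes> b) (n + i) = G b n" if "b \<in> carrier R" for b n and i :: nat
  proof (induction i)
    case (Suc i)
    have "f [^] Suc i \<otimes> b = f \<otimes> (f [^] i \<otimes> b)" using f that by (simp add: m_ac)
    then show ?case using Suc step[of "f [^] i \<otimes> b" "n + i"] f that by simp
  qed (use that in simp)
  have const: "G b n = G a m" if "(b, n) \<in> fraction R f a m" for b n
  proof -
    have rel: "((a, m), (b, n)) \<in> fraction_rel R f" using that unfolding fraction_def by simp
    then have b: "b \<in> carrier R" unfolding fraction_rel_iff by blast
    obtain i j where ij: "m + i = n + j" "f [^] i \<otimes> a = f [^] j \<otimes> b"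
      using fraction_rel_common[OF f rel] .
    have "G b n = G (f [^] j \<otimes> b) (n + j)" using expand[OF b] by simp
    also have "\<dots> = G a m" unfolding ij[symmetric] using expand[OF a] by simp
    finally show ?thesis .
  qed
  have "(a, m) \<in> fraction R f a m"
    unfolding fraction_def using a by (auto simp: fraction_rel_iff)
  with const show ?thesis by fast
qed

lemma carrier_localization:
  "carrier (localization R f) = {fraction R f a m | a m. a \<in> carrier R}"
  by (auto simp: localization_def quotient_def fraction_def)

lemma fraction_closed: "a \<in> carrier R \<Longrightarrow> fraction R f a m \<in> carrier (localization R f)"
  unfolding carrier_localization by blast

lemma localization_cases:
  assumes "x \<in> carrier (localization R f)"
  obtains a m where "a \<in> carrier R" "x = fraction R f a m"
  using assms unfolding carrier_localization by blast

text \<open>Bringing two fractions to a common exponent reduces the laws of addition to those of \<open>R\<close>.\<close>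

lemma localization_cases2:
  assumes f: "f \<in> carrier R"
    and x: "x \<in> carrier (localization R f)" and y: "y \<in> carrier (localization R f)"
  obtains a b m where "a \<in> carrier R" "b \<in> carrier R" "x = fraction R f a m" "y = fraction R f b m"
proof -
  obtain a m where a: "a \<in> carrier R" "x = fraction R f a m" using localization_cases[OF x] .
  obtain b n where b: "b \<in> carrier R" "y = fraction R f b n" using localization_cases[OF y] .
  have "x = fraction R f (f [^] n \<otimes> a) (m + n)" using a f fraction_expand by simp
  moreover have "y = fraction R f (f [^] m \<otimes> b) (m + n)"
    using b f fraction_expand[OF f b(1), of m n] by (simp add: add.commute)
  ultimately show ?thesis
    using that[of "f [^] n \<otimes> a" "f [^] m \<otimes> b" "m + n"] a(1) b(1) f by simp
qed

lemma localization_mult: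
  assumes f: "f \<in> carrier R" and a: "a \<in> carrier R" and b: "b \<in> carrier R"
  shows "fraction R f a m \<otimes>\<^bsub>localization R f\<^esub> fraction R f b n = fraction R f (a \<otimes> b) (m + n)"
proof -
  have inner: "(\<Union>(b, n)\<in>fraction R f b n. fraction R f (a \<otimes> b) (m + n)) = fraction R f (a \<otimes> b) (m + n)"
    if a: "a \<in> carrier R" for a m
  proof (rule fraction_lift[OF f b])
    fix b n assume "b \<in> carrier R"
    then show "fraction R f (a \<otimes> (f \<otimes> b)) (m + Suc n) = fraction R f (a \<otimes> b) (m + n)"
      using fraction_step[OF f, of "a \<otimes> b" "m + n"] a f by (simp add: m_lcomm)
  qed
  have "fraction R f a m \<otimes>\<^bsub>localization R f\<^esub> fraction R f b n
      = (\<Union>(a, m)\<in>fraction R f a m. \<Union>(b, n)\<in>fraction R f b n. fraction R f (a \<otimes> b) (m + n))"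
    by (simp add: localization_def)
  also have "\<dots> = (\<Union>(b, n)\<in>fraction R f b n. fraction R f (a \<otimes> b) (m + n))"
  proof (rule fraction_lift[OF f a])
    fix a m assume a: "a \<in> carrier R"
    have fa: "f \<otimes> a \<in> carrier R" using a f by simp
    show "(\<Union>(b, n)\<in>fraction R f b n. fraction R f (f \<otimes> a \<otimes> b) (Suc m + n))
        = (\<Union>(b, n)\<in>fraction R f b n. fraction R f (a \<otimes> b) (m + n))"
      unfolding inner[OF a] inner[OF fa]
      using fraction_step[OF f, of "a \<otimes> b" "m + n"] a b f by (simp add: m_assoc)
  qed
  also have "\<dots> = fraction R f (a \<otimes> b) (m + n)" by (rule inner[OF a])
  finally show ?thesis .
qed

lemma localization_add:
  assumes f: "f \<in> carrier R" and a: "a \<in> carrier R" and b: "b \<in> carrier R"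
  shows "fraction R f a m \<oplus>\<^bsub>localization R f\<^esub> fraction R f b n
    = fraction R f (f [^] n \<otimes> a \<oplus> f [^] m \<otimes> b) (m + n)"
proof -
  let ?g = "\<lambda>a m b n. fraction R f (f [^] n \<otimes> a \<oplus> f [^] m \<otimes> b) (m + n)"
  have inner: "(\<Union>(b, n)\<in>fraction R f b n. ?g a m b n) = ?g a m b n"
    if a: "a \<in> carrier R" for a m
  proof (rule fraction_lift[OF f b])
    fix b n assume b: "b \<in> carrier R"
    have "f [^] Suc n \<otimes> a \<oplus> f [^] m \<otimes> (f \<otimes> b) = f \<otimes> (f [^] n \<otimes> a \<oplus> f [^] m \<otimes> b)"
      using a b f by (simp add: r_distr m_ac)
    then show "?g a m (f \<otimes> b) (Suc n) = ?g a m b n"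
      using fraction_step[OF f, of "f [^] n \<otimes> a \<oplus> f [^] m \<otimes> b" "m + n"] a b f by simp
  qed
  have "fraction R f a m \<oplus>\<^bsub>localization R f\<^esub> fraction R f b n
      = (\<Union>(a, m)\<in>fraction R f a m. \<Union>(b, n)\<in>fraction R f b n. ?g a m b n)"
    by (simp add: localization_def)
  also have "\<dots> = (\<Union>(b, n)\<in>fraction R f b n. ?g a m b n)"
  proof (rule fraction_lift[OF f a])
    fix a m assume a: "a \<in> carrier R"
    have fa: "f \<otimes> a \<in> carrier R" using a f by simp
    have "f [^] n \<otimes> (f \<otimes> a) \<oplus> f [^] Suc m \<otimes> b = f \<otimes> (f [^] n \<otimes> a \<oplus> f [^] m \<otimes> b)"
      using a b f by (simp add: r_distr m_ac)
    then show "(\<Union>(b, n)\<in>fraction R f b n. ?g (f \<otimes> a) (Suc m) b n) = (\<Union>(b, n)\<in>fraction R f b n. ?g a m b n)"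
      unfolding inner[OF a] inner[OF fa]
      using fraction_step[OF f, of "f [^] n \<otimes> a \<oplus> f [^] m \<otimes> b" "m + n"] a b f by simp
  qed
  also have "\<dots> = ?g a m b n" by (rule inner[OF a])
  finally show ?thesis .
qed

lemma localization_add_common:
  assumes f: "f \<in> carrier R" and a: "a \<in> carrier R" and b: "b \<in> carrier R"
  shows "fraction R f a m \<oplus>\<^bsub>localization R f\<^esub> fraction R f b m = fraction R f (a \<oplus> b) m"
proof -
  have "fraction R f a m \<oplus>\<^bsub>localization R f\<^esub> fraction R f b m = fraction R f (f [^] m \<otimes> (a \<oplus> b)) (m + m)"
    using localization_add[OF assms] a b f by (simp add: r_distr)
  also have "\<dots> = fraction R f (a \<oplus> b) m" using a b by (intro fraction_expand[OF f]) simp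
  finally show ?thesis .
qed

lemma localization_zero: "f \<in> carrier R \<Longrightarrow> \<zero>\<^bsub>localization R f\<^esub> = fraction R f \<zero> m"
  using fraction_expand[of f \<zero> m 0] by (simp add: localization_def)

lemma abelian_group_localization:
  assumes f: "f \<in> carrier R"
  shows "abelian_group (localization R f)"
proof (rule abelian_groupI)
  let ?L = "localization R f"
  show "\<zero>\<^bsub>?L\<^esub> \<in> carrier ?L" unfolding localization_zero[OF f, of 0] by (intro fraction_closed) simp
  fix x y z assume x: "x \<in> carrier ?L"
  obtain a m where a: "a \<in> carrier R" "x = fraction R f a m" using localization_cases[OF x] .
  show "\<zero>\<^bsub>?L\<^esub> \<oplus>\<^bsub>?L\<^esub> x = x"
    unfolding a(2) localization_zero[OF f, of m] using localization_add_common[OF f zero_closed a(1)] a by simp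
  show "\<exists>y\<in>carrier ?L. y \<oplus>\<^bsub>?L\<^esub> x = \<zero>\<^bsub>?L\<^esub>"
    unfolding a(2) localization_zero[OF f, of m]
    using localization_add_common[OF f a_inv_closed[OF a(1)] a(1), of m] a
    by (intro bexI[of _ "fraction R f (\<ominus> a) m"]) (simp_all add: l_neg fraction_closed)
  assume y: "y \<in> carrier ?L"
  obtain a b m where ab: "a \<in> carrier R" "b \<in> carrier R" "x = fraction R f a m" "y = fraction R f b m"
    using localization_cases2[OF f x y] .
  show "x \<oplus>\<^bsub>?L\<^esub> y \<in> carrier ?L"
    unfolding ab(3,4) localization_add_common[OF f ab(1,2)] using ab(1,2) by (intro fraction_closed) simp
  show "x \<oplus>\<^bsub>?L\<^esub> y = y \<oplus>\<^bsub>?L\<^esub> x"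
    unfolding ab(3,4) localization_add_common[OF f ab(1,2)] localization_add_common[OF f ab(2,1)]
    using ab(1,2) by (simp add: a_comm)
  assume z: "z \<in> carrier ?L"
  obtain c n where c: "c \<in> carrier R" "z = fraction R f c n" using localization_cases[OF z] .
  define a' b' c' where "a' = f [^] n \<otimes> a" and "b' = f [^] n \<otimes> b" and "c' = f [^] m \<otimes> c"
  have cl: "a' \<in> carrier R" "b' \<in> carrier R" "c' \<in> carrier R"
    using ab c f by (simp_all add: a'_def b'_def c'_def)
  have eq: "x = fraction R f a' (m + n)" "y = fraction R f b' (m + n)" "z = fraction R f c' (m + n)"
    using fraction_expand[OF f ab(1), of n m] fraction_expand[OF f ab(2), of n m]
      fraction_expand[OF f c(1), of m n]
    unfolding ab(3,4) c(2) a'_def b'_def c'_def by (simp_all only: add.commute[of n m])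
  show "x \<oplus>\<^bsub>?L\<^esub> y \<oplus>\<^bsub>?L\<^esub> z = x \<oplus>\<^bsub>?L\<^esub> (y \<oplus>\<^bsub>?L\<^esub> z)"
    unfolding eq using cl by (simp add: localization_add_common[OF f] a_assoc)
qed

lemma comm_group_localization: "f \<in> carrier R \<Longrightarrow> comm_group (add_monoid (localization R f))"
  by (rule abelian_group.a_comm_group[OF abelian_group_localization])

lemma localization_power:
  assumes f: "f \<in> carrier R" and a: "a \<in> carrier R"
  shows "fraction R f a m [^]\<^bsub>localization R f\<^esub> (n::nat) = fraction R f (a [^] n) (m * n)"
proof (induction n)
  case 0
  show ?case by (simp add: nat_pow_def) (simp add: localization_def)
next
  case (Suc n)
  have "fraction R f a m [^]\<^bsub>localization R f\<^esub> Suc n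
      = fraction R f a m [^]\<^bsub>localization R f\<^esub> n \<otimes>\<^bsub>localization R f\<^esub> fraction R f a m"
    by (simp add: nat_pow_def)
  then show ?case using Suc localization_mult[OF f, of "a [^] n" a "m * n" m] a by (simp add: add.commute)
qed

lemma localization_homI:
  assumes f: "f \<in> carrier R" and g: "g \<in> carrier R"
    and closed: "\<And>a m. a \<in> carrier R \<Longrightarrow> T (fraction R f a m) \<in> carrier (localization R g)"
    and add: "\<And>a b m. a \<in> carrier R \<Longrightarrow> b \<in> carrier R \<Longrightarrow>
      T (fraction R f (a \<oplus> b) m) = T (fraction R f a m) \<oplus>\<^bsub>localization R g\<^esub> T (fraction R f b m)"
  shows "T \<in> hom (add_monoid (localization R f)) (add_monoid (localization R g))"
proof (rule homI)
  fix x assume "x \<in> carrier (add_monoid (localization R f))"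
  then have x: "x \<in> carrier (localization R f)" by simp
  show "T x \<in> carrier (add_monoid (localization R g))" using localization_cases[OF x] closed by fastforce
  fix y assume "y \<in> carrier (add_monoid (localization R f))"
  then have y: "y \<in> carrier (localization R f)" by simp
  obtain a b m where "a \<in> carrier R" "b \<in> carrier R" "x = fraction R f a m" "y = fraction R f b m"
    using localization_cases2[OF f x y] .
  then show "T (x \<otimes>\<^bsub>add_monoid (localization R f)\<^esub> y) = T x \<otimes>\<^bsub>add_monoid (localization R g)\<^esub> T y"
    using add localization_add_common[OF f] by simp
qed

lemma localization_map_fraction:
  assumes f: "f \<in> carrier R" and g: "g \<in> carrier R" and a: "a \<in> carrier R"
  shows "localization_map R f g (fraction R f a m) = fraction R (f \<otimes> g) (a \<otimes> g [^] m) m"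
  unfolding localization_map_def
proof (rule fraction_lift[OF f a])
  fix b n assume b: "b \<in> carrier R"
  have "f \<otimes> b \<otimes> g [^] Suc n = (f \<otimes> g) \<otimes> (b \<otimes> g [^] n)"
    using b f g by (simp add: m_ac)
  then show "fraction R (f \<otimes> g) (f \<otimes> b \<otimes> g [^] Suc n) (Suc n) = fraction R (f \<otimes> g) (b \<otimes> g [^] n) n"
    using fraction_step[of "f \<otimes> g" "b \<otimes> g [^] n" n] b f g by simp
qed

lemma localization_map_hom:
  assumes f: "f \<in> carrier R" and g: "g \<in> carrier R"
  shows "localization_map R f g \<in> hom (add_monoid (localization R f)) (add_monoid (localization R (f \<otimes> g)))"
  using assms
  by (intro localization_homI)
    (simp_all add: localization_map_fraction fraction_closed localization_add_common l_distr)

end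

section \<open>Cech complexes\<close>

text \<open>The alternating sum of coface maps for an arbitrary system of abelian groups. The Cech complex and
  its homogeneous parts, with coefficients in a field, are both of this kind, so that
  all maps between them are covered by \<open>system_differential_natural\<close>.\<close>

definition system_differential ::
    "(nat set \<Rightarrow> ('a, 'm) monoid_scheme) \<Rightarrow> (nat set \<Rightarrow> nat \<Rightarrow> 'a \<Rightarrow> 'a) \<Rightarrow> (nat set \<Rightarrow> 'a) \<Rightarrow> nat set \<Rightarrow> 'a"
  where "system_differential G r c J =
    finprod (G J) (\<lambda>j. r J j (c (J - {j})) [^]\<^bsub>G J\<^esub> ((-1) ^ card {l \<in> J. l < j} :: int)) J"

lemma hom_finprod_comm_group:
  assumes "comm_group G" "comm_group H" "h \<in> hom G H" "f \<in> A \<rightarrow> carrier G"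
  shows "h (finprod G f A) = finprod H (\<lambda>x. h (f x)) A"
proof -
  interpret G: comm_group G by fact
  interpret H: comm_group H by fact
  interpret h: group_hom G H h
    using assms(3) by (intro group_hom.intro group_hom_axioms.intro) unfold_locales
  show ?thesis using assms(4)
  proof (induction A rule: infinite_finite_induct)
    case (insert x A)
    have "f \<in> A \<rightarrow> carrier G" "f x \<in> carrier G" using insert.prems by auto
    moreover from this have "(\<lambda>x. h (f x)) \<in> A \<rightarrow> carrier H" by (intro Pi_I h.hom_closed) auto
    ultimately show ?case using insert.hyps insert.IH by simp
  qed simp_all
qed

lemma system_differential_natural:
  assumes G: "comm_group (G J)" and G': "comm_group (G' J)"
    and T: "T J \<in> hom (G J) (G' J)"
    and r: "\<And>j. j \<in> J \<Longrightarrow> r J j (c (J - {j})) \<in> carrier (G J)"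
    and nat: "\<And>j. j \<in> J \<Longrightarrow> T J (r J j (c (J - {j}))) = r' J j (c' (J - {j}))"
  shows "T J (system_differential G r c J) = system_differential G' r' c' J"
proof -
  interpret G: comm_group "G J" by fact
  interpret G': comm_group "G' J" by fact
  interpret T: group_hom "G J" "G' J" "T J"
    using T by (intro group_hom.intro group_hom_axioms.intro) unfold_locales
  have "T J (system_differential G r c J)
      = finprod (G' J) (\<lambda>j. T J (r J j (c (J - {j})) [^]\<^bsub>G J\<^esub> ((-1) ^ card {l \<in> J. l < j} :: int))) J"
    unfolding system_differential_def
    using r by (intro hom_finprod_comm_group[OF G G' T]) auto
  also have "\<dots> = system_differential G' r' c' J"
    unfolding system_differential_def
  proof (rule G'.finprod_cong'[OF refl])
    show "(\<lambda>j. r' J j (c' (J - {j})) [^]\<^bsub>G' J\<^esub> ((-1) ^ card {l \<in> J. l < j} :: int)) \<in> J \<rightarrow> carrier (G' J)"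
    proof
      fix j assume j: "j \<in> J"
      then have "r' J j (c' (J - {j})) \<in> carrier (G' J)"
        using T.hom_closed[OF r[OF j]] nat[OF j] by simp
      then show "r' J j (c' (J - {j})) [^]\<^bsub>G' J\<^esub> ((-1) ^ card {l \<in> J. l < j} :: int) \<in> carrier (G' J)"
        by (rule G'.int_pow_closed)
    qed
    fix j assume j: "j \<in> J"
    show "T J (r J j (c (J - {j})) [^]\<^bsub>G J\<^esub> ((-1) ^ card {l \<in> J. l < j} :: int))
        = r' J j (c' (J - {j})) [^]\<^bsub>G' J\<^esub> ((-1) ^ card {l \<in> J. l < j} :: int)"
      using T.hom_int_pow[OF r[OF j]] nat[OF j] by simp
  qed
  finally show ?thesis .
qed

lemma system_differential_mult:
  assumes G: "comm_group (G J)" and r: "\<And>j. j \<in> J \<Longrightarrow> r J j \<in> hom (G (J - {j})) (G J)"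
    and c: "\<And>j. j \<in> J \<Longrightarrow> c (J - {j}) \<in> carrier (G (J - {j}))"
    and c': "\<And>j. j \<in> J \<Longrightarrow> c' (J - {j}) \<in> carrier (G (J - {j}))"
    and e: "\<And>j. j \<in> J \<Longrightarrow> e (J - {j}) = c (J - {j}) \<otimes>\<^bsub>G (J - {j})\<^esub> c' (J - {j})"
  shows "system_differential G r e J
    = system_differential G r c J \<otimes>\<^bsub>G J\<^esub> system_differential G r c' J"
proof -
  interpret G: comm_group "G J" by fact
  let ?s = "\<lambda>j. (-1) ^ card {l \<in> J. l < j} :: int"
  have rc: "r J j (c (J - {j})) \<in> carrier (G J)" "r J j (c' (J - {j})) \<in> carrier (G J)" if "j \<in> J" for j
    using hom_in_carrier[OF r[OF that]] c[OF that] c'[OF that] by blast+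
  have "system_differential G r e J = finprod (G J)
      (\<lambda>j. r J j (c (J - {j})) [^]\<^bsub>G J\<^esub> ?s j \<otimes>\<^bsub>G J\<^esub> r J j (c' (J - {j})) [^]\<^bsub>G J\<^esub> ?s j) J"
    unfolding system_differential_def
  proof (rule G.finprod_cong'[OF refl])
    show "(\<lambda>j. r J j (c (J - {j})) [^]\<^bsub>G J\<^esub> ?s j \<otimes>\<^bsub>G J\<^esub> r J j (c' (J - {j})) [^]\<^bsub>G J\<^esub> ?s j) \<in> J \<rightarrow> carrier (G J)"
      using rc by auto
    fix j assume j: "j \<in> J"
    have "r J j (e (J - {j})) = r J j (c (J - {j})) \<otimes>\<^bsub>G J\<^esub> r J j (c' (J - {j}))"
      unfolding e[OF j] by (rule hom_mult[OF r[OF j] c[OF j] c'[OF j]])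
    then show "r J j (e (J - {j})) [^]\<^bsub>G J\<^esub> ?s j
        = r J j (c (J - {j})) [^]\<^bsub>G J\<^esub> ?s j \<otimes>\<^bsub>G J\<^esub> r J j (c' (J - {j})) [^]\<^bsub>G J\<^esub> ?s j"
      using rc[OF j] G.int_pow_distrib by simp
  qed
  also have "\<dots> = system_differential G r c J \<otimes>\<^bsub>G J\<^esub> system_differential G r c' J"
    unfolding system_differential_def using rc by (intro G.finprod_multf) auto
  finally show ?thesis .
qed

locale cech_complex = frobenius_ring R p for R (structure) and p +
  fixes xs :: "'a list"
  assumes elements: "set xs \<subseteq> carrier R"
begin

abbreviation "denom I \<equiv> list_subprod R xs I"

abbreviation "loc I \<equiv> localization R (denom I)"

abbreviation "coface J j \<equiv> localization_map R (denom (J - {j})) (xs ! j)"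

abbreviation "positions \<equiv> {..<length xs}"

abbreviation "cochains i \<equiv> cech_group R xs i"

lemma nth_closed: "j < length xs \<Longrightarrow> xs ! j \<in> carrier R"
  using elements nth_mem by blast

lemma denom_closed: "I \<subseteq> positions \<Longrightarrow> denom I \<in> carrier R"
  unfolding list_subprod_def using nth_closed by (intro finprod_closed) auto

lemma denom_remove:
  assumes "J \<subseteq> positions" "j \<in> J"
  shows "denom (J - {j}) \<otimes> xs ! j = denom J"
proof -
  have fin: "finite J" using assms(1) finite_subset by blast
  have "denom J = denom (insert j (J - {j}))" using assms(2) by (simp add: insert_absorb)
  also have "\<dots> = xs ! j \<otimes> denom (J - {j})"
    unfolding list_subprod_def using assms fin nth_closed by (intro finprod_insert) auto
  also have "\<dots> = denom (J - {j}) \<otimes> xs ! j"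
    using assms nth_closed denom_closed[of "J - {j}"] by (intro m_comm) auto
  finally show ?thesis by simp
qed

lemma comm_group_loc: "I \<subseteq> positions \<Longrightarrow> comm_group (add_monoid (loc I))"
  by (rule comm_group_localization[OF denom_closed])

lemma coface_hom:
  assumes "J \<subseteq> positions" "j \<in> J"
  shows "coface J j \<in> hom (add_monoid (loc (J - {j}))) (add_monoid (loc J))"
  using localization_map_hom[of "denom (J - {j})" "xs ! j"] denom_closed[of "J - {j}"] nth_closed assms
  by (auto simp: denom_remove)

lemma coface_fraction:
  assumes "J \<subseteq> positions" "j \<in> J" "a \<in> carrier R"
  shows "coface J j (fraction R (denom (J - {j})) a m) = fraction R (denom J) (a \<otimes> (xs ! j) [^] m) m"
  using localization_map_fraction[of "denom (J - {j})" "xs ! j" a m]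
    denom_closed[of "J - {j}"] nth_closed assms denom_remove by auto

lemma position_sets_subset: "I \<in> position_sets xs i \<Longrightarrow> I \<subseteq> positions"
  by (simp add: position_sets_def)

lemma position_sets_remove: "J \<in> position_sets xs (Suc i) \<Longrightarrow> j \<in> J \<Longrightarrow> J - {j} \<in> position_sets xs i"
  unfolding position_sets_def using finite_subset[of J positions] by (auto simp: card_Diff_singleton)

lemma group_cochains: "group (cochains i)"
  unfolding cech_group_def
  using comm_group_loc[OF position_sets_subset] by (intro product_group) (simp add: comm_group_def)

lemma cochain_iff: "c \<in> carrier (cochains i) \<longleftrightarrow>
    c \<in> extensional (position_sets xs i) \<and> (\<forall>I\<in>position_sets xs i. c I \<in> carrier (loc I))"
  by (auto simp: cech_group_def PiE_def Pi_def)

lemma cochain_closed: "c \<in> carrier (cochains i) \<Longrightarrow> I \<in> position_sets xs i \<Longrightarrow> c I \<in> carrier (loc I)"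
  by (simp add: cochain_iff)

lemma differential_eq: "cech_differential R xs i c =
    (\<lambda>J\<in>position_sets xs (Suc i). system_differential (\<lambda>J. add_monoid (loc J)) coface c J)"
  unfolding cech_differential_def system_differential_def finsum_def add_pow_def ..

lemma coface_closed:
  assumes "J \<subseteq> positions" "j \<in> J" "x \<in> carrier (loc (J - {j}))"
  shows "coface J j x \<in> carrier (loc J)"
  using hom_in_carrier[OF coface_hom[OF assms(1,2)], of x] assms(3) by simp

lemma system_differential_closed:
  assumes "J \<subseteq> positions" "\<And>j. j \<in> J \<Longrightarrow> c (J - {j}) \<in> carrier (loc (J - {j}))"
  shows "system_differential (\<lambda>J. add_monoid (loc J)) coface c J \<in> carrier (loc J)"
proof -
  interpret G: comm_group "add_monoid (loc J)" by (rule comm_group_loc[OF assms(1)])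
  have "system_differential (\<lambda>J. add_monoid (loc J)) coface c J \<in> carrier (add_monoid (loc J))"
    unfolding system_differential_def
  proof (rule G.finprod_closed, rule Pi_I)
    fix j assume j: "j \<in> J"
    have "coface J j (c (J - {j})) \<in> carrier (add_monoid (loc J))"
      using coface_closed[OF assms(1) j assms(2)[OF j]] by simp
    then show "coface J j (c (J - {j})) [^]\<^bsub>add_monoid (loc J)\<^esub> ((-1) ^ card {l \<in> J. l < j} :: int)
        \<in> carrier (add_monoid (loc J))"
      by (rule G.int_pow_closed)
  qed
  then show ?thesis by simp
qed

lemma differential_closed:
  assumes "c \<in> carrier (cochains i)"
  shows "cech_differential R xs i c \<in> carrier (cochains (Suc i))"
  unfolding cochain_iff differential_eq
proof (intro conjI ballI)
  fix J assume J: "J \<in> position_sets xs (Suc i)"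
  have "system_differential (\<lambda>J. add_monoid (loc J)) coface c J \<in> carrier (loc J)"
    using position_sets_subset[OF J] cochain_closed[OF assms position_sets_remove[OF J]]
    by (rule system_differential_closed)
  then show "(\<lambda>J\<in>position_sets xs (Suc i). system_differential (\<lambda>J. add_monoid (loc J)) coface c J) J
      \<in> carrier (loc J)" using J by simp
qed simp

lemma differential_hom: "cech_differential R xs i \<in> hom (cochains i) (cochains (Suc i))"
proof (rule homI)
  show "cech_differential R xs i c \<in> carrier (cochains (Suc i))" if "c \<in> carrier (cochains i)" for c
    by (rule differential_closed[OF that])
  fix c c' assume c: "c \<in> carrier (cochains i)" and c': "c' \<in> carrier (cochains i)"
  have "system_differential (\<lambda>J. add_monoid (loc J)) coface (c \<otimes>\<^bsub>cochains i\<^esub> c') J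
      = system_differential (\<lambda>J. add_monoid (loc J)) coface c J
        \<otimes>\<^bsub>add_monoid (loc J)\<^esub> system_differential (\<lambda>J. add_monoid (loc J)) coface c' J"
    if J: "J \<in> position_sets xs (Suc i)" for J
  proof (rule system_differential_mult[where G = "\<lambda>J. add_monoid (loc J)" and r = coface])
    show "comm_group (add_monoid (loc J))" by (rule comm_group_loc[OF position_sets_subset[OF J]])
    fix j assume j: "j \<in> J"
    show "coface J j \<in> hom (add_monoid (loc (J - {j}))) (add_monoid (loc J))"
      by (rule coface_hom[OF position_sets_subset[OF J] j])
    show "c (J - {j}) \<in> carrier (add_monoid (loc (J - {j})))" "c' (J - {j}) \<in> carrier (add_monoid (loc (J - {j})))"
      using cochain_closed[OF c] cochain_closed[OF c'] position_sets_remove[OF J j] by simp_all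
    show "(c \<otimes>\<^bsub>cochains i\<^esub> c') (J - {j})
        = c (J - {j}) \<otimes>\<^bsub>add_monoid (loc (J - {j}))\<^esub> c' (J - {j})"
      using position_sets_remove[OF J j] by (simp add: cech_group_def)
  qed
  then show "cech_differential R xs i (c \<otimes>\<^bsub>cochains i\<^esub> c')
      = cech_differential R xs i c \<otimes>\<^bsub>cochains (Suc i)\<^esub> cech_differential R xs i c'"
    unfolding differential_eq by (simp add: cech_group_def restrict_def fun_eq_iff)
qed

lemma coboundaries_subgroup: "subgroup (cech_coboundaries R xs i) (cochains i)"
proof (cases i)
  case 0
  show ?thesis
    unfolding 0 cech_coboundaries_def using group.triv_subgroup[OF group_cochains] by simp
next
  case (Suc j)
  interpret d: group_hom "cochains j" "cochains (Suc j)" "cech_differential R xs j"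
    using differential_hom group_cochains by (intro group_hom.intro group_hom_axioms.intro)
  show ?thesis
    unfolding Suc cech_coboundaries_def using d.img_is_subgroup by simp
qed

lemma cocycle_iff: "c \<in> cech_cocycles R xs i \<longleftrightarrow> c \<in> carrier (cochains i) \<and>
    (\<forall>J\<in>position_sets xs (Suc i). cech_differential R xs i c J = \<zero>\<^bsub>loc J\<^esub>)"
proof -
  have "cech_differential R xs i c = \<one>\<^bsub>cochains (Suc i)\<^esub> \<longleftrightarrow>
      (\<forall>J\<in>position_sets xs (Suc i). cech_differential R xs i c J = \<zero>\<^bsub>loc J\<^esub>)"
    unfolding differential_eq by (simp add: cech_group_def restrict_def fun_eq_iff) blast
  then show ?thesis by (simp add: cech_cocycles_def kernel_def)
qed

definition natural_endo :: "(nat set \<Rightarrow> ('a \<times> nat) set \<Rightarrow> ('a \<times> nat) set) \<Rightarrow> bool"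
  where "natural_endo T \<longleftrightarrow>
    (\<forall>I. I \<subseteq> positions \<longrightarrow> T I \<in> hom (add_monoid (loc I)) (add_monoid (loc I))) \<and>
    (\<forall>J j x. J \<subseteq> positions \<longrightarrow> j \<in> J \<longrightarrow> x \<in> carrier (loc (J - {j})) \<longrightarrow>
      T J (coface J j x) = coface J j (T (J - {j}) x))"

definition apply_endo where "apply_endo T i c = (\<lambda>I\<in>position_sets xs i. T I (c I))"

lemma apply_endo_hom:
  assumes "natural_endo T"
  shows "apply_endo T i \<in> hom (cochains i) (cochains i)"
proof (rule homI)
  have hom: "T I \<in> hom (add_monoid (loc I)) (add_monoid (loc I))" if "I \<in> position_sets xs i" for I
    using assms position_sets_subset[OF that] unfolding natural_endo_def by blast
  fix c assume c: "c \<in> carrier (cochains i)"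
  show "apply_endo T i c \<in> carrier (cochains i)"
    unfolding cochain_iff apply_endo_def using hom_in_carrier[OF hom] cochain_closed[OF c] by simp
  fix c' assume c': "c' \<in> carrier (cochains i)"
  have "T I (c I \<oplus>\<^bsub>loc I\<^esub> c' I) = T I (c I) \<oplus>\<^bsub>loc I\<^esub> T I (c' I)" if "I \<in> position_sets xs i" for I
    using hom_mult[OF hom[OF that]] cochain_closed[OF c that] cochain_closed[OF c' that] by simp
  then show "apply_endo T i (c \<otimes>\<^bsub>cochains i\<^esub> c') = apply_endo T i c \<otimes>\<^bsub>cochains i\<^esub> apply_endo T i c'"
    by (simp add: apply_endo_def cech_group_def restrict_def fun_eq_iff)
qed

lemma apply_endo_differential:
  assumes T: "natural_endo T" and c: "c \<in> carrier (cochains i)"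
  shows "apply_endo T (Suc i) (cech_differential R xs i c) = cech_differential R xs i (apply_endo T i c)"
proof -
  let ?d = "system_differential (\<lambda>J. add_monoid (loc J)) coface"
  have "T J (?d c J) = ?d (apply_endo T i c) J" if J: "J \<in> position_sets xs (Suc i)" for J
  proof -
    note sub = position_sets_subset[OF J]
    show ?thesis
    proof (rule system_differential_natural)
      show "comm_group (add_monoid (loc J))" by (rule comm_group_loc[OF sub])
      show "comm_group (add_monoid (loc J))" by (rule comm_group_loc[OF sub])
      show "T J \<in> hom (add_monoid (loc J)) (add_monoid (loc J))"
        using T sub unfolding natural_endo_def by blast
      fix j assume j: "j \<in> J"
      have cj: "c (J - {j}) \<in> carrier (loc (J - {j}))" by (rule cochain_closed[OF c position_sets_remove[OF J j]])
      show "coface J j (c (J - {j})) \<in> carrier (add_monoid (loc J))"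
        using coface_closed[OF sub j cj] by simp
      have "T J (coface J j (c (J - {j}))) = coface J j (T (J - {j}) (c (J - {j})))"
        using T sub j cj unfolding natural_endo_def by blast
      then show "T J (coface J j (c (J - {j}))) = coface J j (apply_endo T i c (J - {j}))"
        using position_sets_remove[OF J j] by (simp add: apply_endo_def)
    qed
  qed
  then show ?thesis unfolding differential_eq by (simp add: apply_endo_def restrict_def fun_eq_iff)
qed

lemma apply_endo_coboundaries:
  assumes T: "natural_endo T" and b: "b \<in> cech_coboundaries R xs i"
  shows "apply_endo T i b \<in> cech_coboundaries R xs i"
proof (cases i)
  case 0
  then have "b = \<one>\<^bsub>cochains i\<^esub>" using b by (simp add: cech_coboundaries_def)
  then have "apply_endo T i b = \<one>\<^bsub>cochains i\<^esub>"
    using hom_one[OF apply_endo_hom[OF T] group_cochains group_cochains] by simp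
  then show ?thesis using 0 by (simp add: cech_coboundaries_def)
next
  case (Suc j)
  then obtain c where c: "c \<in> carrier (cochains j)" "b = cech_differential R xs j c"
    using b by (auto simp: cech_coboundaries_def)
  have "apply_endo T i b = cech_differential R xs j (apply_endo T j c)"
    unfolding c(2) Suc by (rule apply_endo_differential[OF T c(1)])
  moreover have "apply_endo T j c \<in> carrier (cochains j)"
    by (rule hom_in_carrier[OF apply_endo_hom[OF T] c(1)])
  ultimately show ?thesis unfolding Suc by (simp add: cech_coboundaries_def)
qed

definition frob :: "nat set \<Rightarrow> ('a \<times> nat) set \<Rightarrow> ('a \<times> nat) set"
  where "frob I x = x [^]\<^bsub>loc I\<^esub> p"

lemma frob_fraction:
  "I \<subseteq> positions \<Longrightarrow> a \<in> carrier R \<Longrightarrow>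
    frob I (fraction R (denom I) a m) = fraction R (denom I) (a [^] p) (m * p)"
  unfolding frob_def by (rule localization_power[OF denom_closed])

lemma natural_frob: "natural_endo frob"
  unfolding natural_endo_def
proof (intro conjI allI impI)
  fix I assume I: "I \<subseteq> positions"
  show "frob I \<in> hom (add_monoid (loc I)) (add_monoid (loc I))"
    by (intro localization_homI denom_closed[OF I])
      (simp_all add: frob_fraction[OF I] fraction_closed frobenius_add localization_add_common[OF denom_closed[OF I]])
next
  fix J j x assume J: "J \<subseteq> positions" and j: "j \<in> J" and x: "x \<in> carrier (loc (J - {j}))"
  have J': "J - {j} \<subseteq> positions" using J by blast
  have xj: "xs ! j \<in> carrier R" using J j nth_closed by auto
  obtain a m where a: "a \<in> carrier R" "x = fraction R (denom (J - {j})) a m" using localization_cases[OF x] .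
  show "frob J (coface J j x) = coface J j (frob (J - {j}) x)"
    unfolding a(2) using a(1) xj
    by (simp add: coface_fraction[OF J j] frob_fraction[OF J] frob_fraction[OF J'] frobenius_mult nat_pow_pow)
qed

lemma cech_frobenius_eq: "cech_frobenius R p xs i = apply_endo frob i"
  by (simp add: cech_frobenius_def apply_endo_def frob_def fun_eq_iff)

text \<open>The induced map on cohomology can be computed on any representative of a coset because the
  Frobenius is additive and preserves coboundaries.\<close>

lemma frobenius_coset:
  assumes c: "c \<in> carrier (cochains i)"
  shows "local_cohomology_frobenius R p xs i (cech_coboundaries R xs i #>\<^bsub>cochains i\<^esub> c)
    = cech_coboundaries R xs i #>\<^bsub>cochains i\<^esub> cech_frobenius R p xs i c"
proof -
  interpret G: group "cochains i" by (rule group_cochains)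
  let ?B = "cech_coboundaries R xs i" and ?F = "cech_frobenius R p xs i"
  note B = coboundaries_subgroup[of i]
  have F: "?F \<in> hom (cochains i) (cochains i)" unfolding cech_frobenius_eq by (rule apply_endo_hom[OF natural_frob])
  have Fc: "?F c \<in> carrier (cochains i)" by (rule hom_in_carrier[OF F c])
  have "?B #>\<^bsub>cochains i\<^esub> ?F z = ?B #>\<^bsub>cochains i\<^esub> ?F c" if z: "z \<in> ?B #>\<^bsub>cochains i\<^esub> c" for z
  proof -
    obtain b where b: "b \<in> ?B" "z = b \<otimes>\<^bsub>cochains i\<^esub> c" using z unfolding r_coset_def by blast
    have bc: "b \<in> carrier (cochains i)" using b(1) subgroup.subset[OF B] by blast
    have "?F z = ?F b \<otimes>\<^bsub>cochains i\<^esub> ?F c" unfolding b(2) by (rule hom_mult[OF F bc c])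
    moreover have "?F b \<in> ?B" unfolding cech_frobenius_eq by (rule apply_endo_coboundaries[OF natural_frob b(1)])
    ultimately have "?F z \<in> ?B #>\<^bsub>cochains i\<^esub> ?F c" unfolding r_coset_def by blast
    then show ?thesis using G.repr_independence[OF _ Fc B] by simp
  qed
  moreover have "c \<in> ?B #>\<^bsub>cochains i\<^esub> c" by (rule G.rcos_self[OF c B])
  ultimately have "(\<lambda>z. ?B #>\<^bsub>cochains i\<^esub> ?F z) ` (?B #>\<^bsub>cochains i\<^esub> c) = {?B #>\<^bsub>cochains i\<^esub> ?F c}" by blast
  then show ?thesis unfolding local_cohomology_frobenius_def by simp
qed

lemma carrier_local_cohomology: "carrier (local_cohomology R xs i)
    = {cech_coboundaries R xs i #>\<^bsub>cochains i\<^esub> c | c. c \<in> cech_cocycles R xs i}"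
  by (auto simp: local_cohomology_def FactGroup_def RCOSETS_def r_coset_def)

lemma coset_eq_iff:
  assumes "c \<in> carrier (cochains i)" "c' \<in> carrier (cochains i)"
  shows "cech_coboundaries R xs i #>\<^bsub>cochains i\<^esub> c = cech_coboundaries R xs i #>\<^bsub>cochains i\<^esub> c'
    \<longleftrightarrow> (\<exists>b\<in>cech_coboundaries R xs i. c = b \<otimes>\<^bsub>cochains i\<^esub> c')"
proof -
  interpret G: group "cochains i" by (rule group_cochains)
  note B = coboundaries_subgroup[of i]
  have "(\<exists>b\<in>cech_coboundaries R xs i. c = b \<otimes>\<^bsub>cochains i\<^esub> c')
      \<longleftrightarrow> c \<in> cech_coboundaries R xs i #>\<^bsub>cochains i\<^esub> c'" unfolding r_coset_def by blast
  then show ?thesis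
    using G.repr_independence[OF _ assms(2) B] G.rcos_self[OF assms(1) B] by blast
qed

text \<open>The splitting extends to localizations through \<open>a / f\<^sup>m = f\<^bsup>m (p - 1)\<^esup> a / (f\<^sup>m)\<^sup>p\<close>.\<close>

definition localized_splitting :: "('a \<Rightarrow> 'a) \<Rightarrow> nat set \<Rightarrow> ('a \<times> nat) set \<Rightarrow> ('a \<times> nat) set"
  where "localized_splitting \<theta> I S =
    (\<Union>(a, m)\<in>S. fraction R (denom I) (\<theta> (denom I [^] (m * (p - 1)) \<otimes> a)) m)"

text \<open>The localized splittings commute with the coface maps and are left inverse to the Frobenius, so
  they provide a left inverse of the Frobenius on the Cech complex and on its cohomology.\<close>

lemma splitting_imp_injective:
  assumes "splitting \<theta>"
  shows "inj_on (local_cohomology_frobenius R p xs i) (carrier (local_cohomology R xs i))"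
proof -
  have closed: "\<theta> a \<in> carrier R" if "a \<in> carrier R" for a using assms that unfolding splitting_def by blast
  have add: "\<theta> (a \<oplus> b) = \<theta> a \<oplus> \<theta> b" if "a \<in> carrier R" "b \<in> carrier R" for a b
    using assms that unfolding splitting_def by blast
  have lin: "\<theta> (a [^] p \<otimes> b) = a \<otimes> \<theta> b" if "a \<in> carrier R" "b \<in> carrier R" for a b
    using assms that unfolding splitting_def by blast
  have pow: "\<theta> (a [^] p) = a" if "a \<in> carrier R" for a
    using lin[OF that one_closed] assms that unfolding splitting_def by simp
  define q where "q = p - 1"
  have q: "p = Suc q" using p_pos by (simp add: q_def)
  let ?\<Theta> = "localized_splitting \<theta>"
  have frac: "?\<Theta> I (fraction R (denom I) a m) = fraction R (denom I) (\<theta> (denom I [^] (m * q) \<otimes> a)) m"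
    if I: "I \<subseteq> positions" and a: "a \<in> carrier R" for I a m
    unfolding localized_splitting_def q_def[symmetric]
  proof (rule fraction_lift[OF denom_closed[OF I] a])
    note f = denom_closed[OF I]
    fix b n assume b: "b \<in> carrier R"
    have "denom I [^] (Suc n * q) \<otimes> (denom I \<otimes> b) = denom I [^] p \<otimes> (denom I [^] (n * q) \<otimes> b)"
      using f b by (simp add: q nat_pow_mult[symmetric] m_ac)
    then have "\<theta> (denom I [^] (Suc n * q) \<otimes> (denom I \<otimes> b)) = denom I \<otimes> \<theta> (denom I [^] (n * q) \<otimes> b)"
      using lin f b by simp
    then show "fraction R (denom I) (\<theta> (denom I [^] (Suc n * q) \<otimes> (denom I \<otimes> b))) (Suc n)
        = fraction R (denom I) (\<theta> (denom I [^] (n * q) \<otimes> b)) n"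
      using fraction_step[OF f] closed f b by simp
  qed
  have nat: "natural_endo ?\<Theta>"
    unfolding natural_endo_def
  proof (intro conjI allI impI)
    fix I assume I: "I \<subseteq> positions"
    note f = denom_closed[OF I]
    show "?\<Theta> I \<in> hom (add_monoid (loc I)) (add_monoid (loc I))"
      using f closed
      by (intro localization_homI f) (simp_all add: frac[OF I] fraction_closed localization_add_common[OF f] r_distr add)
  next
    fix J j x assume J: "J \<subseteq> positions" and j: "j \<in> J" and x: "x \<in> carrier (loc (J - {j}))"
    have J': "J - {j} \<subseteq> positions" using J by blast
    have xj: "xs ! j \<in> carrier R" using J j nth_closed by auto
    note f = denom_closed[OF J']
    obtain a m where a: "a \<in> carrier R" "x = fraction R (denom (J - {j})) a m" using localization_cases[OF x] .
    have "denom J [^] (m * q) \<otimes> (a \<otimes> (xs ! j) [^] m)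
        = ((xs ! j) [^] (m * q) \<otimes> (xs ! j) [^] m) \<otimes> (denom (J - {j}) [^] (m * q) \<otimes> a)"
      unfolding denom_remove[OF J j, symmetric] using f xj a(1)
      by (simp add: nat_pow_distrib m_ac)
    also have "(xs ! j) [^] (m * q) \<otimes> (xs ! j) [^] m = ((xs ! j) [^] m) [^] p"
      using xj by (simp add: nat_pow_pow nat_pow_mult q add.commute)
    finally have "\<theta> (denom J [^] (m * q) \<otimes> (a \<otimes> (xs ! j) [^] m))
        = (xs ! j) [^] m \<otimes> \<theta> (denom (J - {j}) [^] (m * q) \<otimes> a)"
      using lin f xj a(1) by simp
    then show "?\<Theta> J (coface J j x) = coface J j (?\<Theta> (J - {j}) x)"
      unfolding a(2) using a(1) xj f closed
      by (simp add: coface_fraction[OF J j] frac[OF J] frac[OF J'] m_comm)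
  qed
  have split: "?\<Theta> I (frob I x) = x" if I: "I \<subseteq> positions" and x: "x \<in> carrier (loc I)" for I x
  proof -
    note f = denom_closed[OF I]
    obtain a m where a: "a \<in> carrier R" "x = fraction R (denom I) a m" using localization_cases[OF x] .
    have "denom I [^] (m * p * q) \<otimes> a [^] p = (denom I [^] (m * q) \<otimes> a) [^] p"
      using f a(1) by (simp add: nat_pow_distrib nat_pow_pow mult_ac)
    then have "?\<Theta> I (frob I x) = fraction R (denom I) (denom I [^] (m * q) \<otimes> a) (m * p)"
      unfolding a(2) using a(1) f pow by (simp add: frob_fraction[OF I] frac[OF I])
    also have "\<dots> = fraction R (denom I) a m"
      using fraction_expand[OF f a(1), of "m * q" m] by (simp add: q)
    finally show ?thesis using a(2) by simp
  qed
  have split_cochain: "apply_endo ?\<Theta> i (cech_frobenius R p xs i c) = c" if c: "c \<in> carrier (cochains i)" for c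
  proof
    fix I
    show "apply_endo ?\<Theta> i (cech_frobenius R p xs i c) I = c I"
    proof (cases "I \<in> position_sets xs i")
      case True
      then show ?thesis
        using split[OF position_sets_subset[OF True] cochain_closed[OF c True]]
        by (simp add: cech_frobenius_eq apply_endo_def)
    next
      case False
      then show ?thesis using c by (simp add: apply_endo_def cochain_iff extensional_def)
    qed
  qed
  show ?thesis
  proof (rule inj_onI)
    let ?B = "cech_coboundaries R xs i" and ?F = "cech_frobenius R p xs i"
    fix Z Z' assume "Z \<in> carrier (local_cohomology R xs i)" "Z' \<in> carrier (local_cohomology R xs i)"
      and eq: "local_cohomology_frobenius R p xs i Z = local_cohomology_frobenius R p xs i Z'"
    then obtain c c' where c: "c \<in> cech_cocycles R xs i" "Z = ?B #>\<^bsub>cochains i\<^esub> c"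
      and c': "c' \<in> cech_cocycles R xs i" "Z' = ?B #>\<^bsub>cochains i\<^esub> c'"
      unfolding carrier_local_cohomology by blast
    have cc: "c \<in> carrier (cochains i)" "c' \<in> carrier (cochains i)" using c(1) c'(1) cocycle_iff by blast+
    have F: "?F \<in> hom (cochains i) (cochains i)" unfolding cech_frobenius_eq by (rule apply_endo_hom[OF natural_frob])
    have Fc: "?F c \<in> carrier (cochains i)" "?F c' \<in> carrier (cochains i)"
      using hom_in_carrier[OF F] cc by blast+
    have "?B #>\<^bsub>cochains i\<^esub> ?F c = ?B #>\<^bsub>cochains i\<^esub> ?F c'"
      using eq frobenius_coset[OF cc(1)] frobenius_coset[OF cc(2)] unfolding c(2) c'(2) by simp
    then obtain b where b: "b \<in> ?B" "?F c = b \<otimes>\<^bsub>cochains i\<^esub> ?F c'"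
      using coset_eq_iff[OF Fc] by blast
    have bc: "b \<in> carrier (cochains i)" using b(1) subgroup.subset[OF coboundaries_subgroup] by blast
    have "c = apply_endo ?\<Theta> i (b \<otimes>\<^bsub>cochains i\<^esub> ?F c')" using split_cochain[OF cc(1)] b(2) by simp
    also have "\<dots> = apply_endo ?\<Theta> i b \<otimes>\<^bsub>cochains i\<^esub> c'"
      using hom_mult[OF apply_endo_hom[OF nat] bc Fc(2)] split_cochain[OF cc(2)] by simp
    finally show "Z = Z'"
      unfolding c(2) c'(2) coset_eq_iff[OF cc] using apply_endo_coboundaries[OF nat b(1)] by blast
  qed
qed

end

context frobenius_ring
begin

lemma splitting_imp_F_injective:
  assumes "splitting \<theta>"
  shows "F_injective p R \<mm>"
  unfolding F_injective_def
proof (intro allI impI)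
  fix xs i assume "set xs \<subseteq> carrier R \<and> Idl\<^bsub>R\<^esub> (set xs) = \<mm>"
  then interpret cech_complex R p xs by unfold_locales blast
  show "inj_on (local_cohomology_frobenius R p xs i) (carrier (local_cohomology R xs i))"
    by (rule splitting_imp_injective[OF assms])
qed

end


section \<open>Monoid algebras and toric face rings\<close>

lemma poly_mapping_sum_single: "f = (\<Sum>a\<in>Poly_Mapping.keys f. Poly_Mapping.single a (Poly_Mapping.lookup f a))"
proof (rule poly_mapping_eqI)
  fix b
  have "(\<Sum>a\<in>Poly_Mapping.keys f. Poly_Mapping.lookup (Poly_Mapping.single a (Poly_Mapping.lookup f a)) b)
      = (\<Sum>a\<in>Poly_Mapping.keys f. if a = b then Poly_Mapping.lookup f b else 0)"
    by (intro sum.cong refl) (simp add: lookup_single when_def)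
  also have "\<dots> = Poly_Mapping.lookup f b"
    by (cases "b \<in> Poly_Mapping.keys f") (simp_all add: in_keys_iff)
  finally show "Poly_Mapping.lookup f b
      = Poly_Mapping.lookup (\<Sum>a\<in>Poly_Mapping.keys f. Poly_Mapping.single a (Poly_Mapping.lookup f a)) b"
    by (simp add: lookup_sum)
qed

lemma poly_mapping_times_single:
  fixes f g :: "'a::comm_monoid_add \<Rightarrow>\<^sub>0 'k::comm_semiring_1"
  shows "f * g = (\<Sum>a\<in>Poly_Mapping.keys f. \<Sum>b\<in>Poly_Mapping.keys g.
    Poly_Mapping.single (a + b) (Poly_Mapping.lookup f a * Poly_Mapping.lookup g b))"
  by (subst poly_mapping_sum_single[of f], subst poly_mapping_sum_single[of g])
    (simp add: sum_product mult_single)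

lemma single_power:
  fixes a :: "int ^ 'd" and c :: "'k::comm_semiring_1"
  shows "Poly_Mapping.single a c ^ n = Poly_Mapping.single (int n *s a) (c ^ n)"
proof (induction n)
  case (Suc n)
  have "int (Suc n) *s a = a + int n *s a" by (simp add: vec_eq_iff algebra_simps)
  then show ?case using Suc by (simp add: mult_single)
qed simp

lemma CHAR_poly_mapping: "CHAR((int ^ 'd) \<Rightarrow>\<^sub>0 'k::field) = CHAR('k)"
proof (rule CHAR_eqI)
  have *: "(of_nat n :: (int ^ 'd) \<Rightarrow>\<^sub>0 'k) = Poly_Mapping.single 0 (of_nat n)" for n
    by (rule single_of_nat[symmetric])
  show "(of_nat CHAR('k) :: (int ^ 'd) \<Rightarrow>\<^sub>0 'k) = 0" unfolding * by simp
  fix n assume "(of_nat n :: (int ^ 'd) \<Rightarrow>\<^sub>0 'k) = 0"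
  then have "(of_nat n :: 'k) = 0" unfolding * by (metis lookup_single_eq lookup_zero)
  then show "CHAR('k) dvd n" by (simp add: of_nat_eq_0_iff_char_dvd)
qed

definition restrict_keys :: "'a set \<Rightarrow> ('a \<Rightarrow>\<^sub>0 'k::comm_monoid_add) \<Rightarrow> ('a \<Rightarrow>\<^sub>0 'k)"
  where "restrict_keys S f = Abs_poly_mapping (\<lambda>a. if a \<in> S then Poly_Mapping.lookup f a else 0)"

lemma lookup_restrict_keys:
  "Poly_Mapping.lookup (restrict_keys S f) a = (if a \<in> S then Poly_Mapping.lookup f a else 0)"
proof -
  have "finite {a. (if a \<in> S then Poly_Mapping.lookup f a else 0) \<noteq> 0}"
    by (rule finite_subset[OF _ finite_keys[of f]]) (auto simp: in_keys_iff split: if_splits)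
  then show ?thesis unfolding restrict_keys_def by (simp add: Abs_poly_mapping_inverse)
qed

lemma restrict_keys_zero [simp]: "restrict_keys S 0 = 0"
  by (rule poly_mapping_eqI) (simp add: lookup_restrict_keys)

lemma restrict_keys_add: "restrict_keys S (f + g) = restrict_keys S f + restrict_keys S g"
  by (rule poly_mapping_eqI) (simp add: lookup_restrict_keys lookup_add)

lemma restrict_keys_sum: "restrict_keys S (\<Sum>x\<in>A. f x) = (\<Sum>x\<in>A. restrict_keys S (f x))"
  by (induction A rule: infinite_finite_induct) (simp_all add: restrict_keys_add)

lemma restrict_keys_single:
  "restrict_keys S (Poly_Mapping.single a c) = (if a \<in> S then Poly_Mapping.single a c else 0)"
  by (rule poly_mapping_eqI) (auto simp: lookup_restrict_keys lookup_single when_def)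

lemma restrict_keys_expand: "restrict_keys S f
    = (\<Sum>a\<in>Poly_Mapping.keys f. if a \<in> S then Poly_Mapping.single a (Poly_Mapping.lookup f a) else 0)"
  by (subst poly_mapping_sum_single[of f]) (simp add: restrict_keys_sum restrict_keys_single)

lemma prod_if_zero: "(if P then x else 0) * (if Q then y else 0) = (if P \<and> Q then x * y else (0::'a::semiring_0))"
  by simp

text \<open>A common frame for monoid algebras, where the index set has one element, and toric face rings,
  where it is the fan. By the assumption \<open>face\<close>, restricting the support to one monoid \<open>M i\<close> is a ring
  homomorphism to the group algebra. These
  homomorphisms are jointly injective, and so identities in \<open>R\<close> are verified there.\<close>

locale face_algebra =
  fixes I :: "'i set" and M :: "'i \<Rightarrow> (int ^ 'd) set"
    and R :: "((int ^ 'd) \<Rightarrow>\<^sub>0 'k::field) ring" and p :: nat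
  assumes char: "CHAR('k) = p" and char_pos: "0 < p"
    and nonempty: "I \<noteq> {}"
    and submonoid: "i \<in> I \<Longrightarrow> add_submonoid (M i)"
    and face: "i \<in> I \<Longrightarrow> j \<in> I \<Longrightarrow> a \<in> M i \<Longrightarrow> b \<in> M i \<Longrightarrow> a + b \<in> M j \<Longrightarrow> a \<in> M j"
    and carrier_eq: "carrier R = {f. Poly_Mapping.keys f \<subseteq> (\<Union>i\<in>I. M i)}"
    and one_eq: "\<one>\<^bsub>R\<^esub> = 1" and zero_eq: "\<zero>\<^bsub>R\<^esub> = 0" and add_eq: "\<And>f g. f \<oplus>\<^bsub>R\<^esub> g = f + g"
    and mult_eq: "f \<in> carrier R \<Longrightarrow> g \<in> carrier R \<Longrightarrow> f \<otimes>\<^bsub>R\<^esub> g =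
      (\<Sum>a\<in>Poly_Mapping.keys f. \<Sum>b\<in>Poly_Mapping.keys g.
        if \<exists>i\<in>I. a \<in> M i \<and> b \<in> M i
        then Poly_Mapping.single (a + b) (Poly_Mapping.lookup f a * Poly_Mapping.lookup g b) else 0)"
begin

abbreviation "exponents \<equiv> \<Union>i\<in>I. M i"

lemma face': "i \<in> I \<Longrightarrow> j \<in> I \<Longrightarrow> a \<in> M i \<Longrightarrow> b \<in> M i \<Longrightarrow> a + b \<in> M j \<Longrightarrow> b \<in> M j"
  using face[of i j b a] by (simp add: add.commute)

lemma smult_mem_iff:
  assumes "i \<in> I" "a \<in> exponents"
  shows "int p *s a \<in> M i \<longleftrightarrow> a \<in> M i"
proof
  assume *: "int p *s a \<in> M i"
  obtain j where j: "j \<in> I" "a \<in> M j" using assms(2) by blast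
  have "int p *s a = a + int (p - 1) *s a"
    using char_pos by (simp add: vec_eq_iff of_nat_diff algebra_simps)
  then show "a \<in> M i"
    using face[OF j(1) assms(1) j(2), of "int (p - 1) *s a"] submonoid_smult[OF submonoid[OF j(1)] j(2)] * by simp
qed (simp add: submonoid_smult[OF submonoid] assms(1))

lemma single_carrier: "a \<in> exponents \<Longrightarrow> Poly_Mapping.single a c \<in> carrier R"
  by (simp add: carrier_eq)

lemma single_carrier': "i \<in> I \<Longrightarrow> a \<in> M i \<Longrightarrow> Poly_Mapping.single a c \<in> carrier R"
  by (rule single_carrier) blast

lemma add_carrier: "f \<in> carrier R \<Longrightarrow> g \<in> carrier R \<Longrightarrow> f + g \<in> carrier R"
  using keys_add[of f g] by (auto simp: carrier_eq)

lemma sum_carrier: "(\<And>x. x \<in> A \<Longrightarrow> f x \<in> carrier R) \<Longrightarrow> (\<Sum>x\<in>A. f x) \<in> carrier R"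
  by (induction A rule: infinite_finite_induct) (simp_all add: add_carrier, simp_all add: carrier_eq)

lemma mult_carrier:
  assumes "f \<in> carrier R" "g \<in> carrier R"
  shows "f \<otimes>\<^bsub>R\<^esub> g \<in> carrier R"
  unfolding mult_eq[OF assms]
proof (intro sum_carrier)
  fix a b
  show "(if \<exists>i\<in>I. a \<in> M i \<and> b \<in> M i
      then Poly_Mapping.single (a + b) (Poly_Mapping.lookup f a * Poly_Mapping.lookup g b) else 0) \<in> carrier R"
    using submonoid_add[OF submonoid] by (auto intro!: single_carrier) (simp add: carrier_eq)
qed

lemma carrier_eqI:
  assumes "f \<in> carrier R" "g \<in> carrier R" "\<And>i. i \<in> I \<Longrightarrow> restrict_keys (M i) f = restrict_keys (M i) g"
  shows "f = g"
proof (rule poly_mapping_eqI)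
  fix a
  show "Poly_Mapping.lookup f a = Poly_Mapping.lookup g a"
  proof (cases "a \<in> exponents")
    case True
    then obtain i where i: "i \<in> I" "a \<in> M i" by blast
    then have "Poly_Mapping.lookup (restrict_keys (M i) f) a = Poly_Mapping.lookup (restrict_keys (M i) g) a"
      using assms(3)[OF i(1)] by simp
    then show ?thesis using i(2) by (simp add: lookup_restrict_keys)
  next
    case False
    then have "a \<notin> Poly_Mapping.keys f" "a \<notin> Poly_Mapping.keys g"
      using assms(1,2) unfolding carrier_eq by blast+
    then show ?thesis by (simp add: in_keys_iff)
  qed
qed

text \<open>A product of monomials with exponents \<open>a\<close> and \<open>b\<close> has its exponent in \<open>M i\<close> exactly if both \<open>a\<close> and \<open>b\<close>
  are in \<open>M i\<close>.\<close>

lemma restrict_mult: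
  assumes i: "i \<in> I" and f: "f \<in> carrier R" and g: "g \<in> carrier R"
  shows "restrict_keys (M i) (f \<otimes>\<^bsub>R\<^esub> g) = restrict_keys (M i) f * restrict_keys (M i) g"
proof -
  let ?s = "\<lambda>a b. Poly_Mapping.single (a + b) (Poly_Mapping.lookup f a * Poly_Mapping.lookup g b)"
  have "restrict_keys (M i) (f \<otimes>\<^bsub>R\<^esub> g) = (\<Sum>a\<in>Poly_Mapping.keys f. \<Sum>b\<in>Poly_Mapping.keys g.
      if a \<in> M i \<and> b \<in> M i then ?s a b else 0)"
    unfolding mult_eq[OF f g] restrict_keys_sum
  proof (intro sum.cong refl)
    fix a b assume "a \<in> Poly_Mapping.keys f" "b \<in> Poly_Mapping.keys g"
    show "restrict_keys (M i) (if \<exists>i\<in>I. a \<in> M i \<and> b \<in> M i then ?s a b else 0)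
        = (if a \<in> M i \<and> b \<in> M i then ?s a b else 0)"
    proof (cases "\<exists>j\<in>I. a \<in> M j \<and> b \<in> M j")
      case True
      then obtain j where j: "j \<in> I" "a \<in> M j" "b \<in> M j" by blast
      have "a + b \<in> M i \<longleftrightarrow> a \<in> M i \<and> b \<in> M i"
        using face[OF j(1) i j(2,3)] face'[OF j(1) i j(2,3)] submonoid_add[OF submonoid[OF i]] by blast
      then show ?thesis using True by (simp add: restrict_keys_single)
    next
      case False
      then show ?thesis using i by auto
    qed
  qed
  also have "\<dots> = restrict_keys (M i) f * restrict_keys (M i) g"
    unfolding restrict_keys_expand[of _ f] restrict_keys_expand[of _ g] sum_product prod_if_zero mult_single ..
  finally show ?thesis .
qed

lemma restrict_one: "i \<in> I \<Longrightarrow> restrict_keys (M i) 1 = (1 :: (int ^ 'd) \<Rightarrow>\<^sub>0 'k)"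
  using submonoid_zero[OF submonoid] restrict_keys_single[of "M i" 0 "1 :: 'k"] by simp

lemma one_carrier: "1 \<in> carrier R"
  using nonempty submonoid_zero[OF submonoid] by (auto simp: carrier_eq)

lemma cring_R: "cring R"
proof (rule cringI)
  show "abelian_group R"
  proof (rule abelian_groupI)
    fix x assume x: "x \<in> carrier R"
    show "\<exists>y\<in>carrier R. y \<oplus>\<^bsub>R\<^esub> x = \<zero>\<^bsub>R\<^esub>"
      using x by (intro bexI[of _ "- x"]) (simp_all add: add_eq zero_eq, simp add: carrier_eq)
  qed (simp_all add: add_eq zero_eq add_carrier add_ac, simp add: carrier_eq)
  show "comm_monoid R"
  proof (rule comm_monoidI)
    fix x y z assume x: "x \<in> carrier R"
    show "\<one>\<^bsub>R\<^esub> \<otimes>\<^bsub>R\<^esub> x = x"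
      unfolding one_eq using x one_carrier
      by (intro carrier_eqI[OF mult_carrier]) (simp_all add: restrict_mult restrict_one)
    assume y: "y \<in> carrier R"
    show "x \<otimes>\<^bsub>R\<^esub> y = y \<otimes>\<^bsub>R\<^esub> x"
      using x y by (intro carrier_eqI[OF mult_carrier mult_carrier]) (simp_all add: restrict_mult mult.commute)
    assume z: "z \<in> carrier R"
    show "x \<otimes>\<^bsub>R\<^esub> y \<otimes>\<^bsub>R\<^esub> z = x \<otimes>\<^bsub>R\<^esub> (y \<otimes>\<^bsub>R\<^esub> z)"
      using x y z by (intro carrier_eqI[OF mult_carrier mult_carrier])
        (simp_all add: restrict_mult mult_carrier mult.assoc)
  qed (simp_all add: mult_carrier one_eq one_carrier)
  show "(x \<oplus>\<^bsub>R\<^esub> y) \<otimes>\<^bsub>R\<^esub> z = x \<otimes>\<^bsub>R\<^esub> z \<oplus>\<^bsub>R\<^esub> y \<otimes>\<^bsub>R\<^esub> z"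
    if "x \<in> carrier R" "y \<in> carrier R" "z \<in> carrier R" for x y z
    unfolding add_eq using that
    by (intro carrier_eqI[OF mult_carrier add_carrier[OF mult_carrier mult_carrier]])
      (simp_all add: restrict_mult restrict_keys_add add_carrier distrib_right)
qed

sublocale cring R by (rule cring_R)

lemma power_carrier: "f \<in> carrier R \<Longrightarrow> f [^]\<^bsub>R\<^esub> (n::nat) \<in> carrier R"
  by (rule nat_pow_closed)

lemma restrict_power:
  assumes "i \<in> I" "f \<in> carrier R"
  shows "restrict_keys (M i) (f [^]\<^bsub>R\<^esub> (n::nat)) = restrict_keys (M i) f ^ n"
proof (induction n)
  case 0
  show ?case using restrict_one[OF assms(1)] by (simp add: one_eq)
next
  case (Suc n)
  then show ?case using restrict_mult[OF assms(1) power_carrier[OF assms(2)] assms(2)]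
    by (simp add: mult.commute)
qed

lemma freshman:
  fixes x y :: "(int ^ 'd) \<Rightarrow>\<^sub>0 'k"
  shows "(x + y) ^ p = x ^ p + y ^ p"
  using prime_CHAR_semidom[where 'a='k] char char_pos
  by (intro freshmans_dream) (simp_all add: CHAR_poly_mapping)

lemma freshman_sum:
  fixes f :: "'b \<Rightarrow> (int ^ 'd) \<Rightarrow>\<^sub>0 'k"
  shows "(\<Sum>x\<in>A. f x) ^ p = (\<Sum>x\<in>A. f x ^ p)"
  using char_pos by (induction A rule: infinite_finite_induct) (simp_all add: freshman power_0_left)

sublocale frobenius_ring R p
proof
  show "0 < p" by (rule char_pos)
  fix a b assume ab: "a \<in> carrier R" "b \<in> carrier R"
  show "(a \<oplus>\<^bsub>R\<^esub> b) [^]\<^bsub>R\<^esub> p = a [^]\<^bsub>R\<^esub> p \<oplus>\<^bsub>R\<^esub> b [^]\<^bsub>R\<^esub> p"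
    unfolding add_eq using ab
    by (intro carrier_eqI[OF power_carrier[OF add_carrier] add_carrier[OF power_carrier power_carrier]])
      (simp_all add: restrict_power restrict_keys_add add_carrier freshman)
qed

lemma frobenius_formula:
  assumes f: "f \<in> carrier R"
  shows "f [^]\<^bsub>R\<^esub> p = (\<Sum>a\<in>Poly_Mapping.keys f. Poly_Mapping.single (int p *s a) (Poly_Mapping.lookup f a ^ p))"
proof (rule carrier_eqI[OF power_carrier[OF f]])
  have keys: "a \<in> exponents" if "a \<in> Poly_Mapping.keys f" for a using f that by (auto simp: carrier_eq)
  show "(\<Sum>a\<in>Poly_Mapping.keys f. Poly_Mapping.single (int p *s a) (Poly_Mapping.lookup f a ^ p)) \<in> carrier R"
  proof (rule sum_carrier)
    fix a assume "a \<in> Poly_Mapping.keys f"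
    then obtain i where "i \<in> I" "a \<in> M i" using keys by blast
    then show "Poly_Mapping.single (int p *s a) (Poly_Mapping.lookup f a ^ p) \<in> carrier R"
      using submonoid_smult[OF submonoid] by (intro single_carrier') auto
  qed
  fix i assume i: "i \<in> I"
  have "restrict_keys (M i) (f [^]\<^bsub>R\<^esub> p)
      = (\<Sum>a\<in>Poly_Mapping.keys f. if a \<in> M i then Poly_Mapping.single a (Poly_Mapping.lookup f a) else 0) ^ p"
    unfolding restrict_power[OF i f] restrict_keys_expand[of _ f] ..
  also have "\<dots> = (\<Sum>a\<in>Poly_Mapping.keys f. if int p *s a \<in> M i then Poly_Mapping.single (int p *s a) (Poly_Mapping.lookup f a ^ p) else 0)"
    unfolding freshman_sum
    using char_pos by (intro sum.cong refl) (simp add: smult_mem_iff[OF i keys] single_power power_0_left)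
  also have "\<dots> = restrict_keys (M i) (\<Sum>a\<in>Poly_Mapping.keys f. Poly_Mapping.single (int p *s a) (Poly_Mapping.lookup f a ^ p))"
    by (simp add: restrict_keys_sum restrict_keys_single)
  finally show "restrict_keys (M i) (f [^]\<^bsub>R\<^esub> p)
      = restrict_keys (M i) (\<Sum>a\<in>Poly_Mapping.keys f. Poly_Mapping.single (int p *s a) (Poly_Mapping.lookup f a ^ p))" .
qed

lemma smult_p_inj: "int p *s a = int p *s b \<longleftrightarrow> a = b"
  using char_pos by (intro smult_left_cancel) simp

lemma lookup_frobenius:
  assumes f: "f \<in> carrier R"
  shows "Poly_Mapping.lookup (f [^]\<^bsub>R\<^esub> p) (int p *s a) = Poly_Mapping.lookup f a ^ p"
proof -
  have "Poly_Mapping.lookup (f [^]\<^bsub>R\<^esub> p) (int p *s a)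
      = (\<Sum>b\<in>Poly_Mapping.keys f. if b = a then Poly_Mapping.lookup f a ^ p else 0)"
    unfolding frobenius_formula[OF f] lookup_sum
    by (intro sum.cong refl) (simp add: lookup_single when_def smult_p_inj)
  also have "\<dots> = Poly_Mapping.lookup f a ^ p"
    using char_pos by (cases "a \<in> Poly_Mapping.keys f") (simp_all add: in_keys_iff power_0_left)
  finally show ?thesis .
qed

lemma frobenius_single:
  assumes "a \<in> exponents"
  shows "Poly_Mapping.single a c [^]\<^bsub>R\<^esub> p = Poly_Mapping.single (int p *s a) (c ^ p)"
  using frobenius_formula[OF single_carrier[OF assms], of c] char_pos by (cases "c = 0") (simp_all add: power_0_left)

lemma mult_single_single:
  assumes "a \<in> exponents" "b \<in> exponents"
  shows "Poly_Mapping.single a c \<otimes>\<^bsub>R\<^esub> Poly_Mapping.single b d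
    = (if \<exists>i\<in>I. a \<in> M i \<and> b \<in> M i then Poly_Mapping.single (a + b) (c * d) else 0)"
proof -
  have *: "(\<Sum>x\<in>Poly_Mapping.keys (Poly_Mapping.single y e). f x) = (if e = 0 then 0 else f y)"
    for y :: "int ^ 'd" and e :: 'k and f :: "int ^ 'd \<Rightarrow> (int ^ 'd) \<Rightarrow>\<^sub>0 'k" by simp
  show ?thesis
    unfolding mult_eq[OF single_carrier[OF assms(1)] single_carrier[OF assms(2)]] * by auto
qed

lemma single_mult_single:
  assumes "i \<in> I" "a \<in> M i" "b \<in> M i"
  shows "Poly_Mapping.single a c \<otimes>\<^bsub>R\<^esub> Poly_Mapping.single b d = Poly_Mapping.single (a + b) (c * d)"
proof -
  have "\<exists>i\<in>I. a \<in> M i \<and> b \<in> M i" using assms by blast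
  moreover have "a \<in> exponents" "b \<in> exponents" using assms by blast+
  ultimately show ?thesis by (simp only: mult_single_single if_True)
qed

lemma carrier_induct [consumes 1, case_names zero single add]:
  assumes f: "f \<in> carrier R" and "P 0"
    and single: "\<And>a c. a \<in> exponents \<Longrightarrow> P (Poly_Mapping.single a c)"
    and add: "\<And>f g. f \<in> carrier R \<Longrightarrow> g \<in> carrier R \<Longrightarrow> P f \<Longrightarrow> P g \<Longrightarrow> P (f + g)"
  shows "P f"
proof -
  have "(\<Sum>a\<in>A. Poly_Mapping.single a (Poly_Mapping.lookup f a)) \<in> carrier R
      \<and> P (\<Sum>a\<in>A. Poly_Mapping.single a (Poly_Mapping.lookup f a))" if "finite A" "A \<subseteq> exponents" for A
    using that
  proof (induction A rule: finite_induct)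
    case empty
    then show ?case using \<open>P 0\<close> by (simp add: carrier_eq)
  next
    case (insert a A)
    then have "a \<in> exponents" by blast
    then show ?case using insert single_carrier single add add_carrier by simp
  qed
  from this[of "Poly_Mapping.keys f"] show ?thesis
    using f poly_mapping_sum_single[of f] by (simp add: carrier_eq)
qed

text \<open>The monomials satisfy \<open>(X\<^sup>u)\<^sup>p = (X\<^sup>v)\<^sup>p X\<^sup>w\<close> with \<open>w = p (u - v)\<close>. Contractedness gives
  \<open>(X\<^sup>u)\<^sup>p = (X\<^sup>v h)\<^sup>p\<close>, and comparing coefficients at \<open>p u\<close> shows that \<open>u - v\<close> is an exponent of \<open>h\<close>.\<close>

lemma contracted_imp_difference_mem:
  assumes contr: frobenius_contracted and i: "i \<in> I" and uv: "u \<in> M i" "v \<in> M i"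
    and w: "int p *s (u - v) \<in> M i"
  shows "u - v \<in> M i"
proof -
  let ?x = "\<lambda>a. Poly_Mapping.single a (1::'k)"
  have us: "u \<in> exponents" "v \<in> exponents" using i uv by blast+
  have pv: "int p *s v \<in> M i" by (rule submonoid_smult[OF submonoid[OF i] uv(2)])
  have "?x u [^]\<^bsub>R\<^esub> p = ?x v [^]\<^bsub>R\<^esub> p \<otimes>\<^bsub>R\<^esub> ?x (int p *s (u - v))"
  proof -
    have "int p *s v + int p *s (u - v) = int p *s u" by (simp add: vec_eq_iff algebra_simps)
    then show ?thesis using single_mult_single[OF i pv w, of 1 1] by (simp add: frobenius_single[OF us(1)] frobenius_single[OF us(2)])
  qed
  moreover have "?x u \<in> carrier R" "?x v \<in> carrier R" "?x (int p *s (u - v)) \<in> carrier R"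
    using single_carrier'[OF i] uv w by blast+
  ultimately obtain h where h: "h \<in> carrier R" "?x u [^]\<^bsub>R\<^esub> p = (?x v \<otimes>\<^bsub>R\<^esub> h) [^]\<^bsub>R\<^esub> p"
    using contr unfolding frobenius_contracted_def by blast
  have vh: "?x v \<otimes>\<^bsub>R\<^esub> h \<in> carrier R" using mult_carrier single_carrier[OF us(2)] h(1) by blast
  have "Poly_Mapping.lookup (?x u [^]\<^bsub>R\<^esub> p) (int p *s u) = 1"
    by (simp add: frobenius_single[OF us(1)])
  then have "Poly_Mapping.lookup (?x v \<otimes>\<^bsub>R\<^esub> h) u ^ p = 1"
    unfolding h(2) lookup_frobenius[OF vh] .
  then have nz: "Poly_Mapping.lookup (?x v \<otimes>\<^bsub>R\<^esub> h) u \<noteq> 0" using char_pos by (auto simp: power_0_left)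
  have "?x v \<otimes>\<^bsub>R\<^esub> h = (\<Sum>b\<in>Poly_Mapping.keys h. if \<exists>i\<in>I. v \<in> M i \<and> b \<in> M i
      then Poly_Mapping.single (v + b) (Poly_Mapping.lookup h b) else 0)"
  proof -
    have *: "(\<Sum>x\<in>Poly_Mapping.keys (Poly_Mapping.single v (1 :: 'k)). f x) = f v"
      for f :: "int ^ 'd \<Rightarrow> (int ^ 'd) \<Rightarrow>\<^sub>0 'k" by simp
    show ?thesis unfolding mult_eq[OF single_carrier[OF us(2)] h(1)] * by (simp only: lookup_single_eq mult_1)
  qed
  then have "(\<Sum>b\<in>Poly_Mapping.keys h. Poly_Mapping.lookup (if \<exists>i\<in>I. v \<in> M i \<and> b \<in> M i
      then Poly_Mapping.single (v + b) (Poly_Mapping.lookup h b) else 0) u) \<noteq> 0"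
    using nz by (simp add: lookup_sum)
  then obtain b where b: "Poly_Mapping.lookup (if \<exists>i\<in>I. v \<in> M i \<and> b \<in> M i
      then Poly_Mapping.single (v + b) (Poly_Mapping.lookup h b) else 0) u \<noteq> 0"
    by (meson sum.neutral)
  then obtain j where j: "j \<in> I" "v \<in> M j" "b \<in> M j" "v + b = u"
    by (auto simp: lookup_single when_def split: if_splits)
  have "b \<in> M i" using face'[OF j(1) i j(2,3)] j(4) uv(1) by simp
  then show ?thesis using j(4)[symmetric] by simp
qed

text \<open>The splitting maps \<open>c X\<^sup>a\<close> to \<open>\<lambda>(c) X\<^bsup>a/p\<^esup>\<close> if \<open>a / p\<close> is an exponent of the ring and to zero otherwise, where
  the additive map \<open>\<lambda>\<close> on \<open>k\<close> satisfies \<open>\<lambda>(c\<^sup>p d) = c \<lambda>(d)\<close> and \<open>\<lambda>(1) = 1\<close>. The hypothesis is what linearity over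
  the Frobenius requires: multiplication by \<open>X\<^bsup>p a\<^esup>\<close> must not create exponents divisible by \<open>p\<close>.\<close>

lemma root_closed_imp_splitting:
  assumes root: "\<And>i a b e. i \<in> I \<Longrightarrow> a \<in> M i \<Longrightarrow> b \<in> M i \<Longrightarrow> e \<in> exponents \<Longrightarrow>
    int p *s a + b = int p *s e \<Longrightarrow> \<exists>b'\<in>exponents. b = int p *s b'"
  shows "\<exists>\<theta>. splitting \<theta>"
proof -
  have freshman_k: "(x + y) ^ p = x ^ p + y ^ p" for x y :: 'k
    using prime_CHAR_semidom[where 'a='k] char char_pos by (intro freshmans_dream) simp_all
  \<comment> \<open>Through the Frobenius, \<open>k\<close> is a vector space over itself; \<open>lk\<close> is a linear functional on it.\<close>
  have "vector_space (\<lambda>a b. a ^ p * b :: 'k)"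
    by unfold_locales (simp_all add: freshman_k algebra_simps power_mult_distrib)
  then obtain lk :: "'k \<Rightarrow> 'k" where lkp: "\<And>x y. lk (x + y) = lk x + lk y"
      "\<And>a x. lk (a ^ p * x) = a * lk x" "lk 1 = 1"
    by (rule exists_linear_functional[of _ 1]) auto
  have lk0: "lk 0 = 0" using lkp(1)[of 0 0] by (metis add_cancel_right_right add_0_right)
  define \<theta> :: "((int ^ 'd) \<Rightarrow>\<^sub>0 'k) \<Rightarrow> (int ^ 'd) \<Rightarrow>\<^sub>0 'k"
    where "\<theta> f = Abs_poly_mapping (\<lambda>a. if a \<in> exponents then lk (Poly_Mapping.lookup f (int p *s a)) else 0)" for f
  have lookup_\<theta>: "Poly_Mapping.lookup (\<theta> f) a
      = (if a \<in> exponents then lk (Poly_Mapping.lookup f (int p *s a)) else 0)" for f a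
  proof -
    have "finite ((\<lambda>a. int p *s a) -` Poly_Mapping.keys f)"
      by (intro finite_vimageI) (simp_all add: inj_def smult_p_inj)
    then have "finite {a. (if a \<in> exponents then lk (Poly_Mapping.lookup f (int p *s a)) else 0) \<noteq> 0}"
      by (rule rev_finite_subset) (auto simp: in_keys_iff lk0)
    then show ?thesis unfolding \<theta>_def by (simp add: Abs_poly_mapping_inverse)
  qed
  have \<theta>_carrier: "\<theta> f \<in> carrier R" for f
    unfolding carrier_eq by (auto simp: in_keys_iff lookup_\<theta> split: if_splits)
  have \<theta>_add: "\<theta> (f + g) = \<theta> f + \<theta> g" for f g
    by (rule poly_mapping_eqI) (simp add: lookup_\<theta> lookup_add lkp)
  have \<theta>_zero: "\<theta> 0 = 0"
    by (rule poly_mapping_eqI) (simp add: lookup_\<theta> lk0)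
  have \<theta>_single: "\<theta> (Poly_Mapping.single (int p *s a) c) = Poly_Mapping.single a (lk c)" if "a \<in> exponents" for a c
    using that by (intro poly_mapping_eqI) (auto simp: lookup_\<theta> lookup_single when_def smult_p_inj lk0)
  have \<theta>_single0: "\<theta> (Poly_Mapping.single b c) = 0" if "\<And>a. a \<in> exponents \<Longrightarrow> b \<noteq> int p *s a" for b c
    using that by (intro poly_mapping_eqI) (auto simp: lookup_\<theta> lookup_single when_def lk0)
  have common: "(\<exists>i\<in>I. int p *s a \<in> M i \<and> b \<in> M i) \<longleftrightarrow> (\<exists>i\<in>I. a \<in> M i \<and> b \<in> M i)" if "a \<in> exponents" for a b
    using smult_mem_iff[OF _ that] by blast
  have psup: "int p *s a \<in> exponents" if "a \<in> exponents" for a using smult_mem_iff[OF _ that] that by blast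
  have singles: "\<theta> (Poly_Mapping.single a c [^]\<^bsub>R\<^esub> p \<otimes>\<^bsub>R\<^esub> Poly_Mapping.single b d)
      = Poly_Mapping.single a c \<otimes>\<^bsub>R\<^esub> \<theta> (Poly_Mapping.single b d)"
    if a: "a \<in> exponents" and b: "b \<in> exponents" for a b c d
  proof -
    have L: "Poly_Mapping.single a c [^]\<^bsub>R\<^esub> p \<otimes>\<^bsub>R\<^esub> Poly_Mapping.single b d
        = (if \<exists>i\<in>I. a \<in> M i \<and> b \<in> M i then Poly_Mapping.single (int p *s a + b) (c ^ p * d) else 0)"
      unfolding frobenius_single[OF a] mult_single_single[OF psup[OF a] b] common[OF a] ..
    show ?thesis
    proof (cases "\<exists>b'\<in>exponents. b = int p *s b'")
      case True
      then obtain b' where b': "b' \<in> exponents" "b = int p *s b'" by blast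
      have comm: "(\<exists>i\<in>I. a \<in> M i \<and> b \<in> M i) \<longleftrightarrow> (\<exists>i\<in>I. a \<in> M i \<and> b' \<in> M i)"
        unfolding b'(2) using smult_mem_iff[OF _ b'(1)] by blast
      have R': "Poly_Mapping.single a c \<otimes>\<^bsub>R\<^esub> \<theta> (Poly_Mapping.single b d)
          = (if \<exists>i\<in>I. a \<in> M i \<and> b' \<in> M i then Poly_Mapping.single (a + b') (c * lk d) else 0)"
        unfolding b'(2) \<theta>_single[OF b'(1)] mult_single_single[OF a b'(1)] ..
      have sum: "int p *s a + b = int p *s (a + b')" unfolding b'(2) by (simp add: vec_eq_iff algebra_simps)
      show ?thesis
      proof (cases "\<exists>i\<in>I. a \<in> M i \<and> b' \<in> M i")
        case T: True
        then have "a + b' \<in> exponents" using submonoid_add[OF submonoid] by blast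
        from \<theta>_single[OF this, of "c ^ p * d"]
        have "\<theta> (Poly_Mapping.single (int p *s (a + b')) (c ^ p * d)) = Poly_Mapping.single (a + b') (c * lk d)"
          unfolding lkp(2) .
        then show ?thesis unfolding L R' comm sum if_P[OF T] .
      next
        case False
        show ?thesis unfolding L R' comm if_not_P[OF False] by (rule \<theta>_zero)
      qed
    next
      case False
      then have "\<theta> (Poly_Mapping.single b d) = 0" by (intro \<theta>_single0) blast
      then have R': "Poly_Mapping.single a c \<otimes>\<^bsub>R\<^esub> \<theta> (Poly_Mapping.single b d) = 0"
        using r_null[OF single_carrier[OF a]] by (simp add: zero_eq)
      have "\<theta> (Poly_Mapping.single (int p *s a + b) (c ^ p * d)) = 0" if "\<exists>i\<in>I. a \<in> M i \<and> b \<in> M i"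
        using root that False by (intro \<theta>_single0) metis
      then show ?thesis unfolding L R' using \<theta>_zero by simp
    qed
  qed
  have lin: "\<theta> (f [^]\<^bsub>R\<^esub> p \<otimes>\<^bsub>R\<^esub> g) = f \<otimes>\<^bsub>R\<^esub> \<theta> g" if f: "f \<in> carrier R" and g: "g \<in> carrier R" for f g
    using f
  proof (induction f rule: carrier_induct)
    case zero
    show ?case using g \<theta>_carrier[of g] frobenius_zero l_null[OF g] l_null[OF \<theta>_carrier[of g]] by (simp add: zero_eq \<theta>_zero)
  next
    case (single a c)
    note sc = single_carrier[OF single]
    show ?case using g
    proof (induction g rule: carrier_induct)
      case zero
      show ?case using sc r_null[OF sc] r_null[OF power_carrier[OF sc]] by (simp add: zero_eq \<theta>_zero)
    next
      case (single b d)
      then show ?case using singles \<open>a \<in> exponents\<close> by blast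
    next
      case (add g g')
      then show ?case
        using r_distr[OF add(1,2) power_carrier[OF sc]] r_distr[OF \<theta>_carrier \<theta>_carrier sc]
        by (simp add: add_eq \<theta>_add)
    qed
  next
    case (add f f')
    then show ?case
      using l_distr[OF power_carrier[OF add(1)] power_carrier[OF add(2)] g] l_distr[OF add(1,2) \<theta>_carrier]
        frobenius_add[OF add(1,2)]
      by (simp add: add_eq \<theta>_add)
  qed
  have zs: "0 \<in> exponents" using nonempty submonoid_zero[OF submonoid] by blast
  have "\<theta> 1 = 1" using \<theta>_single[OF zs, of 1] lkp(3) by simp
  then have "splitting \<theta>"
    unfolding splitting_def using \<theta>_carrier \<theta>_add lin by (simp add: add_eq one_eq)
  then show ?thesis by blast
qed

end


section \<open>The graded Cech complex of a monoid algebra\<close>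

lemma face_algebra_monoid_ring:
  assumes "add_submonoid N" "CHAR('k::field) = p" "0 < p"
  shows "face_algebra {()} (\<lambda>_. N) (monoid_ring N :: ((int ^ 'd) \<Rightarrow>\<^sub>0 'k) ring) p"
proof
  fix f g :: "(int ^ 'd) \<Rightarrow>\<^sub>0 'k"
  assume fg: "f \<in> carrier (monoid_ring N)" "g \<in> carrier (monoid_ring N)"
  then have k: "a \<in> N" if "a \<in> Poly_Mapping.keys f \<or> a \<in> Poly_Mapping.keys g" for a
    using that by (auto simp: monoid_ring_def)
  show "f \<otimes>\<^bsub>monoid_ring N\<^esub> g = (\<Sum>a\<in>Poly_Mapping.keys f. \<Sum>b\<in>Poly_Mapping.keys g.
      if \<exists>i\<in>{()}. a \<in> N \<and> b \<in> N
      then Poly_Mapping.single (a + b) (Poly_Mapping.lookup f a * Poly_Mapping.lookup g b) else 0)"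
    using k by (simp add: monoid_ring_def poly_mapping_times_single[of f g] cong: sum.cong)
qed (use assms in \<open>simp_all add: monoid_ring_def\<close>)

lemma lookup_single_times:
  fixes f :: "'a::cancel_comm_monoid_add \<Rightarrow>\<^sub>0 'k::comm_semiring_1"
  shows "Poly_Mapping.lookup (Poly_Mapping.single x c * f) (x + b) = c * Poly_Mapping.lookup f b"
proof -
  have "Poly_Mapping.single x c * f
      = (\<Sum>a\<in>Poly_Mapping.keys f. Poly_Mapping.single (x + a) (c * Poly_Mapping.lookup f a))"
    by (subst poly_mapping_sum_single[of f]) (simp add: sum_distrib_left mult_single)
  then have "Poly_Mapping.lookup (Poly_Mapping.single x c * f) (x + b)
      = (\<Sum>a\<in>Poly_Mapping.keys f. if a = b then c * Poly_Mapping.lookup f b else 0)"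
    by (simp add: lookup_sum lookup_single when_def cong: sum.cong if_cong)
  also have "\<dots> = c * Poly_Mapping.lookup f b"
    by (cases "b \<in> Poly_Mapping.keys f") (simp_all add: in_keys_iff)
  finally show ?thesis .
qed

lemma comm_group_additive: "comm_group (additive_group (UNIV :: 'a::ab_group_add set))"
proof (rule comm_groupI)
  fix x :: 'a
  show "\<exists>y\<in>carrier (additive_group UNIV). y \<otimes>\<^bsub>additive_group UNIV\<^esub> x = \<one>\<^bsub>additive_group UNIV\<^esub>"
    by (intro bexI[of _ "- x"]) (simp_all add: additive_group_def)
qed (simp_all add: additive_group_def add_ac)

lemma finprod_additive: "finprod (additive_group UNIV) f A = (\<Sum>x\<in>A. f x :: 'a::ab_group_add)"
proof -
  interpret comm_group "additive_group (UNIV :: 'a set)" by (rule comm_group_additive)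
  show ?thesis
  proof (induction A rule: infinite_finite_induct)
    case (insert x A)
    then show ?case by (subst finprod_insert) (simp_all add: additive_group_def)
  qed (simp_all, simp_all add: additive_group_def)
qed

lemma sign_pow_additive:
  "x [^]\<^bsub>additive_group UNIV\<^esub> ((-1) ^ n :: int) = (-1) ^ n * (x :: 'k::comm_ring_1)"
proof -
  interpret comm_group "additive_group (UNIV :: 'k set)" by (rule comm_group_additive)
  have c: "y \<in> carrier (additive_group UNIV)" for y :: 'k by (simp add: additive_group_def)
  have inv: "inv\<^bsub>additive_group UNIV\<^esub> x = - x"
    by (rule inv_equality) (simp_all add: additive_group_def)
  have "x [^]\<^bsub>additive_group UNIV\<^esub> (-1 :: int) = inv\<^bsub>additive_group UNIV\<^esub> x"
    using int_pow_neg[OF c, of x 1] int_pow_1[OF c, of x] by simp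
  then have "x [^]\<^bsub>additive_group UNIV\<^esub> (-1 :: int) = - x" using inv by simp
  moreover have "x [^]\<^bsub>additive_group UNIV\<^esub> (1 :: int) = x" by (rule int_pow_1[OF c])
  ultimately show ?thesis by (cases "even n") simp_all
qed

text \<open>For coefficients in \<open>k\<close> on the sets of \<open>L\<close>, the general differential is the combinatorial coboundary.\<close>

lemma system_differential_additive:
  "system_differential (\<lambda>_. additive_group UNIV) (\<lambda>J j c. if J - {j} \<in> L then c else 0) \<phi> J
    = coboundary (restrict_to L \<phi>) J"
  by (simp add: system_differential_def finprod_additive sign_pow_additive coboundary_def
      restrict_to_def cosign_def)

locale graded_cech =
  fixes N :: "(int ^ 'd) set" and gs :: "(int ^ 'd) list" and k :: "'k::field itself" and p :: nat
  assumes submonoid_N: "add_submonoid N" and gs: "set gs \<subseteq> N"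
    and char_k: "CHAR('k) = p" and p_positive: "0 < p"
begin

abbreviation "R \<equiv> (monoid_ring N :: ((int ^ 'd) \<Rightarrow>\<^sub>0 'k) ring)"

abbreviation "xs \<equiv> map (\<lambda>g. Poly_Mapping.single g (1 :: 'k)) gs"

sublocale face_algebra "{()}" "\<lambda>_. N" R p
  using submonoid_N char_k p_positive by (rule face_algebra_monoid_ring)

sublocale cech_complex R p xs
proof
  show "set xs \<subseteq> carrier R" using gs by (auto simp: carrier_eq)
qed

lemma times_eq: "f \<otimes>\<^bsub>R\<^esub> g = f * g"
  by (simp add: monoid_ring_def)

lemma power_eq: "f [^]\<^bsub>R\<^esub> (n::nat) = f ^ n"
proof (induction n)
  case 0
  show ?case by (simp add: nat_pow_def) (simp add: monoid_ring_def)
next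
  case (Suc n)
  then show ?case by (simp add: nat_pow_def times_eq mult.commute)
qed

definition exponent :: "nat set \<Rightarrow> int ^ 'd"
  where "exponent I = (\<Sum>j\<in>I. gs ! j)"

lemma gs_nth: "j < length gs \<Longrightarrow> gs ! j \<in> N"
  using gs nth_mem by blast

lemma positions_eq: "positions = {..<length gs}"
  by simp

lemma exponent_mem: "I \<subseteq> {..<length gs} \<Longrightarrow> exponent I \<in> N"
  unfolding exponent_def using gs_nth by (intro submonoid_sum[OF submonoid_N]) auto

lemma denom_eq:
  assumes "I \<subseteq> {..<length gs}"
  shows "denom I = Poly_Mapping.single (exponent I) 1"
proof -
  have "finite I" using assms finite_subset by blast
  then show ?thesis using assms
  proof (induction I rule: finite_induct)
    case empty
    show ?case by (simp add: list_subprod_def exponent_def one_eq)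
  next
    case (insert j I)
    have "denom (insert j I) = xs ! j \<otimes>\<^bsub>R\<^esub> denom I"
      unfolding list_subprod_def using insert.hyps insert.prems nth_closed
      by (intro finprod_insert) auto
    then show ?case using insert by (simp add: times_eq mult_single exponent_def)
  qed
qed

lemma exponent_remove:
  assumes "J \<subseteq> {..<length gs}" "j \<in> J"
  shows "exponent J = exponent (J - {j}) + gs ! j"
proof -
  have "finite J" using assms(1) finite_subset by blast
  then show ?thesis using assms(2) by (simp add: exponent_def sum.remove add.commute)
qed

lemma denom_power: "I \<subseteq> {..<length gs} \<Longrightarrow> denom I [^]\<^bsub>R\<^esub> (n::nat) = Poly_Mapping.single (int n *s exponent I) 1"
  by (simp add: denom_eq power_eq single_power)

text \<open>The index sets at which the localization has a component of degree \<open>a\<close>.\<close>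

definition degree_family :: "int ^ 'd \<Rightarrow> nat set set"
  where "degree_family a = {I. I \<subseteq> {..<length gs} \<and> (\<exists>n. a + int n *s exponent I \<in> N)}"

text \<open>The element \<open>c X\<^sup>a\<close> of the localization at the product of the monomials in \<open>I\<close>. It is independent of the
  exponent \<open>n\<close> chosen to write it as a fraction.\<close>

definition monomial_fraction :: "int ^ 'd \<Rightarrow> nat set \<Rightarrow> 'k \<Rightarrow> (((int ^ 'd) \<Rightarrow>\<^sub>0 'k) \<times> nat) set"
  where "monomial_fraction a I c =
    (if I \<in> degree_family a
     then let n = (SOME n. a + int n *s exponent I \<in> N)
       in fraction R (denom I) (Poly_Mapping.single (a + int n *s exponent I) c) n
     else \<zero>\<^bsub>loc I\<^esub>)"

lemma degree_family_positions: "I \<in> degree_family a \<Longrightarrow> I \<subseteq> {..<length gs}"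
  by (simp add: degree_family_def)

lemma single_N: "a \<in> N \<Longrightarrow> Poly_Mapping.single a c \<in> carrier R"
  by (simp add: carrier_eq)

lemma monomial_fraction_eq:
  assumes I: "I \<subseteq> {..<length gs}" and n: "a + int n *s exponent I \<in> N"
  shows "monomial_fraction a I c = fraction R (denom I) (Poly_Mapping.single (a + int n *s exponent I) c) n"
proof -
  define m where "m = (SOME n. a + int n *s exponent I \<in> N)"
  have m: "a + int m *s exponent I \<in> N" unfolding m_def using n by (rule someI)
  have L: "I \<in> degree_family a" using I n unfolding degree_family_def by blast
  have "int n *s exponent I + (a + int m *s exponent I) = int m *s exponent I + (a + int n *s exponent I)"
    by (simp add: add_ac)
  then have "denom I [^]\<^bsub>R\<^esub> (0::nat) \<otimes>\<^bsub>R\<^esub> (denom I [^]\<^bsub>R\<^esub> n \<otimes>\<^bsub>R\<^esub> Poly_Mapping.single (a + int m *s exponent I) c)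
      = denom I [^]\<^bsub>R\<^esub> (0::nat) \<otimes>\<^bsub>R\<^esub> (denom I [^]\<^bsub>R\<^esub> m \<otimes>\<^bsub>R\<^esub> Poly_Mapping.single (a + int n *s exponent I) c)"
    using I by (simp only: denom_power times_eq mult_single)
  then have "fraction R (denom I) (Poly_Mapping.single (a + int m *s exponent I) c) m
      = fraction R (denom I) (Poly_Mapping.single (a + int n *s exponent I) c) n"
    using denom_closed[of I] I single_N[OF m] single_N[OF n]
    by (subst fraction_eq_iff) (simp_all only: positions_eq, blast)
  then show ?thesis using L unfolding monomial_fraction_def m_def[symmetric] Let_def by simp
qed

lemma monomial_fraction_cases:
  assumes "I \<in> degree_family a"
  obtains n where "a + int n *s exponent I \<in> N"
    "\<And>c. monomial_fraction a I c = fraction R (denom I) (Poly_Mapping.single (a + int n *s exponent I) c) n"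
  using assms monomial_fraction_eq that unfolding degree_family_def by blast

lemma monomial_fraction_outside: "I \<notin> degree_family a \<Longrightarrow> monomial_fraction a I c = \<zero>\<^bsub>loc I\<^esub>"
  by (simp add: monomial_fraction_def)

lemma loc_zero: "I \<subseteq> {..<length gs} \<Longrightarrow> \<zero>\<^bsub>loc I\<^esub> = fraction R (denom I) 0 n"
  using localization_zero[OF denom_closed[of I], of n] by (simp add: zero_eq)

lemma zero_carrier: "0 \<in> carrier R"
  by (simp add: carrier_eq)

lemma loc_zero_closed: "I \<subseteq> {..<length gs} \<Longrightarrow> \<zero>\<^bsub>loc I\<^esub> \<in> carrier (loc I)"
  using loc_zero fraction_closed[OF zero_carrier] by metis

lemma monomial_fraction_zero: "I \<subseteq> {..<length gs} \<Longrightarrow> monomial_fraction a I 0 = \<zero>\<^bsub>loc I\<^esub>"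
proof (cases "I \<in> degree_family a")
  case True
  assume I: "I \<subseteq> {..<length gs}"
  obtain n where "monomial_fraction a I 0 = fraction R (denom I) (Poly_Mapping.single (a + int n *s exponent I) 0) n"
    using monomial_fraction_cases[OF True] by metis
  then show ?thesis using loc_zero[OF I] by simp
qed (simp add: monomial_fraction_outside)

lemma monomial_fraction_closed:
  assumes I: "I \<subseteq> {..<length gs}"
  shows "monomial_fraction a I c \<in> carrier (loc I)"
proof (cases "I \<in> degree_family a")
  case True
  then show ?thesis using monomial_fraction_cases[OF True] fraction_closed[OF single_N] by metis
next
  case False
  then show ?thesis using loc_zero_closed[OF I] by (simp add: monomial_fraction_outside)
qed

lemma monomial_fraction_hom:
  assumes I: "I \<subseteq> {..<length gs}"
  shows "monomial_fraction a I \<in> hom (additive_group UNIV) (add_monoid (loc I))"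
proof (rule homI)
  fix c d :: 'k
  show "monomial_fraction a I c \<in> carrier (add_monoid (loc I))"
    using monomial_fraction_closed[OF I] by simp
  have f: "denom I \<in> carrier R" using denom_closed I by simp
  have "monomial_fraction a I (c + d) = monomial_fraction a I c \<oplus>\<^bsub>loc I\<^esub> monomial_fraction a I d"
  proof (cases "I \<in> degree_family a")
    case True
    obtain n where n: "a + int n *s exponent I \<in> N"
      "\<And>c. monomial_fraction a I c = fraction R (denom I) (Poly_Mapping.single (a + int n *s exponent I) c) n"
      using monomial_fraction_cases[OF True] by metis
    show ?thesis unfolding n(2) localization_add_common[OF f single_N[OF n(1)] single_N[OF n(1)]] add_eq
      by (simp add: single_add)
  next
    case False
    then show ?thesis
      using localization_add_common[OF f zero_carrier zero_carrier, of 0] loc_zero[OF I, of 0]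
      by (simp add: monomial_fraction_outside add_eq)
  qed
  then show "monomial_fraction a I (c \<otimes>\<^bsub>additive_group UNIV\<^esub> d)
      = monomial_fraction a I c \<otimes>\<^bsub>add_monoid (loc I)\<^esub> monomial_fraction a I d"
    by (simp add: additive_group_def)
qed

lemma coface_monomial_fraction:
  assumes J: "J \<subseteq> {..<length gs}" and j: "j \<in> J"
  shows "coface J j (monomial_fraction a (J - {j}) c)
    = monomial_fraction a J (if J - {j} \<in> degree_family a then c else 0)"
proof -
  have J': "J - {j} \<subseteq> {..<length gs}" using J by blast
  have jl: "j < length gs" using J j by auto
  show ?thesis
  proof (cases "J - {j} \<in> degree_family a")
    case True
    then obtain n where n: "a + int n *s exponent (J - {j}) \<in> N" unfolding degree_family_def by blast
    have s: "a + int n *s exponent J = (a + int n *s exponent (J - {j})) + int n *s (gs ! j)"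
      unfolding exponent_remove[OF J j] by (simp add: vec_eq_iff algebra_simps)
    have nJ: "a + int n *s exponent J \<in> N"
      unfolding s using n submonoid_add[OF submonoid_N] submonoid_smult[OF submonoid_N gs_nth[OF jl]] by blast
    have "coface J j (monomial_fraction a (J - {j}) c)
        = fraction R (denom J) (Poly_Mapping.single (a + int n *s exponent (J - {j})) c \<otimes>\<^bsub>R\<^esub> (xs ! j) [^]\<^bsub>R\<^esub> n) n"
      unfolding monomial_fraction_eq[OF J' n]
      using J by (intro coface_fraction[OF _ j single_N[OF n]]) simp
    also have "\<dots> = fraction R (denom J) (Poly_Mapping.single (a + int n *s exponent J) c) n"
      unfolding s using jl by (simp add: times_eq power_eq single_power mult_single)
    finally show ?thesis unfolding monomial_fraction_eq[OF J nJ] using True by simp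
  next
    case False
    have "coface J j (fraction R (denom (J - {j})) 0 0) = fraction R (denom J) (0 \<otimes>\<^bsub>R\<^esub> (xs ! j) [^]\<^bsub>R\<^esub> (0::nat)) 0"
      using J by (intro coface_fraction[OF _ j zero_carrier]) simp
    also have "\<dots> = fraction R (denom J) 0 0" by (simp add: times_eq)
    finally show ?thesis
      using False monomial_fraction_zero[OF J] loc_zero[OF J, of 0] loc_zero[OF J', of 0]
      by (simp add: monomial_fraction_outside)
  qed
qed

lemma frob_monomial_fraction:
  assumes I: "I \<in> degree_family a"
  shows "frob I (monomial_fraction a I c) = monomial_fraction (int p *s a) I (c ^ p)"
proof -
  have I': "I \<subseteq> {..<length gs}" by (rule degree_family_positions[OF I])
  obtain n where n: "a + int n *s exponent I \<in> N" using I unfolding degree_family_def by blast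
  have s: "int p *s a + int (n * p) *s exponent I = int p *s (a + int n *s exponent I)"
    by (simp add: vec_eq_iff algebra_simps)
  have np: "int p *s a + int (n * p) *s exponent I \<in> N"
    unfolding s by (rule submonoid_smult[OF submonoid_N n])
  show ?thesis
    unfolding monomial_fraction_eq[OF I' n] monomial_fraction_eq[OF I' np] s
    using I' frob_fraction[OF _ single_N[OF n]] by (simp add: power_eq single_power)
qed

text \<open>The coefficient of \<open>X\<^sup>a\<close> in an element of the localization, read off from any representing fraction.\<close>

definition coefficient :: "int ^ 'd \<Rightarrow> nat set \<Rightarrow> (((int ^ 'd) \<Rightarrow>\<^sub>0 'k) \<times> nat) set \<Rightarrow> 'k"
  where "coefficient a I S =
    the_elem (\<Union>(f, n)\<in>S. {Poly_Mapping.lookup f (a + int n *s exponent I)})"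

lemma coefficient_fraction:
  assumes I: "I \<subseteq> {..<length gs}" and f: "f \<in> carrier R"
  shows "coefficient a I (fraction R (denom I) f n) = Poly_Mapping.lookup f (a + int n *s exponent I)"
proof -
  have dc: "denom I \<in> carrier R" using denom_closed I by simp
  have "(\<Union>(f, n)\<in>fraction R (denom I) f n. {Poly_Mapping.lookup f (a + int n *s exponent I)})
      = {Poly_Mapping.lookup f (a + int n *s exponent I)}"
  proof (rule fraction_lift[OF dc f])
    fix g m assume "g \<in> carrier R"
    have "a + int (Suc m) *s exponent I = exponent I + (a + int m *s exponent I)"
      by (simp add: vec_eq_iff algebra_simps)
    then show "{Poly_Mapping.lookup (denom I \<otimes>\<^bsub>R\<^esub> g) (a + int (Suc m) *s exponent I)}
        = {Poly_Mapping.lookup g (a + int m *s exponent I)}"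
      by (simp only: times_eq denom_eq[OF I] lookup_single_times mult_1)
  qed
  then show ?thesis unfolding coefficient_def by simp
qed

lemma coefficient_hom:
  assumes I: "I \<subseteq> {..<length gs}"
  shows "coefficient a I \<in> hom (add_monoid (loc I)) (additive_group UNIV)"
proof (rule homI)
  have f: "denom I \<in> carrier R" using denom_closed I by simp
  fix x y assume "x \<in> carrier (add_monoid (loc I))" "y \<in> carrier (add_monoid (loc I))"
  then have xy: "x \<in> carrier (loc I)" "y \<in> carrier (loc I)" by simp_all
  obtain u v m where uv: "u \<in> carrier R" "v \<in> carrier R"
      "x = fraction R (denom I) u m" "y = fraction R (denom I) v m"
    using localization_cases2[OF f xy] .
  show "coefficient a I (x \<otimes>\<^bsub>add_monoid (loc I)\<^esub> y)
      = coefficient a I x \<otimes>\<^bsub>additive_group UNIV\<^esub> coefficient a I y"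
    using localization_add_common[OF f uv(1,2)] uv add_carrier[OF uv(1,2)]
    by (simp add: coefficient_fraction[OF I] additive_group_def add_eq lookup_add)
qed (simp add: additive_group_def)

lemma coefficient_outside:
  assumes I: "I \<subseteq> {..<length gs}" and "I \<notin> degree_family a" and x: "x \<in> carrier (loc I)"
  shows "coefficient a I x = 0"
proof -
  obtain f m where f: "f \<in> carrier R" "x = fraction R (denom I) f m" using localization_cases[OF x] .
  have "a + int m *s exponent I \<notin> N" using assms unfolding degree_family_def by blast
  then have "a + int m *s exponent I \<notin> Poly_Mapping.keys f" using f(1) unfolding carrier_eq by blast
  then show ?thesis unfolding f(2) coefficient_fraction[OF I f(1)] by (simp add: in_keys_iff)
qed

text \<open>With \<open>coface_monomial_fraction\<close>, this says that the part of degree \<open>a\<close> of the Cech complex is the cochain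
  complex of \<open>degree_family a\<close>, and a direct summand.\<close>

lemma coefficient_coface:
  assumes J: "J \<subseteq> {..<length gs}" and j: "j \<in> J" and x: "x \<in> carrier (loc (J - {j}))"
  shows "coefficient a J (coface J j x)
    = (if J - {j} \<in> degree_family a then coefficient a (J - {j}) x else 0)"
proof -
  have J': "J - {j} \<subseteq> {..<length gs}" using J by blast
  have jl: "j < length gs" using J j by auto
  obtain f m where f: "f \<in> carrier R" "x = fraction R (denom (J - {j})) f m" using localization_cases[OF x] .
  have g: "f \<otimes>\<^bsub>R\<^esub> (xs ! j) [^]\<^bsub>R\<^esub> m \<in> carrier R"
    using f(1) nth_closed[of j] jl by simp
  have s: "a + int m *s exponent J = int m *s (gs ! j) + (a + int m *s exponent (J - {j}))"
    unfolding exponent_remove[OF J j] by (simp add: vec_eq_iff algebra_simps)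
  have "coface J j x = fraction R (denom J) (f \<otimes>\<^bsub>R\<^esub> (xs ! j) [^]\<^bsub>R\<^esub> m) m"
    unfolding f(2) using J by (intro coface_fraction[OF _ j f(1)]) simp
  then have "coefficient a J (coface J j x)
      = Poly_Mapping.lookup (f \<otimes>\<^bsub>R\<^esub> (xs ! j) [^]\<^bsub>R\<^esub> m) (a + int m *s exponent J)"
    using coefficient_fraction[OF J g] by simp
  also have "f \<otimes>\<^bsub>R\<^esub> (xs ! j) [^]\<^bsub>R\<^esub> m = Poly_Mapping.single (int m *s (gs ! j)) 1 * f"
    using jl by (simp add: times_eq power_eq single_power mult.commute)
  finally have "coefficient a J (coface J j x) = coefficient a (J - {j}) x"
    unfolding s lookup_single_times f(2) coefficient_fraction[OF J' f(1)] by simp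
  then show ?thesis using coefficient_outside[OF J' _ x] by simp
qed

lemma coefficient_monomial_fraction:
  assumes "I \<in> degree_family a"
  shows "coefficient a I (monomial_fraction a I c) = c"
proof -
  obtain n where n: "a + int n *s exponent I \<in> N"
      "\<And>c. monomial_fraction a I c = fraction R (denom I) (Poly_Mapping.single (a + int n *s exponent I) c) n"
    using monomial_fraction_cases[OF assms] by metis
  show ?thesis
    unfolding n(2) coefficient_fraction[OF degree_family_positions[OF assms] single_N[OF n(1)]] by simp
qed

definition graded_cochain :: "int ^ 'd \<Rightarrow> nat \<Rightarrow> (nat set \<Rightarrow> 'k) \<Rightarrow> nat set \<Rightarrow> (((int ^ 'd) \<Rightarrow>\<^sub>0 'k) \<times> nat) set"
  where "graded_cochain a i \<phi> = (\<lambda>I\<in>position_sets xs i. monomial_fraction a I (\<phi> I))"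

lemma graded_cochain_closed: "graded_cochain a i \<phi> \<in> carrier (cochains i)"
  unfolding cochain_iff graded_cochain_def
  using position_sets_subset by (auto intro!: monomial_fraction_closed)

lemma differential_graded_cochain:
  assumes J: "J \<in> position_sets xs (Suc i)"
  shows "cech_differential R xs i (graded_cochain a i \<phi>) J
    = monomial_fraction a J (coboundary (restrict_to (degree_family a) \<phi>) J)"
proof -
  have JV: "J \<subseteq> {..<length gs}" using position_sets_subset[OF J] by simp
  let ?r = "\<lambda>J j c. if J - {j} \<in> degree_family a then c else (0::'k)"
  have "monomial_fraction a J (system_differential (\<lambda>_. additive_group UNIV) ?r \<phi> J)
      = system_differential (\<lambda>J. add_monoid (loc J)) coface (graded_cochain a i \<phi>) J"
  proof (rule system_differential_natural)
    show "comm_group (additive_group (UNIV :: 'k set))" by (rule comm_group_additive)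
    show "comm_group (add_monoid (loc J))" using JV by (intro comm_group_loc) simp
    show "monomial_fraction a J \<in> hom (additive_group UNIV) (add_monoid (loc J))"
      by (rule monomial_fraction_hom[OF JV])
    fix j assume j: "j \<in> J"
    show "?r J j (\<phi> (J - {j})) \<in> carrier (additive_group UNIV)" by (simp add: additive_group_def)
    show "monomial_fraction a J (?r J j (\<phi> (J - {j}))) = coface J j (graded_cochain a i \<phi> (J - {j}))"
      using coface_monomial_fraction[OF JV j] position_sets_remove[OF J j] by (simp add: graded_cochain_def)
  qed
  then show ?thesis
    using J unfolding differential_eq system_differential_additive by simp
qed

lemma coefficient_differential:
  assumes J: "J \<in> position_sets xs (Suc i)" and \<psi>: "\<psi> \<in> carrier (cochains i)"
  shows "coefficient a J (cech_differential R xs i \<psi> J)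
    = coboundary (restrict_to (degree_family a) (\<lambda>I. coefficient a I (\<psi> I))) J"
proof -
  have JV: "J \<subseteq> {..<length gs}" using position_sets_subset[OF J] by simp
  let ?r = "\<lambda>J j c. if J - {j} \<in> degree_family a then c else (0::'k)"
  have "coefficient a J (system_differential (\<lambda>J. add_monoid (loc J)) coface \<psi> J)
      = system_differential (\<lambda>_. additive_group UNIV) ?r (\<lambda>I. coefficient a I (\<psi> I)) J"
  proof (rule system_differential_natural)
    show "comm_group (additive_group (UNIV :: 'k set))" by (rule comm_group_additive)
    show "comm_group (add_monoid (loc J))" using JV by (intro comm_group_loc) simp
    show "coefficient a J \<in> hom (add_monoid (loc J)) (additive_group UNIV)"
      by (rule coefficient_hom[OF JV])
    fix j assume j: "j \<in> J"
    have \<psi>j: "\<psi> (J - {j}) \<in> carrier (loc (J - {j}))" by (rule cochain_closed[OF \<psi> position_sets_remove[OF J j]])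
    show "coface J j (\<psi> (J - {j})) \<in> carrier (add_monoid (loc J))"
      using coface_closed[OF position_sets_subset[OF J] j \<psi>j] by simp
    show "coefficient a J (coface J j (\<psi> (J - {j}))) = ?r J j (coefficient a (J - {j}) (\<psi> (J - {j})))"
      by (rule coefficient_coface[OF JV j \<psi>j])
  qed
  then show ?thesis
    using J unfolding differential_eq system_differential_additive by simp
qed

text \<open>The signs are fixed by the \<open>p\<close>-th power map since \<open>(-1)\<^sup>p = -1\<close> in characteristic \<open>p\<close>.\<close>

lemma coboundary_frobenius:
  fixes e :: "nat set \<Rightarrow> 'k"
  shows "coboundary (\<lambda>I. e I ^ p) J = coboundary e J ^ p"
proof -
  have minus: "(-1 :: 'k) ^ p = -1"
    using minus_power_prime_CHAR[of p "1 :: 'k"] prime_CHAR_semidom[where 'a='k] char_k p_positive by simp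
  have "(cosign j J :: 'k) ^ p = cosign j J" for j
    unfolding cosign_def using minus by (metis power_mult mult.commute)
  moreover have "(\<Sum>j\<in>J. f j) ^ p = (\<Sum>j\<in>J. f j ^ p)" for f :: "nat \<Rightarrow> 'k"
    using prime_CHAR_semidom[where 'a='k] char_k p_positive by (intro freshmans_dream_sum) simp_all
  ultimately show ?thesis by (simp add: coboundary_def power_mult_distrib)
qed

text \<open>A nontrivial cocycle \<open>e\<close> on \<open>\<B>\<close> has a coboundary \<open>\<delta>\<close> on \<open>\<A>\<close>. In degree \<open>a\<close>, where only \<open>\<A>\<close> is present, \<open>\<delta>\<close> is not a
  coboundary, by \<open>connecting_injective\<close>. The Frobenius raises coefficients to the \<open>p\<close>-th power and moves
  the class to degree \<open>p a\<close>, where \<open>\<B>\<close> is present as well and \<open>\<delta>\<^sup>p\<close> is the coboundary of \<open>e\<^sup>p\<close>.\<close>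

theorem frobenius_not_injective:
  assumes split: "split_family \<A> \<B>" and acyc: "acyclic_family k (\<A> \<union> \<B>)" and nacyc: "\<not> acyclic_family k \<B>"
    and La: "degree_family a = \<A>" and Lpa: "degree_family (int p *s a) = \<A> \<union> \<B>"
  shows "\<exists>i. \<not> inj_on (local_cohomology_frobenius R p xs i) (carrier (local_cohomology R xs i))"
proof -
  interpret split_family \<A> \<B> by (rule split)
  have posU: "\<A> \<union> \<B> \<subseteq> Pow {..<length gs}"
    unfolding Lpa[symmetric] using degree_family_positions by blast
  then have posB: "\<B> \<subseteq> Pow {..<length gs}" by blast
  obtain i and e :: "nat set \<Rightarrow> 'k" where e: "supported \<B> e" "\<And>I. card I \<noteq> i \<Longrightarrow> e I = 0"
      "\<And>J. J \<in> \<B> \<Longrightarrow> coboundary e J = 0" "\<nexists>\<psi>. supported \<B> \<psi> \<and> (\<forall>J\<in>\<B>. coboundary \<psi> J = e J)"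
    using homogeneous_nontrivial_cocycle[OF nacyc posB finite_lessThan] by metis
  have eU: "supported (\<A> \<union> \<B>) e" using e(1) by (auto simp: supported_def)
  define \<delta> where "\<delta> = restrict_to \<A> (coboundary e)"
  have \<delta>U: "\<delta> = restrict_to (\<A> \<union> \<B>) (coboundary e)"
    unfolding \<delta>_def restrict_to_def using e(3) by auto
  define c where "c = graded_cochain a (Suc i) \<delta>"
  have cc: "c \<in> carrier (cochains (Suc i))" unfolding c_def by (rule graded_cochain_closed)
  have cocycle: "c \<in> cech_cocycles R xs (Suc i)"
    unfolding cocycle_iff
  proof (intro conjI ballI cc)
    fix J assume J: "J \<in> position_sets xs (Suc (Suc i))"
    have JV: "J \<subseteq> {..<length gs}" using position_sets_subset[OF J] by simp
    have "restrict_to (degree_family a) \<delta> = \<delta>" unfolding La \<delta>_def by (auto simp: restrict_to_def)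
    then have d: "cech_differential R xs (Suc i) c J = monomial_fraction a J (coboundary \<delta> J)"
      unfolding c_def differential_graded_cochain[OF J] by simp
    show "cech_differential R xs (Suc i) c J = \<zero>\<^bsub>loc J\<^esub>"
    proof (cases "J \<in> degree_family a")
      case True
      then have "coboundary \<delta> J = 0"
        unfolding \<delta>U La using coboundary_restricted_coboundary[OF convex eU] by blast
      then show ?thesis unfolding d using monomial_fraction_zero[OF JV] by simp
    next
      case False
      then show ?thesis unfolding d by (rule monomial_fraction_outside)
    qed
  qed
  define b where "b = graded_cochain (int p *s a) i (\<lambda>I. e I ^ p)"
  have bc: "b \<in> carrier (cochains i)" unfolding b_def by (rule graded_cochain_closed)
  have Fc: "cech_frobenius R p xs (Suc i) c = cech_differential R xs i b"
  proof
    fix J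
    show "cech_frobenius R p xs (Suc i) c J = cech_differential R xs i b J"
    proof (cases "J \<in> position_sets xs (Suc i)")
      case True
      have JV: "J \<subseteq> {..<length gs}" using position_sets_subset[OF True] by simp
      have "restrict_to (degree_family (int p *s a)) (\<lambda>I. e I ^ p) = (\<lambda>I. e I ^ p)"
        unfolding Lpa restrict_to_def using eU p_positive by (auto simp: supported_def power_0_left)
      then have R': "cech_differential R xs i b J = monomial_fraction (int p *s a) J (coboundary e J ^ p)"
        unfolding b_def differential_graded_cochain[OF True] by (simp add: coboundary_frobenius)
      have L: "cech_frobenius R p xs (Suc i) c J = frob J (monomial_fraction a J (\<delta> J))"
        using True by (simp add: cech_frobenius_eq apply_endo_def c_def graded_cochain_def)
      show ?thesis
      proof (cases "J \<in> \<A>")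
        case A: True
        then have "\<delta> J = coboundary e J" by (simp add: \<delta>_def restrict_to_def)
        then show ?thesis unfolding L R' using frob_monomial_fraction[of J a] A La by simp
      next
        case False
        have "frob J (monomial_fraction a J (\<delta> J)) = frob J (fraction R (denom J) 0 0)"
          using monomial_fraction_outside[of J a] False La loc_zero[OF JV, of 0] by simp
        also have "\<dots> = fraction R (denom J) (0 [^]\<^bsub>R\<^esub> p) (0 * p)"
          using JV by (intro frob_fraction zero_carrier) simp
        also have "\<dots> = \<zero>\<^bsub>loc J\<^esub>"
          using loc_zero[OF JV, of 0] p_positive by (simp add: power_eq power_0_left)
        finally have L0: "cech_frobenius R p xs (Suc i) c J = \<zero>\<^bsub>loc J\<^esub>" unfolding L .
        show ?thesis
        proof (cases "J \<in> \<B>")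
          case True
          then show ?thesis
            unfolding L0 R' e(3)[OF True] using monomial_fraction_zero[OF JV] p_positive by (simp add: power_0_left)
        next
          case B: False
          then have "J \<notin> degree_family (int p *s a)" unfolding Lpa using False by blast
          then show ?thesis unfolding L0 R' by (simp add: monomial_fraction_outside)
        qed
      qed
    next
      case False
      then show ?thesis by (simp add: cech_frobenius_def cech_differential_def)
    qed
  qed
  define B where "B = cech_coboundaries R xs (Suc i)"
  interpret G: group "cochains (Suc i)" by (rule group_cochains)
  have FB: "cech_frobenius R p xs (Suc i) c \<in> B"
    unfolding Fc B_def cech_coboundaries_def using bc by simp
  let ?one = "\<one>\<^bsub>cochains (Suc i)\<^esub>"
  have one: "?one \<in> carrier (cochains (Suc i))" by (rule G.one_closed)
  have Fone: "cech_frobenius R p xs (Suc i) ?one = ?one"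
    unfolding cech_frobenius_eq by (rule hom_one[OF apply_endo_hom[OF natural_frob] group_cochains group_cochains])
  have FcC: "cech_frobenius R p xs (Suc i) c \<in> carrier (cochains (Suc i))"
    unfolding Fc by (rule differential_closed[OF bc])
  have eqF: "local_cohomology_frobenius R p xs (Suc i) (B #>\<^bsub>cochains (Suc i)\<^esub> c)
      = local_cohomology_frobenius R p xs (Suc i) (B #>\<^bsub>cochains (Suc i)\<^esub> ?one)"
    unfolding B_def frobenius_coset[OF cc] frobenius_coset[OF one] Fone coset_eq_iff[OF FcC one]
    using FB FcC unfolding B_def by (intro bexI[of _ "cech_frobenius R p xs (Suc i) c"]) simp_all
  have one_cocycle: "?one \<in> cech_cocycles R xs (Suc i)"
    using hom_one[OF differential_hom group_cochains group_cochains] one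
    by (simp add: cech_cocycles_def kernel_def)
  have "B #>\<^bsub>cochains (Suc i)\<^esub> c \<noteq> B #>\<^bsub>cochains (Suc i)\<^esub> ?one"
  proof
    assume "B #>\<^bsub>cochains (Suc i)\<^esub> c = B #>\<^bsub>cochains (Suc i)\<^esub> ?one"
    then obtain b' where b': "b' \<in> B" "c = b' \<otimes>\<^bsub>cochains (Suc i)\<^esub> ?one"
      unfolding B_def coset_eq_iff[OF cc one] by blast
    have "b' \<in> carrier (cochains (Suc i))"
      using b'(1) subgroup.subset[OF coboundaries_subgroup] unfolding B_def by blast
    then have "c \<in> B" using b' by simp
    then obtain \<psi> where \<psi>: "\<psi> \<in> carrier (cochains i)" "c = cech_differential R xs i \<psi>"
      unfolding B_def cech_coboundaries_def by auto
    define e' where "e' I = (if I \<in> position_sets xs i then coefficient a I (\<psi> I) else 0)" for I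
    have supp: "supported \<A> e'"
      unfolding supported_def
    proof (intro allI impI)
      fix I assume "I \<notin> \<A>"
      then show "e' I = 0"
        using coefficient_outside[of I a "\<psi> I"] position_sets_subset[of I i] cochain_closed[OF \<psi>(1), of I]
        by (simp add: e'_def La)
    qed
    have "coboundary e' J = coboundary e J" if J: "J \<in> \<A>" for J
    proof -
      have JV: "J \<subseteq> {..<length gs}" using J posU by blast
      then have fin: "finite J" using finite_subset by blast
      show ?thesis
      proof (cases "card J = Suc i")
        case True
        then have Jp: "J \<in> position_sets xs (Suc i)" using JV by (simp add: position_sets_def)
        have "coboundary e J = coefficient a J (c J)"
          using J Jp coefficient_monomial_fraction[of J a] La
          by (simp add: c_def graded_cochain_def \<delta>_def restrict_to_def)
        also have "\<dots> = coboundary (restrict_to (degree_family a) (\<lambda>I. coefficient a I (\<psi> I))) J"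
          unfolding \<psi>(2) by (rule coefficient_differential[OF Jp \<psi>(1)])
        also have "\<dots> = coboundary e' J"
        proof (rule coboundary_cong)
          fix j assume j: "j \<in> J"
          show "restrict_to (degree_family a) (\<lambda>I. coefficient a I (\<psi> I)) (J - {j}) = e' (J - {j})"
            using position_sets_remove[OF Jp j] supp
            by (auto simp: restrict_to_def e'_def La supported_def)
        qed
        finally show ?thesis by simp
      next
        case False
        have cj: "card (J - {j}) \<noteq> i" if "j \<in> J" for j
        proof -
          have "card J = Suc (card (J - {j}))" using fin that by (rule card.remove)
          then show ?thesis using False by simp
        qed
        have "coboundary e J = 0" by (rule coboundary_eq_0) (rule e(2)[OF cj])
        moreover have "coboundary e' J = 0"
          by (rule coboundary_eq_0) (use cj in \<open>simp add: e'_def position_sets_def\<close>)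
        ultimately show ?thesis by simp
      qed
    qed
    from connecting_injective[OF acyc e(1,3) supp this] e(4) show False by metis
  qed
  moreover have "B #>\<^bsub>cochains (Suc i)\<^esub> c \<in> carrier (local_cohomology R xs (Suc i))"
      "B #>\<^bsub>cochains (Suc i)\<^esub> ?one \<in> carrier (local_cohomology R xs (Suc i))"
    unfolding carrier_local_cohomology B_def using cocycle one_cocycle by blast+
  ultimately have "\<not> inj_on (local_cohomology_frobenius R p xs (Suc i)) (carrier (local_cohomology R xs (Suc i)))"
    using eqF by (meson inj_onD)
  then show ?thesis by blast
qed

end


section \<open>Torsion in the saturation quotients\<close>

definition has_torsion :: "nat \<Rightarrow> (int ^ 'd) set \<Rightarrow> (int ^ 'd) set \<Rightarrow> bool"
  where "has_torsion p A B \<longleftrightarrow> (\<exists>x\<in>group_closure A.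
    real_vec x \<in> span (real_vec ` B) \<and> int p *s x \<in> group_closure B \<and> x \<notin> group_closure B)"

lemma comm_group_additive_group:
  assumes "0 \<in> S" "\<And>x y. x \<in> S \<Longrightarrow> y \<in> S \<Longrightarrow> x + y \<in> S" "\<And>x. x \<in> S \<Longrightarrow> - x \<in> S"
  shows "comm_group (additive_group S)"
proof (rule comm_groupI)
  show "\<exists>y\<in>carrier (additive_group S). y \<otimes>\<^bsub>additive_group S\<^esub> x = \<one>\<^bsub>additive_group S\<^esub>"
    if "x \<in> carrier (additive_group S)" for x
    using assms that by (intro bexI[of _ "- x"]) (simp_all add: additive_group_def)
qed (use assms in \<open>simp_all add: additive_group_def add_ac\<close>)

lemma int_pow_additive_group:
  fixes S :: "(int ^ 'd) set"
  assumes "comm_group (additive_group S)" "x \<in> S" "\<And>x. x \<in> S \<Longrightarrow> - x \<in> S"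
  shows "x [^]\<^bsub>additive_group S\<^esub> (n::int) = n *s x"
proof -
  interpret comm_group "additive_group S" by fact
  have x: "x \<in> carrier (additive_group S)" using assms(2) by (simp add: additive_group_def)
  have nat: "x [^]\<^bsub>additive_group S\<^esub> (m::nat) = int m *s x" for m
  proof (induction m)
    case 0
    show ?case by (simp add: nat_pow_def) (simp add: additive_group_def)
  next
    case (Suc m)
    have "int (Suc m) *s x = int m *s x + x" by (simp add: vec_eq_iff algebra_simps)
    moreover have "x [^]\<^bsub>additive_group S\<^esub> Suc m = x [^]\<^bsub>additive_group S\<^esub> m + x"
      by (simp add: nat_pow_def) (simp add: additive_group_def)
    ultimately show ?case using Suc by simp
  qed
  have inv: "inv\<^bsub>additive_group S\<^esub> y = - y" if "y \<in> S" for y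
    using that assms(3) by (intro inv_equality) (simp_all add: additive_group_def)
  show ?thesis
  proof (cases "0 \<le> n")
    case True
    then show ?thesis using nat[of "nat n"] int_pow_int[of "additive_group S" x "nat n"] by simp
  next
    case False
    then have n: "n = - int (nat (- n))" by simp
    have "x [^]\<^bsub>additive_group S\<^esub> (nat (- n)) \<in> S"
      using nat_pow_closed[OF x, of "nat (- n)"] by (simp add: additive_group_def)
    then have "int (nat (- n)) *s x \<in> S" unfolding nat .
    then have "x [^]\<^bsub>additive_group S\<^esub> (- int (nat (- n))) = - (int (nat (- n)) *s x)"
      using int_pow_neg[OF x, of "int (nat (- n))"] int_pow_int[of "additive_group S" x "nat (- n)"] nat inv by simp
    moreover have "- (int (nat (- n)) *s x) = n *s x" using False by (simp add: vec_eq_iff)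
    ultimately show ?thesis using n by simp
  qed
qed

text \<open>The annihilator of a class is an ideal that contains \<open>p\<close> but not \<open>1\<close>, hence is \<open>(p)\<close> as \<open>p\<close> is prime.\<close>

lemma associated_prime_iff_torsion:
  assumes p: "Factorial_Ring.prime p" and BA: "B \<subseteq> A"
  shows "associated_prime \<Z> (saturation_quotient A B) (PIdl\<^bsub>\<Z>\<^esub> (int p)) \<longleftrightarrow> has_torsion p A B"
proof -
  define S where "S = {x \<in> group_closure A. real_vec x \<in> span (real_vec ` B)}"
  define K where "K = group_closure B"
  let ?G = "additive_group S"
  have S0: "0 \<in> S" by (simp add: S_def span_zero)
  have Sadd: "x + y \<in> S" if "x \<in> S" "y \<in> S" for x y
    using that by (simp add: S_def group_closure_add real_vec_add span_add)
  have Sminus: "- x \<in> S" if "x \<in> S" for x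
    using that by (simp add: S_def real_vec_uminus span_neg)
  have KS: "K \<subseteq> S"
    unfolding K_def
  proof (rule group_closure_least[OF S0])
    show "B \<subseteq> S"
    proof
      fix b assume b: "b \<in> B"
      then have "b \<in> group_closure A" using BA group_closure_subset[of A] by blast
      moreover have "real_vec b \<in> span (real_vec ` B)" by (rule span_base[OF imageI[OF b]])
      ultimately show "b \<in> S" by (simp add: S_def)
    qed
    show "x - y \<in> S" if "x \<in> S" "y \<in> S" for x y using Sadd[OF that(1) Sminus[OF that(2)]] by simp
  qed
  have cg: "comm_group ?G" using S0 Sadd Sminus by (rule comm_group_additive_group)
  interpret G: comm_group ?G by (rule cg)
  have inv: "inv\<^bsub>?G\<^esub> y = - y" if "y \<in> S" for y
    using that Sminus by (intro G.inv_equality) (simp_all add: additive_group_def)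
  have Ksub: "subgroup K ?G"
  proof (rule subgroup.intro)
    show "K \<subseteq> carrier ?G" using KS by (simp add: additive_group_def)
    show "x \<otimes>\<^bsub>?G\<^esub> y \<in> K" if "x \<in> K" "y \<in> K" for x y
      using that unfolding K_def by (simp add: additive_group_def group_closure_add)
    show "\<one>\<^bsub>?G\<^esub> \<in> K" by (simp add: additive_group_def K_def)
    show "inv\<^bsub>?G\<^esub> x \<in> K" if "x \<in> K" for x
      using that inv[of x] KS unfolding K_def by auto
  qed
  have normal: "normal K ?G" by (rule G.subgroup_imp_normal[OF Ksub])
  interpret N: normal K ?G by (rule normal)
  let ?c = "\<lambda>x. K #>\<^bsub>?G\<^esub> x"
  have quot: "saturation_quotient A B = int_module (?G Mod K)"
    by (simp add: saturation_quotient_def S_def K_def)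
  have carrierN: "carrier (saturation_quotient A B) = ?c ` S"
    by (simp add: quot int_module_def carrier_FactGroup) (simp add: additive_group_def)
  have smultN: "n \<odot>\<^bsub>saturation_quotient A B\<^esub> ?c x = ?c (n *s x)" if x: "x \<in> S" for n x
  proof -
    have xc: "x \<in> carrier ?G" using x by (simp add: additive_group_def)
    have "n \<odot>\<^bsub>saturation_quotient A B\<^esub> ?c x = ?c x [^]\<^bsub>?G Mod K\<^esub> n"
      by (simp add: quot int_module_def)
    also have "\<dots> = ?c (x [^]\<^bsub>?G\<^esub> n)"
      using hom_int_pow[OF N.r_coset_hom_Mod xc G.is_group N.factorgroup_is_group] by simp
    also have "x [^]\<^bsub>?G\<^esub> n = n *s x" by (rule int_pow_additive_group[OF cg x Sminus])
    finally show ?thesis .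
  qed
  have zeroN: "\<zero>\<^bsub>saturation_quotient A B\<^esub> = K" by (simp add: quot int_module_def)
  have Ssmult: "n *s x \<in> S" if "x \<in> S" for n x
    using that unfolding S_def by (simp add: group_closure_smult real_vec_smult span_scale)
  have ann: "n \<odot>\<^bsub>saturation_quotient A B\<^esub> ?c x = \<zero>\<^bsub>saturation_quotient A B\<^esub> \<longleftrightarrow> n *s x \<in> K" if x: "x \<in> S" for n x
  proof -
    have nx: "n *s x \<in> carrier ?G" using Ssmult[OF x] by (simp add: additive_group_def)
    show ?thesis unfolding smultN[OF x] zeroN
      using G.coset_join1[OF _ nx Ksub] G.coset_join2[OF nx Ksub] by blast
  qed
  have PIdl: "PIdl\<^bsub>\<Z>\<^esub> (int p) = {n. int p dvd n}"
    by (auto simp: cgenideal_def dvd_def mult.commute)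
  have prime: "primeideal (PIdl\<^bsub>\<Z>\<^esub> (int p)) \<Z>"
    using prime_primeideal[of "int p"] p int.cgenideal_eq_genideal[of "int p"] by simp
  show ?thesis
  proof
    assume "associated_prime \<Z> (saturation_quotient A B) (PIdl\<^bsub>\<Z>\<^esub> (int p))"
    then obtain x where x: "x \<in> S"
        "PIdl\<^bsub>\<Z>\<^esub> (int p) = {n. n \<odot>\<^bsub>saturation_quotient A B\<^esub> ?c x = \<zero>\<^bsub>saturation_quotient A B\<^esub>}"
      unfolding associated_prime_def carrierN by auto
    then have *: "int p dvd n \<longleftrightarrow> n *s x \<in> K" for n unfolding PIdl ann[OF x(1)] by blast
    have "\<not> int p dvd 1" using p not_prime_unit[of p] by auto
    then have "x \<notin> K" using *[of 1] by simp
    moreover have "int p *s x \<in> K" using *[of "int p"] by simp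
    ultimately show "has_torsion p A B" using x(1) unfolding has_torsion_def S_def K_def by blast
  next
    assume "has_torsion p A B"
    then obtain x where x: "x \<in> S" "int p *s x \<in> K" "x \<notin> K"
      unfolding has_torsion_def S_def K_def by blast
    have "int p dvd n \<longleftrightarrow> n *s x \<in> K" for n
    proof
      assume "int p dvd n"
      then obtain q where "n = q * int p" by (auto simp: dvd_def mult.commute)
      then have "n *s x = q *s (int p *s x)" by (simp add: vec_eq_iff)
      then show "n *s x \<in> K" using x(2) group_closure_smult unfolding K_def by metis
    next
      assume n: "n *s x \<in> K"
      show "int p dvd n"
      proof (rule ccontr)
        assume "\<not> int p dvd n"
        then have "coprime (int p) n" using p by (intro prime_imp_coprime) simp_all
        then obtain u v where "u * int p + v * n = 1"
          using bezout_int[of "int p" n] by (auto simp: coprime_iff_gcd_eq_1)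
        then have "x = (u * int p + v * n) *s x" by simp
        also have "\<dots> = u *s (int p *s x) + v *s (n *s x)" by (simp add: vec_eq_iff algebra_simps)
        also have "\<dots> \<in> K"
          using group_closure_add[OF group_closure_smult[OF x(2)[unfolded K_def]] group_closure_smult[OF n[unfolded K_def]]]
          unfolding K_def .
        finally show False using x(3) by simp
      qed
    qed
    then have "PIdl\<^bsub>\<Z>\<^esub> (int p) = {n. n \<odot>\<^bsub>saturation_quotient A B\<^esub> ?c x = \<zero>\<^bsub>saturation_quotient A B\<^esub>}"
      unfolding PIdl ann[OF x(1)] by blast
    then show "associated_prime \<Z> (saturation_quotient A B) (PIdl\<^bsub>\<Z>\<^esub> (int p))"
      unfolding associated_prime_def carrierN using prime x(1) by auto
  qed
qed

context seminormal_fan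
begin

lemma absorbing_element:
  assumes "D \<in> \<Sigma>"
  obtains m where "m \<in> M D" "interior_point D (real_vec m)"
    "\<And>x. x \<in> span (real_vec ` M D) \<Longrightarrow> \<exists>N::nat. real N *\<^sub>R real_vec m + x \<in> D"
proof -
  obtain m where m: "m \<in> M D"
      "\<And>x. x \<in> span (real_vec ` M D) \<Longrightarrow> \<exists>N::nat. real N *\<^sub>R real_vec m + x \<in> nonneg_span (M D)"
    by (rule sum_generators_absorbs[OF affine[OF assms]]) blast
  have "interior_point D (real_vec m)"
    unfolding interior_point_def
  proof (intro conjI ballI)
    show "real_vec m \<in> D" by (rule in_cone[OF assms m(1)])
    fix z assume "z \<in> D"
    then have "- z \<in> span (real_vec ` M D)"
      using nonneg_span_subset_span[of "M D"] span_monoid[OF assms] span_neg by blast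
    then show "\<exists>N::nat. real N *\<^sub>R real_vec m - z \<in> D"
      using m(2)[of "- z"] span_monoid[OF assms] by simp
  qed
  then show ?thesis using that m span_monoid[OF assms] by simp
qed

text \<open>Elements of the span of a face are moved into its interior by adding an element of its monoid. This
  leaves their classes modulo the group of the face unchanged.\<close>

lemma interior_translate:
  assumes D: "D \<in> \<Sigma>" and x: "real_vec x \<in> span (real_vec ` M D)"
  obtains m where "m \<in> M D" "interior_point D (real_vec (x + m))"
proof -
  obtain m where m: "m \<in> M D" "interior_point D (real_vec m)"
    "\<And>x. x \<in> span (real_vec ` M D) \<Longrightarrow> \<exists>N::nat. real N *\<^sub>R real_vec m + x \<in> D"
    using absorbing_element[OF D] by blast
  obtain N :: nat where N: "real N *\<^sub>R real_vec m + real_vec x \<in> D" using m(3)[OF x] by blast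
  have "interior_point D (real_vec m + (real N *\<^sub>R real_vec m + real_vec x))"
    by (rule interior_point_add[OF cone[OF D] m(2) N])
  moreover have "real_vec m + (real N *\<^sub>R real_vec m + real_vec x) = real_vec (x + int (Suc N) *s m)"
    by (simp only: real_vec_add real_vec_smult of_int_of_nat_eq) (simp add: algebra_simps)
  ultimately have "interior_point D (real_vec (x + int (Suc N) *s m))" by (simp only:)
  then show ?thesis by (rule that[OF submonoid_smult[OF submonoid[OF D] m(1)]])
qed

lemma interior_multiple:
  assumes D: "D \<in> \<Sigma>" and y: "interior_point D (real_vec y)" and n: "0 < n"
  shows "interior_point D (real_vec (int n *s y))"
proof -
  have "interior_point D (real_vec y + real (n - 1) *\<^sub>R real_vec y)"
    using y by (intro interior_point_add[OF cone[OF D] y] cone_scale[OF cone[OF D]]) (simp_all add: interior_point_def)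
  moreover have "real_vec y + real (n - 1) *\<^sub>R real_vec y = real_vec (int n *s y)"
    using n by (simp add: real_vec_smult of_nat_diff algebra_simps)
  ultimately show ?thesis by simp
qed

text \<open>A torsion element may be replaced by an interior translate \<open>x + m\<close>. Then \<open>p (x + m)\<close> belongs to the group of \<open>M D\<close>
  and is interior, so seminormality puts it into \<open>M D\<close>. Writing \<open>x + m = u - v\<close> and applying the
  hypothesis yields \<open>x + m \<in> M D\<close>.\<close>

lemma difference_closed_imp_no_torsion:
  assumes C: "C \<in> \<Sigma>" and D: "cone_face D C" and p: "0 < p"
    and diff: "\<And>u v. u \<in> M C \<Longrightarrow> v \<in> M C \<Longrightarrow> int p *s (u - v) \<in> M C \<Longrightarrow> u - v \<in> M C"
  shows "\<not> has_torsion p (M C) (M D)"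
proof
  have D\<Sigma>: "D \<in> \<Sigma>" by (rule face_in_fan[OF C D])
  assume "has_torsion p (M C) (M D)"
  then obtain x where x: "x \<in> group_closure (M C)" "real_vec x \<in> span (real_vec ` M D)"
      "int p *s x \<in> group_closure (M D)" "x \<notin> group_closure (M D)"
    unfolding has_torsion_def by blast
  obtain m where m: "m \<in> M D" "interior_point D (real_vec (x + m))"
    using interior_translate[OF D\<Sigma> x(2)] .
  have mC: "m \<in> M C" using m(1) face_monoid_subset[OF C D] by blast
  have mg: "m \<in> group_closure (M D)" using m(1) group_closure_subset by blast
  have "x + m \<in> group_closure (M C)" using x(1) mC group_closure_subset by (blast intro: group_closure_add)
  then obtain u v where uv: "u \<in> M C" "v \<in> M C" "x + m = u - v"
    using group_closure_submonoid[OF submonoid[OF C]] by blast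
  have "int p *s (x + m) = int p *s x + int p *s m" by (simp add: vec_eq_iff algebra_simps)
  then have "int p *s (x + m) \<in> group_closure (M D)"
    using x(3) mg group_closure_smult group_closure_add by metis
  then have "int p *s (x + m) \<in> M D"
    using interior_multiple[OF D\<Sigma> m(2) p] by (rule interior_in_monoid[OF D\<Sigma>])
  then have "x + m \<in> M C"
    using diff[OF uv(1,2)] face_monoid_subset[OF C D] unfolding uv(3) by blast
  moreover have "real_vec (x + m) \<in> D" using m(2) by (simp add: interior_point_def)
  ultimately have "x + m \<in> M D" using face_monoid[OF C D] by blast
  then have "(x + m) - m \<in> group_closure (M D)"
    using mg group_closure_subset by (blast intro: group_closure.diff)
  then show False using x(4) by simp
qed

text \<open>The root \<open>b' = e - a\<close> of \<open>b\<close> lies in the interior of the smallest face that contains \<open>b\<close>. Without torsion it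
  belongs to the group of that face, and by seminormality to its monoid.\<close>

lemma no_torsion_imp_root:
  assumes C: "C \<in> \<Sigma>" and no_torsion: "\<And>D. cone_face D C \<Longrightarrow> \<not> has_torsion p (M C) (M D)"
    and p: "0 < p" and ab: "a \<in> M C" "b \<in> M C" and e: "e \<in> M C" "int p *s a + b = int p *s e"
  shows "\<exists>b'\<in>M C. b = int p *s b'"
proof -
  define b' where "b' = e - a"
  have b': "b = int p *s b'" using e(2) by (simp add: b'_def vec_eq_iff algebra_simps)
  have bC: "real_vec b \<in> C" by (rule in_cone[OF C ab(2)])
  define D where "D = face_hull C (real_vec b)"
  have face: "cone_face D C" unfolding D_def by (rule cone_face_face_hull[OF rational[OF C] bC])
  have D\<Sigma>: "D \<in> \<Sigma>" by (rule face_in_fan[OF C face])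
  have int: "interior_point D (real_vec b)"
    unfolding D_def by (rule interior_point_face_hull[OF rational[OF C] bC])
  then have bD: "b \<in> M D" using face_monoid[OF C face] ab(2) by (auto simp: interior_point_def)
  have "real_vec b' = (1 / real p) *\<^sub>R real_vec b" using p unfolding b' by (simp add: real_vec_smult)
  moreover have "real_vec b \<in> span (real_vec ` M D)" using bD by (intro span_base imageI)
  ultimately have "real_vec b' \<in> span (real_vec ` M D)" by (simp add: span_scale)
  moreover have "b' \<in> group_closure (M C)"
    unfolding b'_def using ab(1) e(1) group_closure_subset by (blast intro: group_closure.diff)
  moreover have "int p *s b' \<in> group_closure (M D)" unfolding b'[symmetric] using bD group_closure_subset by blast
  ultimately have "b' \<in> group_closure (M D)" using no_torsion[OF face] unfolding has_torsion_def by blast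
  moreover have "interior_point D (real_vec b')"
  proof (rule interior_point_scale[OF cone[OF D\<Sigma>]])
    show "interior_point D (real p *\<^sub>R real_vec b')" using int unfolding b' real_vec_smult by simp
  qed (use p in simp)
  ultimately have "b' \<in> M D" by (rule interior_in_monoid[OF D\<Sigma>])
  then show ?thesis using b' face_monoid_subset[OF C face] by blast
qed

lemma face_span:
  assumes D: "cone_face D C" and S: "S \<subseteq> D" and y: "y \<in> C" "y \<in> span S"
  shows "y \<in> D"
proof -
  consider "D = C" | c where "D = C \<inter> {x. c \<bullet> x = 0}" using D unfolding cone_face_def by blast
  then show ?thesis
  proof cases
    case 2
    have "c \<bullet> y = 0" using y(2)
    proof (induction rule: span_induct_alt)
      case (step t x z)
      then show ?case using S 2 by (auto simp: inner_add_right)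
    qed simp
    then show ?thesis using 2 y(1) by simp
  qed (use y in simp)
qed

lemma face_algebra_toric:
  assumes "CHAR('k::field) = p" "0 < p"
  shows "face_algebra \<Sigma> M (toric_face_ring \<Sigma> M :: ((int ^ 'd) \<Rightarrow>\<^sub>0 'k) ring) p"
proof
  show "\<Sigma> \<noteq> {}" using fan by (simp add: rational_pointed_fan_def)
  show "a \<in> M j" if "i \<in> \<Sigma>" "j \<in> \<Sigma>" "a \<in> M i" "b \<in> M i" "a + b \<in> M j" for i j a b
    using that by (rule summand_in_monoid)
qed (use assms submonoid in \<open>simp_all add: toric_face_ring_def\<close>)

end

context graded_cech
begin

lemma ideal_monomial_ideal:
  assumes pointed: "\<And>a b. a \<in> N \<Longrightarrow> b \<in> N \<Longrightarrow> a + b = 0 \<Longrightarrow> a = 0"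
  shows "ideal (monomial_ideal R) R"
proof (rule idealI)
  show "ring R" by (rule ring_axioms)
  have carr: "f \<in> carrier R" if "f \<in> monomial_ideal R" for f using that by (simp add: monomial_ideal_def)
  have mult: "g * f \<in> monomial_ideal R" if f: "f \<in> monomial_ideal R" and g: "g \<in> carrier R" for f g
  proof -
    have gf: "g * f \<in> carrier R" using m_closed[OF g carr[OF f]] by (simp add: times_eq)
    have "0 \<notin> Poly_Mapping.keys (g * f)"
    proof
      assume "0 \<in> Poly_Mapping.keys (g * f)"
      then obtain a b where ab: "0 = a + b" "a \<in> Poly_Mapping.keys g" "b \<in> Poly_Mapping.keys f"
        using keys_mult[of g f] by blast
      have "a \<in> N" "b \<in> N" using ab(2,3) g carr[OF f] unfolding carrier_eq by blast+
      then have "b = 0" using pointed[of b a] ab(1) by (simp add: add.commute)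
      then show False using ab(3) f by (simp add: monomial_ideal_def)
    qed
    then show ?thesis using gf by (simp add: monomial_ideal_def)
  qed
  show "subgroup (monomial_ideal R) (add_monoid R)"
  proof (rule subgroup.intro)
    show "monomial_ideal R \<subseteq> carrier (add_monoid R)" using carr by auto
    show "\<one>\<^bsub>add_monoid R\<^esub> \<in> monomial_ideal R" using zero_carrier by (simp add: monomial_ideal_def zero_eq)
    show "f \<otimes>\<^bsub>add_monoid R\<^esub> g \<in> monomial_ideal R" if "f \<in> monomial_ideal R" "g \<in> monomial_ideal R" for f g
      using that add_carrier[OF carr[OF that(1)] carr[OF that(2)]]
      by (simp add: monomial_ideal_def add_eq in_keys_iff lookup_add)
    show "inv\<^bsub>add_monoid R\<^esub> f \<in> monomial_ideal R" if f: "f \<in> monomial_ideal R" for f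
    proof -
      have mf: "- f \<in> carrier R" using carr[OF f] by (simp add: carrier_eq)
      have "\<ominus>\<^bsub>R\<^esub> f = - f"
        by (rule minus_equality[OF _ carr[OF f] mf]) (simp add: add_eq zero_eq)
      then have "inv\<^bsub>add_monoid R\<^esub> f = - f" by (simp only: a_inv_def)
      moreover have "- f \<in> monomial_ideal R" using f mf by (simp add: monomial_ideal_def)
      ultimately show ?thesis by (simp only:)
    qed
  qed
  fix f g assume f: "f \<in> monomial_ideal R" and g: "g \<in> carrier R"
  show "g \<otimes>\<^bsub>R\<^esub> f \<in> monomial_ideal R" using mult[OF f g] by (simp add: times_eq)
  show "f \<otimes>\<^bsub>R\<^esub> g \<in> monomial_ideal R" using mult[OF f g] by (simp add: times_eq mult.commute)
qed

text \<open>Every nonconstant monomial is divisible by the monomial of a nonzero generator.\<close>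

lemma generated_monomial_ideal:
  assumes pointed: "\<And>a b. a \<in> N \<Longrightarrow> b \<in> N \<Longrightarrow> a + b = 0 \<Longrightarrow> a = 0"
    and nonzero: "0 \<notin> set gs"
    and split: "\<And>a. a \<in> N \<Longrightarrow> a \<noteq> 0 \<Longrightarrow> \<exists>g\<in>set gs. \<exists>b\<in>N. a = b + g"
  shows "Idl\<^bsub>R\<^esub> (set xs) = monomial_ideal R"
proof
  show "Idl\<^bsub>R\<^esub> (set xs) \<subseteq> monomial_ideal R"
  proof (rule genideal_minimal[OF ideal_monomial_ideal[OF pointed]])
    show "set xs \<subseteq> monomial_ideal R"
      using gs nonzero by (auto simp: monomial_ideal_def carrier_eq)
  qed
  interpret J: ideal "Idl\<^bsub>R\<^esub> (set xs)" R by (rule genideal_ideal[OF elements])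
  have mono: "Poly_Mapping.single a c \<in> Idl\<^bsub>R\<^esub> (set xs)" if a: "a \<in> N" "a \<noteq> 0" for a c
  proof -
    obtain g b where g: "g \<in> set gs" "b \<in> N" "a = b + g" using split[OF a] by blast
    have "Poly_Mapping.single g 1 \<in> Idl\<^bsub>R\<^esub> (set xs)" using genideal_self[OF elements] g(1) by auto
    from J.I_l_closed[OF this single_N[OF g(2)]] show ?thesis
      by (simp add: times_eq mult_single g(3))
  qed
  have zero: "0 \<in> Idl\<^bsub>R\<^esub> (set xs)"
    using additive_subgroup.zero_closed[OF J.additive_subgroup_axioms] by (simp add: zero_eq)
  have add: "f + g \<in> Idl\<^bsub>R\<^esub> (set xs)" if "f \<in> Idl\<^bsub>R\<^esub> (set xs)" "g \<in> Idl\<^bsub>R\<^esub> (set xs)" for f g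
    using additive_subgroup.a_closed[OF J.additive_subgroup_axioms that] by (simp add: add_eq)
  show "monomial_ideal R \<subseteq> Idl\<^bsub>R\<^esub> (set xs)"
  proof
    fix f assume f: "f \<in> monomial_ideal R"
    have "(\<Sum>a\<in>A. Poly_Mapping.single a (Poly_Mapping.lookup f a)) \<in> Idl\<^bsub>R\<^esub> (set xs)"
      if "finite A" "A \<subseteq> N - {0}" for A
      using that
    proof (induction A rule: finite_induct)
      case (insert a A)
      then show ?case using add[OF mono[of a]] by simp
    qed (use zero in simp)
    moreover have "Poly_Mapping.keys f \<subseteq> N - {0}"
      using f unfolding monomial_ideal_def carrier_eq by auto
    ultimately have "(\<Sum>a\<in>Poly_Mapping.keys f. Poly_Mapping.single a (Poly_Mapping.lookup f a)) \<in> Idl\<^bsub>R\<^esub> (set xs)"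
      using finite_keys by blast
    then show "f \<in> Idl\<^bsub>R\<^esub> (set xs)" unfolding poly_mapping_sum_single[symmetric] .
  qed
qed

end

context seminormal_fan
begin

text \<open>Choose a face \<open>D\<close> that is maximal among those with torsion and represent a torsion class by \<open>a\<close> with \<open>- a\<close> in
  the interior of \<open>D\<close>. In the Cech complex of the monomials of a generating set, let \<open>F(I)\<close> be the smallest
  face that contains the vertices in \<open>I\<close>. The degree \<open>p a\<close> occurs at \<open>I\<close> iff \<open>D \<subseteq> F(I)\<close>. The degree \<open>a\<close>
  occurs iff moreover \<open>a\<close> is in the group of \<open>F(I)\<close>; this excludes \<open>F(I) = D\<close>, where \<open>a\<close> is torsion,
  but by maximality of \<open>D\<close> no larger face. Therefore \<open>frobenius_not_injective\<close> applies with the families \<open>\<A>\<close> of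
  the sets with \<open>D \<subset> F(I)\<close> and \<open>\<B>\<close> of those with \<open>F(I) = D\<close>.\<close>

lemma F_injective_imp_no_torsion:
  assumes char: "CHAR('k::field) = p" and p: "0 < p" and C: "C \<in> \<Sigma>"
    and Finj: "F_injective p (monoid_ring (M C) :: ((int ^ 'd) \<Rightarrow>\<^sub>0 'k) ring)
      (monomial_ideal (monoid_ring (M C) :: ((int ^ 'd) \<Rightarrow>\<^sub>0 'k) ring))"
    and face0: "cone_face D0 C"
  shows "\<not> has_torsion p (M C) (M D0)"
proof
  assume torsion0: "has_torsion p (M C) (M D0)"
  have "finite {D \<in> \<Sigma>. cone_face D C \<and> has_torsion p (M C) (M D)}"
    using fan by (simp add: rational_pointed_fan_def)
  moreover have "{D \<in> \<Sigma>. cone_face D C \<and> has_torsion p (M C) (M D)} \<noteq> {}"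
    using face0 torsion0 face_in_fan[OF C] by blast
  ultimately obtain D where "D \<in> {D \<in> \<Sigma>. cone_face D C \<and> has_torsion p (M C) (M D)}"
      "\<And>E. E \<in> {D \<in> \<Sigma>. cone_face D C \<and> has_torsion p (M C) (M D)} \<Longrightarrow> D \<subseteq> E \<Longrightarrow> D = E"
    using finite_has_maximal by (metis (no_types, lifting))
  then have D: "D \<in> \<Sigma>" and faceD: "cone_face D C" and torsion: "has_torsion p (M C) (M D)"
    and maximal: "\<And>E. cone_face E C \<Longrightarrow> D \<subset> E \<Longrightarrow> \<not> has_torsion p (M C) (M E)"
    using face_in_fan[OF C] by blast+
  note coneC = cone[OF C]
  obtain x where x: "x \<in> group_closure (M C)" "real_vec x \<in> span (real_vec ` M D)"
      "int p *s x \<in> group_closure (M D)" "x \<notin> group_closure (M D)"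
    using torsion unfolding has_torsion_def by blast
  have "real_vec (- x) \<in> span (real_vec ` M D)" using x(2) by (simp add: real_vec_uminus span_neg)
  then obtain m where m: "m \<in> M D" "interior_point D (real_vec (- x + m))"
    using interior_translate[OF D] by blast
  have mg: "m \<in> group_closure (M D)" using m(1) group_closure_subset by blast
  define a where "a = x - m"
  have minus_a: "- a = - x + m" by (simp add: a_def)
  have inta: "interior_point D (real_vec (- a))" unfolding minus_a by (rule m(2))
  have pa: "int p *s a \<in> group_closure (M D)"
  proof -
    have "int p *s a = int p *s x - int p *s m" by (simp add: a_def vec_eq_iff algebra_simps)
    then show ?thesis using x(3) group_closure_smult[OF mg] group_closure.diff by metis
  qed
  have aD: "a \<notin> group_closure (M D)"
  proof
    assume "a \<in> group_closure (M D)"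
    from group_closure_add[OF this mg] show False using x(4) by (simp add: a_def)
  qed
  have a_span: "real_vec a \<in> span (real_vec ` M D)"
    unfolding a_def real_vec_diff by (rule span_diff[OF x(2) span_base[OF imageI[OF m(1)]]])

  obtain G where G: "finite G" "G \<subseteq> M C" "\<And>x. x \<in> M C \<Longrightarrow> \<exists>n. x = (\<Sum>g\<in>G. int (n g) *s g)"
    using affine_monoid_generators[OF affine[OF C]] by blast
  obtain gs where gl: "set gs = G - {0}" "distinct gs" using finite_distinct_list[of "G - {0}"] G(1) by auto
  note subC = submonoid[OF C] and subD = submonoid[OF D]
  interpret graded_cech "M C" gs "TYPE('k)" p
    using subC gl(1) G(2) char p by unfold_locales auto
  obtain H where H: "finite H" "C = {x. \<forall>a\<in>H. 0 \<le> a \<bullet> x}" using rational_coneE[OF rational[OF C]] by blast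
  define V where "V = {..<length gs}"
  define Y where "Y j = real_vec (gs ! j)" for j
  have gsC: "gs ! j \<in> M C" if "j \<in> V" for j using that gs_nth by (simp add: V_def)
  have YC: "Y j \<in> C" if "j \<in> V" for j unfolding Y_def by (rule in_cone[OF C gsC[OF that]])
  have gs0: "gs ! j \<noteq> 0" if "j \<in> V" for j using that nth_mem[of j gs] gl(1) by (auto simp: V_def)
  interpret cone_vertices H Y V
  proof
    show "finite H" "finite V" using H(1) by (simp_all add: V_def)
    show "0 \<le> a \<bullet> Y j" if "j \<in> V" "a \<in> H" for j a using YC[OF that(1)] that(2) unfolding H(2) by blast
  qed
  have combC: "\<exists>c. (\<forall>j\<in>V. 0 \<le> c j) \<and> y = (\<Sum>j\<in>V. c j *\<^sub>R Y j)" if y: "y \<in> C" for y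
  proof -
    obtain c where c: "\<forall>g\<in>G. 0 \<le> c g" "y = (\<Sum>g\<in>G. c g *\<^sub>R real_vec g)"
      using y span_monoid[OF C] nonneg_span_generators[OF G] by auto
    have "y = (\<Sum>g\<in>set gs. c g *\<^sub>R real_vec g)"
      unfolding c(2) gl(1) using G(1) by (intro sum.mono_neutral_right) auto
    also have "\<dots> = (\<Sum>j\<in>V. c (gs ! j) *\<^sub>R Y j)"
      unfolding Y_def V_def using bij_betw_nth[OF gl(2) refl refl]
      by (rule sum.reindex_bij_betw[symmetric])
    finally have "y = (\<Sum>j\<in>V. c (gs ! j) *\<^sub>R Y j)" .
    moreover have "\<forall>j\<in>V. 0 \<le> c (gs ! j)" using c(1) gl(1) nth_mem[of _ gs] by (auto simp: V_def)
    ultimately show ?thesis by (intro exI[of _ "\<lambda>j. c (gs ! j)"] conjI)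
  qed
  define W where "W = {j \<in> V. Y j \<in> D}"
  have WV: "W \<subseteq> V" by (simp add: W_def)
  have DC: "D \<subseteq> C" by (rule cone_face_subset[OF faceD])
  have combD: "\<exists>c. (\<forall>j\<in>W. 0 \<le> c j) \<and> y = (\<Sum>j\<in>W. c j *\<^sub>R Y j)" if y: "y \<in> D" for y
  proof -
    obtain c where c: "\<forall>j\<in>V. 0 \<le> c j" "y = (\<Sum>j\<in>V. c j *\<^sub>R Y j)" using combC y DC by blast
    have "c j = 0" if j: "j \<in> V" "j \<notin> W" for j
    proof (rule ccontr)
      assume "c j \<noteq> 0"
      then have cj: "0 < c j" using c(1) j(1) by (simp add: order_less_le)
      have "c j *\<^sub>R Y j + (\<Sum>i\<in>V - {j}. c i *\<^sub>R Y i) = y"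
        unfolding c(2) using finite_V j(1) by (simp add: sum.remove)
      moreover have "c j *\<^sub>R Y j \<in> C" using c(1) j(1) YC by (intro cone_scale[OF coneC]) auto
      moreover have "(\<Sum>i\<in>V - {j}. c i *\<^sub>R Y i) \<in> C"
        using c(1) YC by (intro cone_sum[OF coneC] cone_scale[OF coneC]) auto
      ultimately have "c j *\<^sub>R Y j \<in> D" using cone_face_left[OF faceD] y by metis
      from cone_scale[OF cone[OF D] this, of "1 / c j"] cj have "Y j \<in> D" by simp
      then show False using j by (simp add: W_def)
    qed
    then have "y = (\<Sum>j\<in>W. c j *\<^sub>R Y j)"
      unfolding c(2) using finite_V WV by (intro sum.mono_neutral_right) auto
    then show ?thesis using c(1) WV by blast
  qed
  have spansV: "spans_face V"
    unfolding spans_face_def using combC unfolding H(2) by blast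
  have spansW: "spans_face W"
    unfolding spans_face_def
  proof (intro conjI ballI impI WV)
    fix y assume y: "y \<in> span (Y ` W)" "\<forall>a\<in>H. 0 \<le> a \<bullet> y"
    have "y \<in> C" using y(2) unfolding H(2) by blast
    moreover have "Y ` W \<subseteq> D" by (auto simp: W_def)
    ultimately have "y \<in> D" using face_span[OF faceD _ _ y(1)] by blast
    then show "\<exists>c. (\<forall>j\<in>W. 0 \<le> c j) \<and> y = (\<Sum>j\<in>W. c j *\<^sub>R Y j)" by (rule combD)
  qed
  have Y_pointed: "\<exists>a\<in>H. 0 < a \<bullet> Y j" if j: "j \<in> V" for j
  proof (rule ccontr)
    assume "\<not> ?thesis"
    then have "- Y j \<in> C" unfolding H(2) by (auto simp: not_less)
    then have "Y j = 0" using pointed_cone_antisym[OF pointed[OF C] YC[OF j]] by blast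
    then show False using gs0[OF j] unfolding Y_def by (metis real_vec_eq_iff real_vec_zero)
  qed
  \<comment> \<open>Applied both to \<open>a\<close> and to \<open>p a\<close>: the signs of the functionals at minus an interior point of \<open>D\<close>.\<close>
  have neg: "l \<bullet> real_vec b < 0 \<longleftrightarrow> (\<exists>j\<in>W. 0 < l \<bullet> Y j)"
    if l: "l \<in> H" and b: "interior_point D (real_vec (- b))" for l b
  proof
    assume "l \<bullet> real_vec b < 0"
    then have pos: "0 < l \<bullet> real_vec (- b)" by (simp add: real_vec_uminus)
    have "real_vec (- b) \<in> D" using b by (simp add: interior_point_def)
    then obtain c where c: "\<forall>j\<in>W. 0 \<le> c j" "real_vec (- b) = (\<Sum>j\<in>W. c j *\<^sub>R Y j)" using combD by blast
    show "\<exists>j\<in>W. 0 < l \<bullet> Y j"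
    proof (rule ccontr)
      assume "\<not> ?thesis"
      then have "(\<Sum>j\<in>W. c j * (l \<bullet> Y j)) \<le> 0"
        using c(1) by (intro sum_nonpos mult_nonneg_nonpos) (auto simp: not_less)
      then show False using pos unfolding c(2) by (simp add: inner_sum_right)
    qed
  next
    assume "\<exists>j\<in>W. 0 < l \<bullet> Y j"
    then obtain j where j: "j \<in> W" "0 < l \<bullet> Y j" by blast
    then obtain K :: nat where "real K *\<^sub>R real_vec (- b) - Y j \<in> D"
      using b unfolding interior_point_def W_def by blast
    then have "real K *\<^sub>R real_vec (- b) - Y j \<in> C" using DC by blast
    then have "0 \<le> l \<bullet> (real K *\<^sub>R real_vec (- b) - Y j)" using l unfolding H(2) by blast
    then have "0 < real K * (l \<bullet> real_vec (- b))" using j(2) by (simp add: inner_diff_right)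
    then have "0 < l \<bullet> real_vec (- b)" by (simp add: zero_less_mult_iff)
    then show "l \<bullet> real_vec b < 0" by (simp add: real_vec_uminus)
  qed
  have DneC: "D \<noteq> C"
  proof
    assume "D = C"
    then show False using x(1,4) by simp
  qed
  \<comment> \<open>Otherwise \<open>- a\<close> would be interior in \<open>C\<close> too, and all vertices would lie in \<open>D\<close>.\<close>
  have "\<exists>l\<in>H. (\<exists>j\<in>V. 0 < l \<bullet> Y j) \<and> (\<forall>j\<in>W. l \<bullet> Y j = 0)"
  proof (rule ccontr)
    assume none: "\<not> ?thesis"
    have YD: "Y j \<in> D" if j: "j \<in> V" for j
    proof -
      let ?y = "real_vec (- a)"
      have yD: "?y \<in> D" using inta by (simp add: interior_point_def)
      have "\<exists>K::nat. real K *\<^sub>R ?y + - Y j \<in> C"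
      proof (rule half_spaces_absorb[OF H])
        show "?y \<in> C" using yD DC by blast
        fix l assume l: "l \<in> H" "l \<bullet> ?y = 0"
        have nn: "0 \<le> l \<bullet> Y i" if "i \<in> V" for i by (rule vertex_nonneg[OF that l(1)])
        have "\<not> (\<exists>i\<in>W. 0 < l \<bullet> Y i)" using neg[OF l(1) inta] l(2) by (simp add: real_vec_uminus)
        then have "\<forall>i\<in>W. l \<bullet> Y i = 0" using nn WV by (meson not_less order_antisym subsetD)
        then have "\<not> 0 < l \<bullet> Y j" using none l(1) j by blast
        then show "0 \<le> l \<bullet> (- Y j)" by simp
      qed
      then obtain K :: nat where K: "real K *\<^sub>R ?y - Y j \<in> C" by auto
      have "real K *\<^sub>R ?y \<in> D" using yD by (intro cone_scale[OF cone[OF D]]) simp_all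
      then show ?thesis using cone_face_left[OF faceD YC[OF j] K] by simp
    qed
    have "C \<subseteq> D"
    proof
      fix y assume "y \<in> C"
      then obtain c where "\<forall>j\<in>V. 0 \<le> c j" "y = (\<Sum>j\<in>V. c j *\<^sub>R Y j)" using combC by blast
      then show "y \<in> D" using YD by (auto intro!: cone_sum[OF cone[OF D]] cone_scale[OF cone[OF D]])
    qed
    then show False using DC DneC by blast
  qed
  then obtain l j where l: "l \<in> H" "j \<in> V" "0 < l \<bullet> Y j" "\<And>i. i \<in> W \<Longrightarrow> l \<bullet> Y i = 0" by blast
  define \<A> where "\<A> = {I \<in> meeting W V. \<not> I \<subseteq> W}"
  define \<B> where "\<B> = meeting W W"
  have union: "\<A> \<union> \<B> = meeting W V" unfolding \<A>_def \<B>_def by (rule meeting_union[OF WV])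
  have split: "split_family \<A> \<B>" unfolding \<A>_def \<B>_def by (rule split_meeting[OF WV order_refl])
  have acyc: "acyclic_family TYPE('k) (\<A> \<union> \<B>)" unfolding union by (rule acyclic_meeting[OF spansV WV l])
  have nacyc: "\<not> acyclic_family TYPE('k) \<B>" unfolding \<B>_def by (rule not_acyclic_meeting[OF spansW Y_pointed])

  have exponent_real: "real_vec (exponent I) = (\<Sum>j\<in>I. Y j)" for I
    by (simp add: exponent_def real_vec_sum Y_def)
  have sub_meeting: "degree_family b \<subseteq> meeting W V" if b: "interior_point D (real_vec (- b))" for b
  proof
    fix I assume "I \<in> degree_family b"
    then obtain n where I: "I \<subseteq> V" "b + int n *s exponent I \<in> M C" unfolding degree_family_def V_def by blast
    have "real_vec (b + int n *s exponent I) \<in> C" by (rule in_cone[OF C I(2)])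
    then have inC: "real_vec b + real n *\<^sub>R (\<Sum>j\<in>I. Y j) \<in> C"
      by (simp add: real_vec_add real_vec_smult exponent_real)
    have "\<exists>j\<in>I. 0 < l \<bullet> Y j" if l: "l \<in> H" "\<exists>j\<in>W. 0 < l \<bullet> Y j" for l
    proof (rule ccontr)
      assume "\<not> ?thesis"
      then have "(\<Sum>j\<in>I. l \<bullet> Y j) \<le> 0" by (intro sum_nonpos) (auto simp: not_less)
      then have "real n * (\<Sum>j\<in>I. l \<bullet> Y j) \<le> 0" by (intro mult_nonneg_nonpos) simp_all
      moreover have "l \<bullet> real_vec b < 0" using neg[OF l(1) b] l(2) by blast
      moreover have "0 \<le> l \<bullet> (real_vec b + real n *\<^sub>R (\<Sum>j\<in>I. Y j))" using inC l(1) unfolding H(2) by blast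
      ultimately show False by (simp add: inner_add_right inner_sum_right)
    qed
    then show "I \<in> meeting W V" using I(1) unfolding meeting_def by blast
  qed
  have meeting_sub: "I \<in> degree_family b"
    if b: "interior_point D (real_vec (- b))" and I: "I \<in> meeting W V"
      and gc: "b \<in> group_closure (M (face_hull C (real_vec (exponent I))))" for b I
  proof -
    have IV: "I \<subseteq> V" using I unfolding meeting_def by blast
    have eC: "exponent I \<in> M C" using IV exponent_mem by (simp add: V_def)
    have yC: "real_vec (exponent I) \<in> C" by (rule in_cone[OF C eC])
    define F where "F = face_hull C (real_vec (exponent I))"
    have F: "cone_face F C" unfolding F_def by (rule cone_face_face_hull[OF rational[OF C] yC])
    have F\<Sigma>: "F \<in> \<Sigma>" by (rule face_in_fan[OF C F])
    have yF: "real_vec (exponent I) \<in> F" unfolding F_def by (rule in_face_hull[OF coneC yC])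
    have intF: "interior_point F (real_vec (exponent I))"
      unfolding F_def by (rule interior_point_face_hull[OF rational[OF C] yC])
    have hit: "\<exists>j\<in>I. 0 < l \<bullet> Y j" if "l \<in> H" "l \<bullet> real_vec b < 0" for l
      using I neg[OF that(1) b] that unfolding meeting_def by blast
    have "\<exists>n. \<forall>l\<in>H. 0 \<le> l \<bullet> (real_vec b + real n *\<^sub>R (\<Sum>j\<in>I. Y j))"
      using eventually_happens'[OF sequentially_bot eventually_in_cone[OF IV hit]] .
    then obtain n where n: "real_vec b + real n *\<^sub>R real_vec (exponent I) \<in> C"
      unfolding H(2) exponent_real by blast
    have mbC: "real_vec (- b) \<in> C" using b DC by (auto simp: interior_point_def)
    have "(real_vec b + real n *\<^sub>R real_vec (exponent I)) + real_vec (- b) = real n *\<^sub>R real_vec (exponent I)"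
      by (simp add: real_vec_uminus)
    moreover have "real n *\<^sub>R real_vec (exponent I) \<in> F" using yF by (intro cone_scale[OF cone[OF F\<Sigma>]]) simp_all
    ultimately have "(real_vec b + real n *\<^sub>R real_vec (exponent I)) + real_vec (- b) \<in> F" by (simp only:)
    then have nF: "real_vec b + real n *\<^sub>R real_vec (exponent I) \<in> F" by (rule cone_face_left[OF F n mbC])
    have "interior_point F (real_vec (exponent I) + (real_vec b + real n *\<^sub>R real_vec (exponent I)))"
      by (rule interior_point_add[OF cone[OF F\<Sigma>] intF nF])
    moreover have "real_vec (exponent I) + (real_vec b + real n *\<^sub>R real_vec (exponent I))
        = real_vec (b + int (Suc n) *s exponent I)"
      by (simp only: real_vec_add real_vec_smult of_int_of_nat_eq) (simp add: algebra_simps)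
    ultimately have int: "interior_point F (real_vec (b + int (Suc n) *s exponent I))" by simp
    have "exponent I \<in> M F" using face_monoid[OF C F] eC yF by blast
    then have "b + int (Suc n) *s exponent I \<in> group_closure (M F)"
      using gc group_closure_subset[of "M F"] unfolding F_def[symmetric]
      by (intro group_closure_add group_closure_smult) blast+
    then have "b + int (Suc n) *s exponent I \<in> M F" using int by (rule interior_in_monoid[OF F\<Sigma>])
    then have "b + int (Suc n) *s exponent I \<in> M C" using face_monoid_subset[OF C F] by blast
    then show ?thesis using IV unfolding degree_family_def V_def by blast
  qed
  have D_sub_hull: "D \<subseteq> face_hull C (real_vec (exponent I))" if I: "I \<in> meeting W V" for I
  proof
    fix z assume z: "z \<in> D"
    have IV: "I \<subseteq> V" using I unfolding meeting_def by blast
    have hit: "\<exists>j\<in>I. 0 < l \<bullet> Y j" if l: "l \<in> H" "l \<bullet> (- z) < 0" for l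
    proof -
      obtain c where c: "\<forall>j\<in>W. 0 \<le> c j" "z = (\<Sum>j\<in>W. c j *\<^sub>R Y j)" using combD[OF z] by blast
      have "\<exists>j\<in>W. 0 < l \<bullet> Y j"
      proof (rule ccontr)
        assume "\<not> ?thesis"
        then have "(\<Sum>j\<in>W. c j * (l \<bullet> Y j)) \<le> 0"
          using c(1) by (intro sum_nonpos mult_nonneg_nonpos) (auto simp: not_less)
        then show False using l(2) unfolding c(2) by (simp add: inner_sum_right)
      qed
      then show ?thesis using I l(1) unfolding meeting_def by blast
    qed
    have "\<exists>n. \<forall>l\<in>H. 0 \<le> l \<bullet> (- z + real n *\<^sub>R (\<Sum>j\<in>I. Y j))"
      using eventually_happens'[OF sequentially_bot eventually_in_cone[OF IV hit]] .
    then obtain n where "- z + real n *\<^sub>R real_vec (exponent I) \<in> C"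
      unfolding H(2) exponent_real by blast
    then have "real n *\<^sub>R real_vec (exponent I) - z \<in> C" by (simp add: algebra_simps)
    then show "z \<in> face_hull C (real_vec (exponent I))" using z DC unfolding face_hull_def by blast
  qed
  have hull_face: "cone_face (face_hull C (real_vec (exponent I))) C" if "I \<in> meeting W V" for I
  proof (rule cone_face_face_hull[OF rational[OF C]])
    have "I \<subseteq> V" using that unfolding meeting_def by blast
    then show "real_vec (exponent I) \<in> C" using exponent_mem[of I] in_cone[OF C] by (simp add: V_def)
  qed
  have M_hull: "M D \<subseteq> M (face_hull C (real_vec (exponent I)))" if "I \<in> meeting W V" for I
    using face_monoid[OF C faceD] face_monoid[OF C hull_face[OF that]] D_sub_hull[OF that] by blast
  have intpa: "interior_point D (real_vec (- (int p *s a)))"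
  proof -
    have "- (int p *s a) = int p *s (- a)" by (simp add: vec_eq_iff)
    then show ?thesis using interior_multiple[OF D inta p] by simp
  qed
  have Lpa: "degree_family (int p *s a) = \<A> \<union> \<B>"
    unfolding union
  proof
    show "degree_family (int p *s a) \<subseteq> meeting W V" by (rule sub_meeting[OF intpa])
    show "meeting W V \<subseteq> degree_family (int p *s a)"
    proof
      fix I assume I: "I \<in> meeting W V"
      show "I \<in> degree_family (int p *s a)"
        using pa group_closure_mono[OF M_hull[OF I]] by (intro meeting_sub[OF intpa I]) blast
    qed
  qed
  have La: "degree_family a = \<A>"
  proof
    show "\<A> \<subseteq> degree_family a"
    proof
      fix I assume "I \<in> \<A>"
      then have I: "I \<in> meeting W V" and notW: "\<not> I \<subseteq> W" by (simp_all add: \<A>_def)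
      have IV: "I \<subseteq> V" using I unfolding meeting_def by blast
      define F where "F = face_hull C (real_vec (exponent I))"
      have F: "cone_face F C" unfolding F_def by (rule hull_face[OF I])
      obtain i where i: "i \<in> I" "i \<notin> W" using notW by blast
      have "Y i \<in> F"
      proof -
        have fin: "finite I" using IV finite_V finite_subset by blast
        have iV: "i \<in> V" using i(1) IV by blast
        have "Y i + (\<Sum>j\<in>I - {i}. Y j) = real_vec (exponent I)"
          unfolding exponent_real using fin i(1) by (simp add: sum.remove)
        moreover have "(\<Sum>j\<in>I - {i}. Y j) \<in> C" using YC IV by (intro cone_sum[OF coneC]) blast
        moreover have "real_vec (exponent I) \<in> F"
          unfolding F_def using IV exponent_mem[of I] in_cone[OF C] by (intro in_face_hull[OF coneC]) (simp add: V_def)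
        ultimately show ?thesis using cone_face_left[OF F YC[OF iV]] by simp
      qed
      moreover have "Y i \<notin> D" using i IV by (auto simp: W_def)
      ultimately have DF: "D \<subset> F" using D_sub_hull[OF I] unfolding F_def by blast
      have MF: "M D \<subseteq> M F" unfolding F_def by (rule M_hull[OF I])
      have "real_vec x \<in> span (real_vec ` M F)" using x(2) span_mono[OF image_mono[OF MF]] by blast
      moreover have "int p *s x \<in> group_closure (M F)" using x(3) group_closure_mono[OF MF] by blast
      ultimately have "x \<in> group_closure (M F)"
        using maximal[OF F DF] x(1) unfolding has_torsion_def by blast
      moreover have "m \<in> group_closure (M F)" using mg group_closure_mono[OF MF] by blast
      ultimately have "a \<in> group_closure (M F)" unfolding a_def by (rule group_closure.diff)
      then show "I \<in> degree_family a" unfolding F_def by (rule meeting_sub[OF inta I])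
    qed
    show "degree_family a \<subseteq> \<A>"
    proof
      fix I assume I: "I \<in> degree_family a"
      then obtain n where n: "I \<subseteq> V" "a + int n *s exponent I \<in> M C" unfolding degree_family_def V_def by blast
      have "\<not> I \<subseteq> W"
      proof
        assume IW: "I \<subseteq> W"
        have "gs ! j \<in> M D" if "j \<in> I" for j
          using face_monoid[OF C faceD] gsC[of j] IW WV that by (auto simp: W_def Y_def)
        then have eD: "exponent I \<in> M D" unfolding exponent_def by (rule submonoid_sum[OF subD])
        have "real_vec (a + int n *s exponent I) \<in> span (real_vec ` M D)"
          unfolding real_vec_add real_vec_smult
          by (rule span_add[OF a_span span_scale[OF span_base[OF imageI[OF eD]]]])
        moreover have "real_vec ` M D \<subseteq> D" by (rule monoid_subset[OF D])
        ultimately have "real_vec (a + int n *s exponent I) \<in> D"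
          using face_span[OF faceD _ in_cone[OF C n(2)]] by blast
        then have "a + int n *s exponent I \<in> group_closure (M D)"
          using face_monoid[OF C faceD] n(2) group_closure_subset[of "M D"] by blast
        moreover have "int n *s exponent I \<in> group_closure (M D)"
          using eD group_closure_subset[of "M D"] by (intro group_closure_smult) blast
        ultimately have "(a + int n *s exponent I) - int n *s exponent I \<in> group_closure (M D)"
          by (rule group_closure.diff)
        then show False using aD by simp
      qed
      then show "I \<in> \<A>" using sub_meeting[OF inta] I by (auto simp: \<A>_def)
    qed
  qed
  obtain i where ninj: "\<not> inj_on (local_cohomology_frobenius R p xs i) (carrier (local_cohomology R xs i))"
    using frobenius_not_injective[OF split acyc nacyc La Lpa] by blast
  have "Idl\<^bsub>R\<^esub> (set xs) = monomial_ideal R"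
  proof (rule generated_monomial_ideal)
    show "a = 0" if "a \<in> M C" "b \<in> M C" "a + b = 0" for a b using that by (rule sum_eq_zero[OF C])
    show "0 \<notin> set gs" by (simp add: gl(1))
    fix b assume b: "b \<in> M C" "b \<noteq> 0"
    obtain n where n: "b = (\<Sum>g\<in>G. int (n g) *s g)" using G(3)[OF b(1)] by blast
    have "\<exists>g\<in>G. int (n g) *s g \<noteq> 0"
    proof (rule ccontr)
      assume "\<not> ?thesis"
      then have "b = 0" unfolding n by (intro sum.neutral) blast
      then show False using b(2) by simp
    qed
    then obtain g where g: "g \<in> G" "int (n g) *s g \<noteq> 0" by blast
    have ng: "0 < n g" and g0: "g \<noteq> 0" using g(2) by (auto intro: Nat.gr0I)
    define b' where "b' = int (n g - 1) *s g + (\<Sum>h\<in>G - {g}. int (n h) *s h)"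
    have "b = int (n g) *s g + (\<Sum>h\<in>G - {g}. int (n h) *s h)"
      unfolding n using G(1) g(1) by (rule sum.remove)
    also have "int (n g) *s g = int (n g - 1) *s g + g"
      using ng by (simp add: vec_eq_iff of_nat_diff algebra_simps)
    finally have "b = b' + g" by (simp add: b'_def add_ac)
    moreover have "b' \<in> M C" unfolding b'_def
      using G(2) g(1) by (intro submonoid_add[OF subC] submonoid_smult[OF subC]
          submonoid_sum[OF subC]) auto
    ultimately show "\<exists>g\<in>set gs. \<exists>b'\<in>M C. b = b' + g" using g(1) g0 gl(1) by blast
  qed
  then have "inj_on (local_cohomology_frobenius R p xs i) (carrier (local_cohomology R xs i))"
    using Finj elements unfolding F_injective_def by blast
  then show False using ninj by blast
qed

end

theorem theorem6p3:
  fixes \<Sigma> :: "(real ^ 'd) set set"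
    and M :: "(real ^ 'd) set \<Rightarrow> (int ^ 'd) set"
    and p :: nat
    and u :: "'u itself"
  assumes "CHAR('k::field) = p" and "p > 0"
    and "rational_pointed_fan \<Sigma>"
    and "seminormal_complex \<Sigma> M"
  defines "mring \<equiv> \<lambda>C. (monoid_ring (M C) :: ((int ^ 'd) \<Rightarrow>\<^sub>0 'k) ring)"
    and "tring \<equiv> (toric_face_ring \<Sigma> M :: ((int ^ 'd) \<Rightarrow>\<^sub>0 'k) ring)"
  shows "(\<forall>C\<in>maximal_cones \<Sigma>. F_pure u p (mring C) \<longleftrightarrow>
            F_injective p (mring C) (monomial_ideal (mring C)))
    \<and> ((\<forall>C\<in>maximal_cones \<Sigma>. F_pure u p (mring C)) \<longleftrightarrow>
         (\<forall>C\<in>maximal_cones \<Sigma>. \<forall>D. cone_face D C \<longrightarrow>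
            \<not> associated_prime \<Z> (saturation_quotient (M C) (M D)) (PIdl\<^bsub>\<Z>\<^esub> (int p))))
    \<and> ((\<forall>C\<in>maximal_cones \<Sigma>. F_pure u p (mring C)) \<longleftrightarrow> F_split p tring)
    \<and> ((\<forall>C\<in>maximal_cones \<Sigma>. F_pure u p (mring C)) \<longleftrightarrow> F_pure u p tring)"
proof -
  interpret seminormal_fan \<Sigma> M using assms(3,4) by unfold_locales
  have prime: "Factorial_Ring.prime p"
    using prime_CHAR_semidom[where 'a='k] assms(1,2) by simp
  define torsion_free where "torsion_free C \<longleftrightarrow> (\<forall>D. cone_face D C \<longrightarrow> \<not> has_torsion p (M C) (M D))" for C
  have assoc: "(\<forall>D. cone_face D C \<longrightarrow>
      \<not> associated_prime \<Z> (saturation_quotient (M C) (M D)) (PIdl\<^bsub>\<Z>\<^esub> (int p))) \<longleftrightarrow> torsion_free C"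
    if "C \<in> \<Sigma>" for C
    unfolding torsion_free_def
    using associated_prime_iff_torsion[OF prime face_monoid_subset[OF that]] by blast
  have ring: "(F_pure u p (mring C) \<longleftrightarrow> torsion_free C) \<and>
      (F_injective p (mring C) (monomial_ideal (mring C)) \<longleftrightarrow> torsion_free C)" if C: "C \<in> \<Sigma>" for C
  proof -
    interpret A: face_algebra "{()}" "\<lambda>_. M C" "mring C" p
      unfolding mring_def by (rule face_algebra_monoid_ring[OF submonoid[OF C] assms(1,2)])
    have 1: "torsion_free C" if "F_pure u p (mring C)"
      unfolding torsion_free_def
    proof (intro allI impI)
      fix D assume D: "cone_face D C"
      show "\<not> has_torsion p (M C) (M D)"
        using A.contracted_imp_difference_mem[OF A.F_pure_imp_contracted[OF that]]
        by (intro difference_closed_imp_no_torsion[OF C D assms(2)]) auto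
    qed
    have 2: "torsion_free C" if "F_injective p (mring C) (monomial_ideal (mring C))"
      using F_injective_imp_no_torsion[OF assms(1,2) C] that unfolding torsion_free_def mring_def by blast
    have 3: "F_pure u p (mring C) \<and> F_injective p (mring C) (monomial_ideal (mring C))" if "torsion_free C"
    proof -
      have "\<exists>\<theta>. A.splitting \<theta>"
        using no_torsion_imp_root[OF C _ assms(2)] that unfolding torsion_free_def
        by (intro A.root_closed_imp_splitting) auto
      then show ?thesis using A.splitting_imp_F_pure A.splitting_imp_F_injective by blast
    qed
    show ?thesis using 1 2 3 by blast
  qed
  interpret T: face_algebra \<Sigma> M tring p
    unfolding tring_def by (rule face_algebra_toric[OF assms(1,2)])
  have contr: "torsion_free C" if "T.frobenius_contracted" "C \<in> \<Sigma>" for C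
    unfolding torsion_free_def
    using difference_closed_imp_no_torsion[OF that(2) _ assms(2)]
      T.contracted_imp_difference_mem[OF that] by blast
  have toric: "F_split p tring \<and> F_pure u p tring" if tf: "\<forall>C\<in>maximal_cones \<Sigma>. torsion_free C"
  proof -
    have "\<exists>\<theta>. T.splitting \<theta>"
    proof (rule T.root_closed_imp_splitting)
      fix i a b e
      assume i: "i \<in> \<Sigma>" and ab: "a \<in> M i" "b \<in> M i" and e: "e \<in> (\<Union>i\<in>\<Sigma>. M i)"
        and eq: "int p *s a + b = int p *s e"
      obtain C where C: "C \<in> maximal_cones \<Sigma>" "i \<subseteq> C" using in_maximal_cone[OF i] .
      have C\<Sigma>: "C \<in> \<Sigma>" by (rule maximal_in_fan[OF C(1)])
      have abC: "a \<in> M C" "b \<in> M C"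
        using monoid_transfer[OF i C\<Sigma>] ab in_cone[OF i] C(2) by blast+
      obtain j where j: "j \<in> \<Sigma>" "e \<in> M j" using e by blast
      have "int p *s e \<in> M C"
        unfolding eq[symmetric] using abC by (intro submonoid_add[OF submonoid[OF C\<Sigma>]] submonoid_smult[OF submonoid[OF C\<Sigma>]])
      then have "real p *\<^sub>R real_vec e \<in> C" using in_cone[OF C\<Sigma>] by (metis real_vec_smult of_int_of_nat_eq)
      from cone_scale[OF cone[OF C\<Sigma>] this, of "1 / real p"] have "real_vec e \<in> C" using assms(2) by simp
      then have eC: "e \<in> M C" by (rule monoid_transfer[OF j(1) C\<Sigma> j(2)])
      show "\<exists>b'\<in>\<Union>i\<in>\<Sigma>. M i. b = int p *s b'"
        using no_torsion_imp_root[OF C\<Sigma> _ assms(2) abC eC eq] tf C(1) C\<Sigma> unfolding torsion_free_def by blast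
    qed
    then show ?thesis using T.splitting_imp_F_split T.splitting_imp_F_pure by blast
  qed
  have pure: "(\<forall>C\<in>maximal_cones \<Sigma>. F_pure u p (mring C)) \<longleftrightarrow> (\<forall>C\<in>maximal_cones \<Sigma>. torsion_free C)"
    using ring maximal_in_fan by blast
  have "F_split p tring \<Longrightarrow> \<forall>C\<in>maximal_cones \<Sigma>. torsion_free C"
    using contr[OF T.F_split_imp_contracted] maximal_in_fan by blast
  moreover have "F_pure u p tring \<Longrightarrow> \<forall>C\<in>maximal_cones \<Sigma>. torsion_free C"
    using contr[OF T.F_pure_imp_contracted] maximal_in_fan by blast
  moreover have "(\<forall>C\<in>maximal_cones \<Sigma>. torsion_free C) \<longleftrightarrow>
      (\<forall>C\<in>maximal_cones \<Sigma>. \<forall>D. cone_face D C \<longrightarrow>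
        \<not> associated_prime \<Z> (saturation_quotient (M C) (M D)) (PIdl\<^bsub>\<Z>\<^esub> (int p)))"
    using assoc maximal_in_fan by blast
  ultimately show ?thesis
    unfolding pure using ring maximal_in_fan toric by blast
qed

end
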